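(* Let $\lambda\vdash n$ be a partition of a positive integer $n$. Then, for $s\in\mathbb{C}$ with $\Re(s)>1$, $$\zeta_\lambda(\{s\}^\lambda)=\sum_{\mu\vdash n}\frac{\chi^\lambda(\mu)}{z_\mu}\prod_{i=1}^{\ell(\mu)}\zeta(\mu_is).$$ Here $z_\mu=\prod_{i\ge1}i^{m_i(\mu)}m_i(\mu)!$ and $\chi^\lambda(\mu)\in\mathbb{Z}$ is the value of the character $\chi^\lambda$ of the irreducible representation of the symmetric group $S_n$ corresponding to $\lambda$ on the conjugacy class of $S_n$ of cycle type $\mu$.
   Context: $\{s\}^\lambda$ is the filling of the Young diagram $D(\lambda)=\{(i,j):1\le i\le\ell(\lambda),\ 1\le j\le\lambda_i\}$ with all entries equal to $s$. For a filling $\boldsymbol{s}=(s_{ij})$ of $D(\lambda)$ by complex numbers, $\zeta_\lambda(\boldsymbol{s})=\sum_{(m_{ij})}\prod_{(i,j)\in D(\lambda)}m_{ij}^{-s_{ij}}$, the sum running over semi-standard Young tableaux $(m_{ij})$ of shape $\lambda$ (positive integer entries, rows weakly increasing, columns strictly increasing). $\ell(\mu)$ is the number of parts of $\mu$, $m_i(\mu)$ is the multiplicity of $i$ as a part of $\mu$, and $\zeta(\cdot)$ of one variable is the Riemann zeta function. *)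

theory Defs
  imports
    "HOL-Analysis.Analysis"
    "HOL-Combinatorics.Permutations"
    "HOL-Combinatorics.Orbits"
    "HOL-Library.Function_Algebras"
    "HOL-Library.Multiset"
begin

section \<open>Partitions, tableaux and zeta functions\<close>

definition partitions :: "nat \<Rightarrow> nat list set" where
  "partitions n = {mu. sorted_wrt (\<ge>) mu \<and> 0 \<notin> set mu \<and> sum_list mu = n}"

text \<open>Cells are 1-based, while list indexing is 0-based: the \<open>i\<close>-th part of \<open>lam\<close> is
  \<open>lam ! (i - 1)\<close>.\<close>

definition diagram :: "nat list \<Rightarrow> (nat \<times> nat) set" where
  "diagram lam = {(i, j). 1 \<le> i \<and> i \<le> length lam \<and> 1 \<le> j \<and> j \<le> lam ! (i - 1)}"

text \<open>Tableaux are extensional functions, so that each filling of the diagram is counted once.\<close>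

definition SSYT :: "nat list \<Rightarrow> (nat \<times> nat \<Rightarrow> nat) set" where
  "SSYT lam = {m \<in> diagram lam \<rightarrow>\<^sub>E {1..}.
     (\<forall>i j. (i, j) \<in> diagram lam \<and> (i, j + 1) \<in> diagram lam \<longrightarrow> m (i, j) \<le> m (i, j + 1)) \<and>
     (\<forall>i j. (i, j) \<in> diagram lam \<and> (i + 1, j) \<in> diagram lam \<longrightarrow> m (i, j) < m (i + 1, j))}"

definition schur_zeta :: "nat list \<Rightarrow> (nat \<times> nat \<Rightarrow> complex) \<Rightarrow> complex" where
  "schur_zeta lam s =
     (\<Sum>\<^sub>\<infinity>m\<in>SSYT lam. \<Prod>c\<in>diagram lam. of_nat (m c) powr (- s c))"

text \<open>The Dirichlet series, which is the Riemann zeta function on \<open>Re s > 1\<close>;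
  it carries no meaning for other \<open>s\<close>.\<close>

definition riemann_zeta :: "complex \<Rightarrow> complex" where
  "riemann_zeta s = (\<Sum>k. of_nat (Suc k) powr (- s))"

text \<open>Both series converge absolutely in the relevant range, so neither definition falls back to
  a default value there.\<close>

lemma riemann_zeta_summable:
  assumes "Re s > 1"
  shows "summable (\<lambda>k. norm (of_nat (Suc k) powr (- s)))"
proof -
  have "norm (of_nat (Suc k) powr (- s)) = real (Suc k) powr (- Re s)" for k
    by (subst norm_powr_real_powr) (auto simp del: of_nat_Suc)
  moreover have "summable (\<lambda>k. real (Suc k) powr (- Re s))"
    using assms by (subst summable_Suc_iff) (simp add: summable_real_powr_iff)
  ultimately show ?thesis by simp
qed

lemma finite_diagram: "finite (diagram lam)"
proof (rule finite_subset)
  show "diagram lam \<subseteq> {1..length lam} \<times> {1..Max (set lam)}"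
    by (auto simp: diagram_def intro!: order_trans[OF _ Max_ge[OF _ nth_mem]])
qed auto

lemma schur_zeta_summable:
  assumes "\<And>c. c \<in> diagram lam \<Longrightarrow> Re (s c) > 1"
  shows "(\<lambda>m. \<Prod>c\<in>diagram lam. of_nat (m c) powr (- s c) :: complex) summable_on SSYT lam"
proof -
  let ?f = "\<lambda>c k. of_nat k powr (- s c) :: complex"
  have 1: "Infinite_Set_Sum.abs_summable_on (?f c) {1..}" if "c \<in> diagram lam" for c
  proof -
    have "Infinite_Set_Sum.abs_summable_on (\<lambda>k. ?f c (Suc k)) UNIV"
      unfolding abs_summable_on_nat_iff' by (rule riemann_zeta_summable[OF assms[OF that]])
    moreover have "bij_betw Suc UNIV {1..}"
      by (auto simp: bij_betw_def image_def Suc_le_eq gr0_conv_Suc)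
    ultimately show ?thesis
      using abs_summable_on_reindex_bij_betw[of Suc UNIV "{1..}" "?f c"] by blast
  qed
  have "Infinite_Set_Sum.abs_summable_on (\<lambda>m. \<Prod>c\<in>diagram lam. ?f c (m c))
          (diagram lam \<rightarrow>\<^sub>E {1..})"
    by (rule abs_summable_on_prod_PiE) (use 1 finite_diagram in auto)
  hence "Infinite_Set_Sum.abs_summable_on (\<lambda>m. \<Prod>c\<in>diagram lam. ?f c (m c)) (SSYT lam)"
    by (rule abs_summable_on_subset) (auto simp: SSYT_def)
  thus ?thesis
    by (simp add: abs_summable_equivalent[symmetric] abs_summable_summable)
qed

definition z_part :: "nat list \<Rightarrow> nat" where
  "z_part mu = (\<Prod>i\<in>set mu. i ^ count_list mu i * fact (count_list mu i))"


section \<open>Irreducible characters of the symmetric group\<close>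

text \<open>
  The irreducible representation of \<open>S\<^sub>n\<close> (the permutations of \<open>{1..n}\<close>) attached to \<open>lam\<close> is
  the left ideal of the complex group algebra generated by the Young symmetrizer
  \<open>c = a b\<close>, where \<open>a\<close> is the sum over the row stabilizer and \<open>b\<close> the signed sum over the
  column stabilizer of the tableau that lists \<open>1, \<dots>, n\<close> row by row. With this convention
  \<open>lam = [n]\<close> gives the trivial and \<open>lam = [1, \<dots>, 1]\<close> the sign representation.

  A group algebra element is the function of its coefficients.
\<close>

definition gscale :: "complex \<Rightarrow> ((nat \<Rightarrow> nat) \<Rightarrow> complex) \<Rightarrow> ((nat \<Rightarrow> nat) \<Rightarrow> complex)" where
  "gscale a f = (\<lambda>g. a * f g)"

interpretation galg: vector_space gscale
  by unfold_locales (auto simp: gscale_def fun_eq_iff algebra_simps)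

text \<open>The coefficient of \<open>h\<close> in \<open>g \<cdot> f\<close> is the coefficient of \<open>g\<inverse>h\<close> in \<open>f\<close>.\<close>

definition left_mult ::
    "(nat \<Rightarrow> nat) \<Rightarrow> ((nat \<Rightarrow> nat) \<Rightarrow> complex) \<Rightarrow> ((nat \<Rightarrow> nat) \<Rightarrow> complex)" where
  "left_mult g f = (\<lambda>h. f (inv g \<circ> h))"

definition row_reading :: "nat list \<Rightarrow> nat \<times> nat \<Rightarrow> nat" where
  "row_reading lam = (\<lambda>(i, j). sum_list (take (i - 1) lam) + j)"

definition tableau_row :: "nat list \<Rightarrow> nat \<Rightarrow> nat set" where
  "tableau_row lam i = {row_reading lam (i, j) | j. (i, j) \<in> diagram lam}"

definition tableau_col :: "nat list \<Rightarrow> nat \<Rightarrow> nat set" where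
  "tableau_col lam j = {row_reading lam (i, j) | i. (i, j) \<in> diagram lam}"

definition row_stab :: "nat list \<Rightarrow> (nat \<Rightarrow> nat) set" where
  "row_stab lam = {p. p permutes {1..sum_list lam} \<and>
     (\<forall>i. p ` tableau_row lam i = tableau_row lam i)}"

definition col_stab :: "nat list \<Rightarrow> (nat \<Rightarrow> nat) set" where
  "col_stab lam = {q. q permutes {1..sum_list lam} \<and>
     (\<forall>j. q ` tableau_col lam j = tableau_col lam j)}"

definition young_symmetrizer :: "nat list \<Rightarrow> (nat \<Rightarrow> nat) \<Rightarrow> complex" where
  "young_symmetrizer lam =
     (\<lambda>g. \<Sum>p\<in>row_stab lam. \<Sum>q\<in>col_stab lam. if g = p \<circ> q then of_int (sign q) else 0)"

definition specht :: "nat list \<Rightarrow> ((nat \<Rightarrow> nat) \<Rightarrow> complex) set" where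
  "specht lam =
     galg.span {left_mult g (young_symmetrizer lam) | g. g permutes {1..sum_list lam}}"

text \<open>Trace of an operator \<open>T\<close> on a finite-dimensional \<open>T\<close>-invariant subspace \<open>V\<close>, computed in
  an arbitrary basis of \<open>V\<close>.\<close>

definition trace_on ::
    "((nat \<Rightarrow> nat) \<Rightarrow> complex) set \<Rightarrow>
     (((nat \<Rightarrow> nat) \<Rightarrow> complex) \<Rightarrow> ((nat \<Rightarrow> nat) \<Rightarrow> complex)) \<Rightarrow> complex" where
  "trace_on V T =
     (let B = (SOME B. galg.independent B \<and> galg.span B = V)
      in \<Sum>b\<in>B. galg.representation B (T b) b)"

definition irr_char :: "nat list \<Rightarrow> (nat \<Rightarrow> nat) \<Rightarrow> complex" where
  "irr_char lam g = trace_on (specht lam) (left_mult g)"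

text \<open>\<open>orbit g x\<close> is the support of the cycle of \<open>g\<close> through \<open>x\<close>, also for fixed points.\<close>

definition cycle_type :: "nat \<Rightarrow> (nat \<Rightarrow> nat) \<Rightarrow> nat multiset" where
  "cycle_type n g = image_mset card (mset_set (orbit g ` {1..n}))"

text \<open>The character is a class function, so its value may be taken at any permutation of cycle
  type \<open>mu\<close>.\<close>

definition chi :: "nat list \<Rightarrow> nat list \<Rightarrow> complex" where
  "chi lam mu = irr_char lam
     (SOME g. g permutes {1..sum_list lam} \<and> cycle_type (sum_list lam) g = mset mu)"

end

theory Submission
  imports Defs
begin

text \<open>Let \<open>N = {1..n}\<close>, and let the permutations of \<open>N\<close> act on words \<open>w\<close> (maps from \<open>N\<close> to the positive
integers) by \<open>w \<circ> g\<close>. On functions of words consider the operator \<open>symmetrize\<close>, which first sums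
over the row permutations \<open>p\<close> and then sums with signs over the column permutations \<open>q\<close> of the
diagram. The permutations of \<open>N\<close> are themselves words, and on functions supported on them
\<open>symmetrize\<close> is right multiplication by the Young symmetrizer; so the Specht module is an image of
\<open>symmetrize\<close>, and any statement about such images on an arbitrary finite set \<open>W\<close> of words that is
closed under rearrangement covers the Specht module and the weight spaces of tensor space at once.

The central fact is the semistandard basis theorem: the images \<open>polytabloid T\<close> of the unit
functions at the semistandard words \<open>T \<in> W\<close> form a basis of the image of the functions on \<open>W\<close>. They
span by straightening with Garnir relations (\<open>straighten\<close>), and they are independent by a
triangularity argument (\<open>polytabloid_triangular\<close>). Taking for \<open>W\<close> the rearrangements of the word of
row indices, which contain exactly one semistandard word, it follows that \<open>symmetrize\<close> squares to
a multiple \<open>\<kappa>\<close> of itself; the scalar \<open>\<kappa>\<close> is nonzero because row sums and signed column sums are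
self-adjoint. Hence \<open>symmetrize / \<kappa>\<close> is idempotent, and two traces can be computed in two ways.

On the functions on \<open>W\<close> the trace of the idempotent is the number of semistandard words in \<open>W\<close>
(\<open>card_semistandard\<close>). On the Specht module the trace of left multiplication by \<open>g\<close> is the character
value at \<open>g\<close> (\<open>trace_on_specht\<close>); it is an integer because words with distinct entries straighten
with integer coefficients, so that \<open>g\<close> has an integer matrix in the standard basis.

Up to the factor \<open>1 / \<kappa>\<close>, both traces are also sums of \<open>sign q\<close> over the pairs \<open>(q, p)\<close>, weighted by a number of fixed words.
For the character, \<open>w\<close> is counted if it conjugates \<open>q \<circ> p\<close> to \<open>g\<close>; there are \<open>z\<^sub>\<mu>\<close> such \<open>w\<close> if both
permutations have cycle type \<open>\<mu>\<close>, and none otherwise (\<open>card_conjugators\<close>). This says that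
\<open>\<chi>(\<mu>) / z\<^sub>\<mu>\<close> is the sum of \<open>sign q / \<kappa>\<close> over the pairs with \<open>q \<circ> p\<close> of cycle type \<open>\<mu>\<close>. For the words,
the monomials \<open>\<Prod>x. f x powr (- s)\<close> of the words \<open>f\<close> that are fixed by \<open>q \<circ> p\<close> add up to the product
of the \<open>\<zeta>(\<mu>\<^sub>i s)\<close> (\<open>infsum_fixed_words\<close>), since such an \<open>f\<close> is constant on cycles. Comparing the two
gives the formula.\<close>

section \<open>Averaging over groups of permutations\<close>

definition perm_group :: "'a set \<Rightarrow> ('a \<Rightarrow> 'a) set \<Rightarrow> bool" where
  "perm_group N G \<longleftrightarrow> (\<forall>p\<in>G. p permutes N) \<and> id \<in> G \<and>
     (\<forall>p\<in>G. \<forall>q\<in>G. p \<circ> q \<in> G) \<and> (\<forall>p\<in>G. inv p \<in> G)"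

lemma perm_groupD:
  assumes "perm_group N G"
  shows "p \<in> G \<Longrightarrow> p permutes N" "id \<in> G" "p \<in> G \<Longrightarrow> q \<in> G \<Longrightarrow> p \<circ> q \<in> G"
    "p \<in> G \<Longrightarrow> inv p \<in> G"
  using assms by (auto simp: perm_group_def)

lemma perm_group_all: "perm_group N {p. p permutes N}"
  by (auto simp: perm_group_def permutes_compose permutes_inv)

lemma perm_comp_inv:
  assumes "p permutes N"
  shows "p \<circ> inv p = id" "inv p \<circ> p = id" "p \<circ> (inv p \<circ> f) = f" "inv p \<circ> (p \<circ> f) = f"
    "h \<circ> p \<circ> inv p = h" "h \<circ> inv p \<circ> p = h" "inv (inv p) = p"
  using permutes_inv_o[OF assms] permutes_inv_inv[OF assms]
  by (auto simp: fun_eq_iff o_def permutes_inverses[OF assms])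

lemma sum_group_left:
  assumes "perm_group N G" "g \<in> G"
  shows "(\<Sum>p\<in>G. f (g \<circ> p)) = (\<Sum>p\<in>G. f p)"
  by (rule sum.reindex_bij_witness[where i = "\<lambda>p. inv g \<circ> p" and j = "\<lambda>p. g \<circ> p"])
     (use assms in \<open>auto simp: perm_groupD[OF assms(1)] perm_comp_inv[OF perm_groupD(1)[OF assms]]\<close>)

lemma sum_group_right:
  assumes "perm_group N G" "g \<in> G"
  shows "(\<Sum>p\<in>G. f (p \<circ> g)) = (\<Sum>p\<in>G. f p)"
  by (rule sum.reindex_bij_witness[where i = "\<lambda>p. p \<circ> inv g" and j = "\<lambda>p. p \<circ> g"])
     (use assms in \<open>auto simp: perm_groupD[OF assms(1)] perm_comp_inv[OF perm_groupD(1)[OF assms]]\<close>)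

lemma sum_group_inv:
  assumes "perm_group N G"
  shows "(\<Sum>p\<in>G. f (inv p)) = (\<Sum>p\<in>G. f p)"
  by (rule sum.reindex_bij_witness[where i = inv and j = inv])
     (use assms in \<open>auto simp: perm_groupD[OF assms(1)] perm_comp_inv[OF perm_groupD(1)[OF assms]]\<close>)

section \<open>Functions on words and traces\<close>

definition delta :: "(nat \<Rightarrow> nat) \<Rightarrow> (nat \<Rightarrow> nat) \<Rightarrow> complex" where
  "delta w = (\<lambda>u. if u = w then 1 else 0)"

lemma sum_fun_apply: "sum f A x = (\<Sum>i\<in>A. f i x)"
  by (induction A rule: infinite_finite_induct) auto

lemma expand_delta:
  assumes "finite W" "\<And>w. w \<notin> W \<Longrightarrow> F w = 0"
  shows "F = (\<Sum>w\<in>W. gscale (F w) (delta w))"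
proof
  fix u
  have "(\<Sum>w\<in>W. F w * delta w u) = (\<Sum>w\<in>W. if w = u then F u else 0)"
    by (rule sum.cong) (auto simp: delta_def)
  thus "F u = (\<Sum>w\<in>W. gscale (F w) (delta w)) u"
    using assms by (auto simp: sum_fun_apply gscale_def)
qed

text \<open>The formula does not mention the basis, so it serves both to compute the trace in a basis about
which nothing is known and to compare it with the trace in a convenient one. It comes from
expanding each \<open>b\<close> in the unit functions \<open>delta w\<close> and summing over \<open>b\<close> first.\<close>

lemma basis_trace:
  assumes W: "finite W" and B: "finite B" "galg.independent B"
    and supp: "\<And>b w. b \<in> B \<Longrightarrow> w \<notin> W \<Longrightarrow> b w = 0"
    and Q: "Vector_Spaces.linear gscale gscale Q"
    and QW: "\<And>w. w \<in> W \<Longrightarrow> Q (delta w) \<in> galg.span B"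
  shows "(\<Sum>b\<in>B. galg.representation B (Q b) b) = (\<Sum>w\<in>W. Q (delta w) w)"
proof -
  interpret Q: Vector_Spaces.linear gscale gscale Q by (rule Q)
  have "galg.representation B (Q b) b = (\<Sum>w\<in>W. b w * galg.representation B (Q (delta w)) b)"
    if b: "b \<in> B" for b
  proof -
    have "Q b = (\<Sum>w\<in>W. gscale (b w) (Q (delta w)))"
      by (subst expand_delta[OF W supp[OF b]]) (simp_all add: Q.sum Q.scale)
    thus ?thesis
      using QW B by (simp add: galg.representation_sum galg.representation_scale galg.span_scale)
  qed
  hence "(\<Sum>b\<in>B. galg.representation B (Q b) b)
       = (\<Sum>w\<in>W. \<Sum>b\<in>B. gscale (galg.representation B (Q (delta w)) b) b w)"
    by (subst sum.swap) (simp add: gscale_def mult.commute)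
  also have "\<dots> = (\<Sum>w\<in>W. Q (delta w) w)"
    by (rule sum.cong) (use QW B in \<open>simp_all add: galg.sum_representation_eq flip: sum_fun_apply[of "\<lambda>b. gscale (galg.representation B _ b) b"]\<close>)
  finally show ?thesis .
qed

section \<open>Sorting within blocks\<close>

definition block_stab :: "nat set \<Rightarrow> (nat \<Rightarrow> nat) \<Rightarrow> (nat \<Rightarrow> nat) set" where
  "block_stab N f = {p. p permutes N \<and> (\<forall>x\<in>N. f (p x) = f x)}"

lemma perm_group_stab: "perm_group N (block_stab N f)"
  unfolding perm_group_def
proof (intro conjI ballI)
  fix p assume p: "p \<in> block_stab N f"
  hence pN: "p permutes N" by (simp add: block_stab_def)
  have "f (inv p x) = f x" if "x \<in> N" for x
  proof -
    have "inv p x \<in> N" using that pN by (simp add: permutes_in_image permutes_inv)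
    hence "f (p (inv p x)) = f (inv p x)" using p by (simp add: block_stab_def)
    thus ?thesis using permutes_inverses(1)[OF pN] by simp
  qed
  thus "inv p \<in> block_stab N f" using p by (auto simp: block_stab_def permutes_inv)
qed (auto simp: block_stab_def permutes_compose permutes_in_image)

lemma finite_stab: "finite N \<Longrightarrow> finite (block_stab N f)"
  by (rule finite_subset[OF _ finite_permutations[of N]]) (auto simp: block_stab_def)

lemma transpose_in_stab:
  "x \<in> N \<Longrightarrow> y \<in> N \<Longrightarrow> f x = f y \<Longrightarrow> Transposition.transpose x y \<in> block_stab N f"
  by (auto simp: block_stab_def permutes_swap_id Transposition.transpose_def)

lemma comp_perm_cancel:
  assumes "p permutes N"
  shows "f \<circ> p = g \<circ> p \<longleftrightarrow> f = g"
  using perm_comp_inv(5)[OF assms] by metis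

definition weight :: "nat set \<Rightarrow> (nat \<Rightarrow> nat) \<Rightarrow> (nat \<Rightarrow> nat) \<Rightarrow> nat" where
  "weight N r w = (\<Sum>x\<in>N. r x * w x)"

definition block_sorted :: "nat set \<Rightarrow> (nat \<Rightarrow> nat) \<Rightarrow> (nat \<Rightarrow> nat) \<Rightarrow> (nat \<Rightarrow> nat) \<Rightarrow> bool" where
  "block_sorted N f r w \<longleftrightarrow> (\<forall>x\<in>N. \<forall>y\<in>N. f x = f y \<longrightarrow> r x < r y \<longrightarrow> w x \<le> w y)"

text \<open>Exchanging an inversion inside a block increases \<open>weight\<close>, so an arrangement of maximal weight has
no inversion. This provides sorted arrangements, and it also turns \<open>weight\<close> into a measure of how
far an arrangement is from being sorted.\<close>

lemma weight_maximal_sorted: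
  assumes N: "finite N" and p: "p \<in> block_stab N f"
    and max: "\<And>q. q \<in> block_stab N f \<Longrightarrow> weight N r (w \<circ> q) \<le> weight N r (w \<circ> p)"
  shows "block_sorted N f r (w \<circ> p)"
  unfolding block_sorted_def
proof (intro ballI impI, rule ccontr)
  fix x y assume xy: "x \<in> N" "y \<in> N" "f x = f y" "r x < r y" "\<not> (w \<circ> p) x \<le> (w \<circ> p) y"
  let ?t = "Transposition.transpose x y"
  have split: "weight N r u = r x * u x + r y * u y + (\<Sum>z\<in>N - {x} - {y}. r z * u z)" for u
    unfolding weight_def using N xy
    by (subst sum.remove[of N x], simp, simp, subst sum.remove[of _ y]) auto
  have "(\<Sum>z\<in>N - {x} - {y}. r z * (w \<circ> (p \<circ> ?t)) z) = (\<Sum>z\<in>N - {x} - {y}. r z * (w \<circ> p) z)"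
    by (rule sum.cong) (auto simp: Transposition.transpose_def)
  moreover have "r x * w (p x) + r y * w (p y) < r x * w (p y) + r y * w (p x)"
  proof -
    obtain d e where "r y = r x + Suc d" "w (p x) = w (p y) + Suc e"
      using xy by (auto simp: not_le dest!: less_imp_Suc_add)
    thus ?thesis by (simp add: algebra_simps)
  qed
  ultimately have "weight N r (w \<circ> p) < weight N r (w \<circ> (p \<circ> ?t))"
    by (simp add: split)
  moreover have "p \<circ> ?t \<in> block_stab N f"
    using perm_groupD(3)[OF perm_group_stab] p transpose_in_stab[OF xy(1-3)] by blast
  ultimately show False using max[of "p \<circ> ?t"] by simp
qed

lemma weight_maximal_exists:
  assumes "finite N"
  obtains p where "p \<in> block_stab N f"
    "\<And>q. q \<in> block_stab N f \<Longrightarrow> weight N r (w \<circ> q) \<le> weight N r (w \<circ> p)"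
proof -
  let ?S = "(\<lambda>q. weight N r (w \<circ> q)) ` block_stab N f"
  have S: "finite ?S" "?S \<noteq> {}"
    using finite_stab[OF assms] perm_groupD(2)[OF perm_group_stab] by auto
  from Max_in[OF S] obtain p where "p \<in> block_stab N f" "Max ?S = weight N r (w \<circ> p)" by auto
  moreover from this have "weight N r (w \<circ> q) \<le> weight N r (w \<circ> p)" if "q \<in> block_stab N f" for q
    using Max_ge[OF S(1), of "weight N r (w \<circ> q)"] that by simp
  ultimately show ?thesis using that by blast
qed

text \<open>In each block the entries that are at most \<open>k\<close> form an initial segment with respect to \<open>r\<close>, for
\<open>u\<close> as well as for \<open>u \<circ> p\<close>. Both segments have the same size, hence are equal, for every \<open>k\<close>.\<close>

lemma block_sorted_unique:
  assumes N: "finite N" and p: "p \<in> block_stab N f"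
    and inj: "\<And>x y. x \<in> N \<Longrightarrow> y \<in> N \<Longrightarrow> f x = f y \<Longrightarrow> r x = r y \<Longrightarrow> x = y"
    and sorted: "block_sorted N f r u" "block_sorted N f r (u \<circ> p)"
  shows "u \<circ> p = u"
proof
  fix x
  have pN: "p permutes N" using p by (simp add: block_stab_def)
  define A where "A = (\<lambda>v k. {y\<in>N. f y = f x \<and> v y \<le> (k::nat)})"
  have same: "A (u \<circ> p) k = A u k" for k
  proof -
    have "A u k \<subseteq> A (u \<circ> p) k \<or> A (u \<circ> p) k \<subseteq> A u k"
    proof (rule ccontr)
      assume "\<not> ?thesis"
      then obtain y z where yz: "y \<in> A u k" "y \<notin> A (u \<circ> p) k" "z \<in> A (u \<circ> p) k" "z \<notin> A u k"
        by blast
      hence mem: "y \<in> N" "z \<in> N" "f y = f z" "f z = f y" "y \<noteq> z"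
        and lt: "u y < u z" "(u \<circ> p) z < (u \<circ> p) y" by (auto simp: A_def)
      hence "r y \<noteq> r z" using inj by blast
      hence "r y < r z \<or> r z < r y" by linarith
      hence "(u \<circ> p) y \<le> (u \<circ> p) z \<or> u z \<le> u y"
        using sorted mem(1-4) unfolding block_sorted_def by blast
      thus False using lt by linarith
    qed
    moreover have "card (A (u \<circ> p) k) = card (A u k)"
    proof (rule bij_betw_same_card[of p])
      have "p ` A (u \<circ> p) k = A u k"
      proof
        show "p ` A (u \<circ> p) k \<subseteq> A u k"
          using p by (auto simp: A_def block_stab_def permutes_in_image)
        show "A u k \<subseteq> p ` A (u \<circ> p) k"
        proof
          fix y assume y: "y \<in> A u k"
          have "inv p y \<in> N" using y pN by (auto simp: A_def permutes_in_image permutes_inv)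
          moreover have "f (inv p y) = f y"
            using perm_groupD(4)[OF perm_group_stab p] y by (simp add: A_def block_stab_def)
              ultimately have "inv p y \<in> A (u \<circ> p) k"
            using y pN by (auto simp: A_def permutes_inverses)
          thus "y \<in> p ` A (u \<circ> p) k" using pN by (metis image_eqI permutes_inverses(1))
        qed
      qed
      thus "bij_betw p (A (u \<circ> p) k) (A u k)"
        using permutes_inj_on[OF pN] by (auto simp: bij_betw_def)
    qed
    moreover have "finite (A v k)" for v using N by (simp add: A_def)
    ultimately show ?thesis by (metis card_subset_eq)
  qed
  show "(u \<circ> p) x = u x"
  proof (cases "x \<in> N")
    case True
    hence "x \<in> A u (u x)" "x \<in> A (u \<circ> p) ((u \<circ> p) x)" by (auto simp: A_def)
    hence "x \<in> A (u \<circ> p) (u x)" "x \<in> A u ((u \<circ> p) x)" by (simp_all only: same)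
    thus ?thesis by (auto simp: A_def)
  next
    case False
    thus ?thesis using permutes_not_in[OF pN] by simp
  qed
qed

text \<open>An arrangement of maximal weight is sorted, hence equal to \<open>u\<close> by uniqueness.\<close>

lemma weight_sorted_maximal:
  assumes N: "finite N" and q: "q \<in> block_stab N f"
    and inj: "\<And>x y. x \<in> N \<Longrightarrow> y \<in> N \<Longrightarrow> f x = f y \<Longrightarrow> r x = r y \<Longrightarrow> x = y"
    and sorted: "block_sorted N f r u"
  shows "weight N r (u \<circ> q) \<le> weight N r u"
    and "weight N r (u \<circ> q) = weight N r u \<Longrightarrow> u \<circ> q = u"
proof -
  obtain p where p: "p \<in> block_stab N f"
    "\<And>q. q \<in> block_stab N f \<Longrightarrow> weight N r (u \<circ> q) \<le> weight N r (u \<circ> p)"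
    using weight_maximal_exists[OF N] by metis
  have "u \<circ> p = u"
    by (rule block_sorted_unique[OF N p(1) inj sorted weight_maximal_sorted[OF N p]])
  hence max: "weight N r (u \<circ> q') \<le> weight N r u" if "q' \<in> block_stab N f" for q'
    using p(2)[OF that] by simp
  show "weight N r (u \<circ> q) \<le> weight N r u" by (rule max[OF q])
  assume eq: "weight N r (u \<circ> q) = weight N r u"
  show "u \<circ> q = u"
    by (rule block_sorted_unique[OF N q inj sorted weight_maximal_sorted[OF N q]])
       (use eq max in auto)
qed

lemma weight_block_constant:
  assumes "p \<in> block_stab N r"
  shows "weight N r (w \<circ> p) = weight N r w"
proof -
  have "weight N r (w \<circ> p) = (\<Sum>x\<in>N. r (p x) * w (p x))"
    unfolding weight_def using assms by (intro sum.cong) (auto simp: block_stab_def)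
  also have "\<dots> = weight N r w"
    unfolding weight_def using assms sum.permute[of p N "\<lambda>x. r x * w x"]
    by (simp add: block_stab_def o_def)
  finally show ?thesis .
qed

section \<open>The Young symmetrizer acting on words\<close>

text \<open>A Young diagram whose cells carry the labels \<open>N\<close>; \<open>cell_below\<close> says that it is closed under moving up
and to the left. Working with labels instead of cells makes words and permutations functions of
the same type.\<close>

locale young_cells =
  fixes N :: "nat set" and row col :: "nat \<Rightarrow> nat"
  assumes finite_N: "finite N"
    and cell_inj: "x \<in> N \<Longrightarrow> y \<in> N \<Longrightarrow> row x = row y \<Longrightarrow> col x = col y \<Longrightarrow> x = y"
    and cell_pos: "x \<in> N \<Longrightarrow> 1 \<le> row x" "x \<in> N \<Longrightarrow> 1 \<le> col x"
    and cell_below: "x \<in> N \<Longrightarrow> 1 \<le> i \<Longrightarrow> i \<le> row x \<Longrightarrow> 1 \<le> j \<Longrightarrow> j \<le> col x \<Longrightarrow>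
      \<exists>y\<in>N. row y = i \<and> col y = j"
begin

abbreviation "S \<equiv> {g. g permutes N}"
abbreviation "R \<equiv> block_stab N row"
abbreviation "C \<equiv> block_stab N col"

lemma finite_S: "finite S" and finite_R: "finite R" and finite_C: "finite C"
  using finite_N by (auto intro: finite_permutations finite_stab)

lemma R_perm: "p \<in> R \<Longrightarrow> p permutes N" and C_perm: "q \<in> C \<Longrightarrow> q permutes N"
  by (auto simp: block_stab_def)

definition row_sum :: "((nat \<Rightarrow> nat) \<Rightarrow> complex) \<Rightarrow> (nat \<Rightarrow> nat) \<Rightarrow> complex" where
  "row_sum F = (\<lambda>w. \<Sum>p\<in>R. F (w \<circ> p))"

definition col_alt :: "((nat \<Rightarrow> nat) \<Rightarrow> complex) \<Rightarrow> (nat \<Rightarrow> nat) \<Rightarrow> complex" where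
  "col_alt F = (\<lambda>w. \<Sum>q\<in>C. of_int (sign q) * F (w \<circ> q))"

text \<open>On functions supported on the permutations of \<open>N\<close> this is right multiplication by the Young
symmetrizer; the order of the two steps is the one that belongs to \<open>a b\<close> rather than \<open>b a\<close>.\<close>

definition symmetrize :: "((nat \<Rightarrow> nat) \<Rightarrow> complex) \<Rightarrow> (nat \<Rightarrow> nat) \<Rightarrow> complex" where
  "symmetrize F = col_alt (row_sum F)"

lemma symmetrize_apply:
  "symmetrize F w = (\<Sum>q\<in>C. \<Sum>p\<in>R. of_int (sign q) * F (w \<circ> q \<circ> p))"
  by (simp add: symmetrize_def col_alt_def row_sum_def sum_distrib_left)

lemma linear_symmetrize: "Vector_Spaces.linear gscale gscale symmetrize"
proof -
  have "symmetrize (F + G) = symmetrize F + symmetrize G" for F G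
    by (simp add: symmetrize_apply fun_eq_iff sum.distrib algebra_simps)
  moreover have "symmetrize (gscale c F) = gscale c (symmetrize F)" for c F
    by (simp add: symmetrize_apply fun_eq_iff gscale_def sum_distrib_left algebra_simps)
  ultimately show ?thesis
    by (simp add: Vector_Spaces.linear_def module_hom_def module_hom_axioms_def
        galg.vector_space_axioms galg.module_axioms)
qed

definition semistandard :: "(nat \<Rightarrow> nat) \<Rightarrow> bool" where
  "semistandard w \<longleftrightarrow> block_sorted N row col w \<and>
     (\<forall>x\<in>N. \<forall>y\<in>N. col x = col y \<longrightarrow> row x < row y \<longrightarrow> w x < w y)"

abbreviation "polytabloid w \<equiv> symmetrize (delta w)"

lemma polytabloid_row:
  assumes "p \<in> R"
  shows "polytabloid (w \<circ> p) = polytabloid w"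
proof
  fix u :: "nat \<Rightarrow> nat"
  have "(\<Sum>p'\<in>R. delta (w \<circ> p) (u \<circ> q \<circ> p')) = (\<Sum>p'\<in>R. delta w (u \<circ> q \<circ> p'))" for q
  proof -
    have "(\<Sum>p'\<in>R. delta (w \<circ> p) (u \<circ> q \<circ> p')) = (\<Sum>p'\<in>R. delta (w \<circ> p) (u \<circ> q \<circ> (p' \<circ> p)))"
      by (rule sum_group_right[OF perm_group_stab assms, symmetric])
    also have "\<dots> = (\<Sum>p'\<in>R. delta w (u \<circ> q \<circ> p'))"
    proof (rule sum.cong)
      fix p' assume "p' \<in> R"
      have "u \<circ> q \<circ> (p' \<circ> p) = w \<circ> p \<longleftrightarrow> u \<circ> q \<circ> p' = w"
        using comp_perm_cancel[OF R_perm[OF assms], of "u \<circ> q \<circ> p'" w] by (simp add: comp_assoc)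
      thus "delta (w \<circ> p) (u \<circ> q \<circ> (p' \<circ> p)) = delta w (u \<circ> q \<circ> p')"
        by (simp add: delta_def)
    qed simp
    finally show ?thesis .
  qed
  thus "polytabloid (w \<circ> p) u = polytabloid w u"
    by (simp add: symmetrize_apply flip: sum_distrib_left)
qed

lemma semistandard_col_sorted: "semistandard w \<Longrightarrow> block_sorted N col row w"
  unfolding semistandard_def block_sorted_def by (meson less_imp_le)

lemma semistandard_weight_C:
  assumes T: "semistandard T" and q: "q \<in> C"
  shows "weight N row (T \<circ> q) \<le> weight N row T"
    and "weight N row (T \<circ> q) = weight N row T \<Longrightarrow> q = id"
proof -
  note * = weight_sorted_maximal[OF finite_N q _ semistandard_col_sorted[OF T]]
  show "weight N row (T \<circ> q) \<le> weight N row T" by (rule *(1)) (auto intro: cell_inj)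
  assume "weight N row (T \<circ> q) = weight N row T"
  hence "T \<circ> q = T" by (rule *(2)[rotated]) (auto intro: cell_inj)
  hence eq: "T (q x) = T x" for x by (auto simp: fun_eq_iff)
  show "q = id"
  proof
    fix x
    show "q x = id x"
    proof (cases "x \<in> N")
      case True
      hence qx: "q x \<in> N" "col (q x) = col x" using q by (auto simp: block_stab_def permutes_in_image)
      moreover have "\<not> row (q x) < row x" "\<not> row x < row (q x)"
        using T True qx eq[of x] unfolding semistandard_def by fastforce+
      ultimately show ?thesis using cell_inj True by simp
    next
      case False
      thus ?thesis using permutes_not_in[OF C_perm[OF q]] by simp
    qed
  qed
qed

text \<open>A nonzero coefficient means that \<open>T\<close> becomes \<open>T'\<close> after a column permutation followed by a row
permutation. The first step lowers the row weight of the column-strict \<open>T\<close> unless it is trivial,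
and the second step preserves it.\<close>

lemma polytabloid_triangular:
  assumes T: "semistandard T" "semistandard T'" and nz: "polytabloid T' T \<noteq> 0"
  shows "T' = T \<or> weight N row T' < weight N row T"
proof -
  have "\<exists>q\<in>C. \<exists>p\<in>R. delta T' (T \<circ> q \<circ> p) \<noteq> 0"
  proof (rule ccontr)
    assume "\<not> ?thesis"
    hence "polytabloid T' T = 0" unfolding symmetrize_apply by (auto intro!: sum.neutral)
    thus False using nz by simp
  qed
  then obtain q p where qp: "q \<in> C" "p \<in> R" "T \<circ> q \<circ> p = T'"
    by (auto simp: delta_def split: if_splits)
  have w: "weight N row T' = weight N row (T \<circ> q)"
    using weight_block_constant[OF qp(2), of "T \<circ> q"] qp(3) by simp
  show ?thesis
  proof (cases "weight N row (T \<circ> q) = weight N row T")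
    case True
    hence "q = id" by (rule semistandard_weight_C(2)[OF T(1) qp(1)])
    hence "T' = T \<circ> p" using qp by simp
    moreover have "T \<circ> p = T"
      using block_sorted_unique[OF finite_N qp(2), of col T] cell_inj T calculation
      by (auto simp: semistandard_def)
    ultimately show ?thesis by simp
  next
    case False
    thus ?thesis using semistandard_weight_C(1)[OF T(1) qp(1)] w by simp
  qed
qed

lemma polytabloid_diagonal:
  assumes T: "semistandard T"
  shows "polytabloid T T \<noteq> 0"
proof -
  have "of_int (sign q) * delta T (T \<circ> q \<circ> p) = (if q = id then delta T (T \<circ> p) else 0)"
    if "q \<in> C" "p \<in> R" for q p
  proof (cases "T \<circ> q \<circ> p = T")
    case True
    hence "weight N row (T \<circ> q) = weight N row T"
      using weight_block_constant[OF that(2), of "T \<circ> q"] by simp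
    thus ?thesis using semistandard_weight_C(2)[OF T that(1)] by simp
  qed (auto simp: delta_def)
  hence "polytabloid T T = (\<Sum>q\<in>C. \<Sum>p\<in>R. if q = id then delta T (T \<circ> p) else 0)"
    by (simp add: symmetrize_apply)
  also have "\<dots> = (\<Sum>q\<in>C. if q = id then (\<Sum>p\<in>R. delta T (T \<circ> p)) else 0)"
    by (rule sum.cong) auto
  also have "\<dots> = (\<Sum>p\<in>R. delta T (T \<circ> p))"
    using finite_C perm_groupD(2)[OF perm_group_stab, of N col] by simp
  also have "\<dots> = of_nat (card {p\<in>R. T \<circ> p = T})"
    using finite_R by (simp add: delta_def sum.If_cases Int_def)
  also have "\<dots> \<noteq> 0"
    using finite_R perm_groupD(2)[OF perm_group_stab, of N row] by (auto simp: card_eq_0_iff)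
  finally show ?thesis .
qed

lemma polytabloid_independent:
  assumes W: "finite W" and ss: "\<And>T. T \<in> W \<Longrightarrow> semistandard T"
  shows "inj_on polytabloid W" and "galg.independent (polytabloid ` W)"
proof -
  show inj: "inj_on polytabloid W"
  proof (rule inj_onI)
    fix T T' assume *: "T \<in> W" "T' \<in> W" "polytabloid T = polytabloid T'"
    hence "polytabloid T T' \<noteq> 0" "polytabloid T' T \<noteq> 0"
      using polytabloid_diagonal ss by metis+
    thus "T = T'" using polytabloid_triangular[OF ss ss] * by (metis less_asym)
  qed
  show "galg.independent (polytabloid ` W)"
  proof (rule galg.independent_if_scalars_zero)
    show "finite (polytabloid ` W)" using W by simp
    fix a x assume 0: "(\<Sum>v\<in>polytabloid ` W. gscale (a v) v) = 0" and x: "x \<in> polytabloid ` W"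
    have "a (polytabloid T) = 0" if "T \<in> W" for T
      using that
    proof (induction "weight N row T" arbitrary: T rule: less_induct)
      case less
      have "0 = (\<Sum>v\<in>polytabloid ` W. gscale (a v) v) T" using 0 by simp
      also have "\<dots> = (\<Sum>T'\<in>W. a (polytabloid T') * polytabloid T' T)"
        by (simp add: sum_fun_apply gscale_def sum.reindex[OF inj])
      also have "\<dots> = (\<Sum>T'\<in>W. if T' = T then a (polytabloid T) * polytabloid T T else 0)"
      proof (rule sum.cong)
        fix T' assume T': "T' \<in> W"
        have "a (polytabloid T') * polytabloid T' T = 0" if "T' \<noteq> T"
          using polytabloid_triangular[OF ss[OF less.prems] ss[OF T']] less.hyps[OF _ T'] that
          by auto
        thus "a (polytabloid T') * polytabloid T' T
            = (if T' = T then a (polytabloid T) * polytabloid T T else 0)" by auto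
      qed simp
      also have "\<dots> = a (polytabloid T) * polytabloid T T" using W less.prems by simp
      finally show ?case using polytabloid_diagonal[OF ss[OF less.prems]] by simp
    qed
    thus "a x = 0" using x by auto
  qed
qed

end

section \<open>Straightening\<close>

text \<open>Among the permutations that map \<open>A\<close> to \<open>B\<close>, an involution that moves only the symmetric difference is
chosen: it fixes a word as soon as the entries that it exchanges are equal.\<close>

lemma exchange_permutation:
  assumes X: "finite X" "A \<subseteq> X" "B \<subseteq> X" "card B = card A"
  obtains \<sigma> where "\<sigma> permutes X" "\<sigma> ` A = B" "\<sigma> \<circ> \<sigma> = id" "\<And>x. x \<notin> (A - B) \<union> (B - A) \<Longrightarrow> \<sigma> x = x"
proof -
  have "card (A - B) = card (B - A)"
    using X card_le_sym_Diff[of A B] card_le_sym_Diff[of B A] finite_subset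
    by (metis dual_order.antisym order_refl)
  then obtain h where h: "bij_betw h (A - B) (B - A)"
    using X finite_subset finite_same_card_bij by (metis finite_Diff)
  define k where "k = inv_into (A - B) h"
  define \<sigma> where "\<sigma> = (\<lambda>x. if x \<in> A - B then h x else if x \<in> B - A then k x else x)"
  have hB: "h x \<in> B - A" "k (h x) = x" if "x \<in> A - B" for x
    using h that by (auto simp: k_def bij_betw_def)
  have kA: "k x \<in> A - B" "h (k x) = x" if "x \<in> B - A" for x
    using h that unfolding k_def by (metis bij_betw_def inv_into_into, metis bij_betw_inv_into_right)
  have inv: "\<sigma> \<circ> \<sigma> = id"
  proof
    fix x show "(\<sigma> \<circ> \<sigma>) x = id x"
      using hB[of x] kA[of x] by (auto simp: \<sigma>_def)
  qed
  have img: "\<sigma> ` A \<subseteq> B" "\<sigma> ` B \<subseteq> A" "\<sigma> ` X \<subseteq> X"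
    using hB kA X(2,3) by (auto simp: \<sigma>_def)
  have "\<sigma> permutes X"
  proof (rule bij_imp_permutes)
    show "bij_betw \<sigma> X X"
      by (rule bij_betw_byWitness[where f' = \<sigma>]) (use img inv in \<open>auto simp: fun_eq_iff\<close>)
  qed (use X in \<open>auto simp: \<sigma>_def\<close>)
  moreover have "\<sigma> ` A = B"
  proof
    show "B \<subseteq> \<sigma> ` A"
    proof
      fix b assume "b \<in> B"
      hence "\<sigma> b \<in> A" "\<sigma> (\<sigma> b) = b" using img inv by (auto simp: fun_eq_iff)
      thus "b \<in> \<sigma> ` A" by (metis imageI)
    qed
  qed (rule img)
  ultimately show ?thesis using inv by (intro that[of \<sigma>]) (auto simp: \<sigma>_def)
qed

context young_cells
begin

text \<open>The assumption holds as soon as the rows that meet \<open>X\<close> have fewer columns than \<open>X\<close> has elements: every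
row permutation then puts two elements of \<open>X\<close> into one column. Their transposition is at once a column
permutation of odd sign and an element of the symmetric group on \<open>X\<close>, so the terms cancel in pairs.\<close>

lemma garnir_full:
  assumes X: "X \<subseteq> N"
    and pigeon: "\<And>p. p \<in> R \<Longrightarrow> \<exists>x\<in>X. \<exists>y\<in>X. x \<noteq> y \<and> col (p x) = col (p y)"
  shows "(\<Sum>\<sigma> | \<sigma> permutes X. polytabloid (w \<circ> \<sigma>) u) = 0"
proof -
  let ?P = "{\<sigma>. \<sigma> permutes X}"
  define G where "G q p \<sigma> = of_int (sign q) * delta w (u \<circ> q \<circ> p \<circ> \<sigma>)"
    for q p \<sigma> :: "nat \<Rightarrow> nat"
  have move: "delta (w \<circ> inv \<sigma>) v = delta w (v \<circ> \<sigma>)" if "\<sigma> permutes X" for \<sigma> v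
    using comp_perm_cancel[OF that, of v "w \<circ> inv \<sigma>"] perm_comp_inv(6)[OF that, of w]
    by (simp add: delta_def)
  have zero: "(\<Sum>q\<in>C. \<Sum>\<sigma>\<in>?P. G q p \<sigma>) = 0" if p: "p \<in> R" for p
  proof -
    obtain x y where xy: "x \<in> X" "y \<in> X" "x \<noteq> y" "col (p x) = col (p y)"
      using pigeon[OF p] by blast
    define s where "s = Transposition.transpose x y"
    define t where "t = Transposition.transpose (p x) (p y)"
    have pN: "p permutes N" by (rule R_perm[OF p])
    have pxy: "p x \<noteq> p y" using xy permutes_inj[OF pN] by (auto dest: injD)
    have tps: "t \<circ> p \<circ> s = p"
      using permutes_inj[OF pN]
      by (auto simp: fun_eq_iff t_def s_def Transposition.transpose_def inj_eq)
    have s: "s \<in> ?P" using xy by (simp add: s_def permutes_swap_id)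
    have t: "t \<in> C"
      unfolding t_def using xy X pN by (intro transpose_in_stab) (auto simp: permutes_in_image)
    \<comment> \<open>The relation \<open>t \<circ> p \<circ> s = p\<close> leaves the word unchanged, while the sign of \<open>q \<circ> t\<close> is reversed.\<close>
    have flip: "G (q \<circ> t) p (s \<circ> \<sigma>) = - G q p \<sigma>" if q: "q \<in> C" for q \<sigma>
    proof -
      have "permutation q" "permutation t"
        using C_perm[OF q] C_perm[OF t] finite_N permutes_imp_permutation by blast+
      hence "sign (q \<circ> t) = - sign q" using pxy by (simp add: sign_compose t_def sign_swap_id)
      moreover have "u \<circ> (q \<circ> t) \<circ> p \<circ> (s \<circ> \<sigma>) = u \<circ> q \<circ> p \<circ> \<sigma>"
        using arg_cong[OF tps, of "\<lambda>h. u \<circ> q \<circ> h \<circ> \<sigma>"] by (simp add: comp_assoc)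
      ultimately show ?thesis unfolding G_def by simp
    qed
    have "(\<Sum>q\<in>C. \<Sum>\<sigma>\<in>?P. G q p \<sigma>) = (\<Sum>q\<in>C. \<Sum>\<sigma>\<in>?P. G (q \<circ> t) p (s \<circ> \<sigma>))"
      by (subst sum_group_left[OF perm_group_all s])
         (rule sum_group_right[OF perm_group_stab t, symmetric])
    also have "\<dots> = - (\<Sum>q\<in>C. \<Sum>\<sigma>\<in>?P. G q p \<sigma>)"
      by (simp add: flip sum_negf)
    finally show ?thesis by simp
  qed
  have "(\<Sum>\<sigma>\<in>?P. polytabloid (w \<circ> \<sigma>) u) = (\<Sum>\<sigma>\<in>?P. polytabloid (w \<circ> inv \<sigma>) u)"
    by (rule sum_group_inv[OF perm_group_all, symmetric])
  also have "\<dots> = (\<Sum>\<sigma>\<in>?P. \<Sum>q\<in>C. \<Sum>p\<in>R. G q p \<sigma>)"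
    by (intro sum.cong) (simp_all add: symmetrize_apply move G_def)
  also have "\<dots> = (\<Sum>q\<in>C. \<Sum>\<sigma>\<in>?P. \<Sum>p\<in>R. G q p \<sigma>)" by (rule sum.swap)
  also have "\<dots> = (\<Sum>q\<in>C. \<Sum>p\<in>R. \<Sum>\<sigma>\<in>?P. G q p \<sigma>)" by (intro sum.cong sum.swap refl)
  also have "\<dots> = (\<Sum>p\<in>R. \<Sum>q\<in>C. \<Sum>\<sigma>\<in>?P. G q p \<sigma>)" by (rule sum.swap)
  also have "\<dots> = 0" using zero by simp
  finally show ?thesis .
qed

text \<open>The relation \<open>garnir_full\<close> collapsed to coset representatives. The elements \<open>\<tau>\<close> that preserve the
lower part \<open>A\<close> of \<open>X\<close> are row permutations and do not change the polytabloid, and the cosets are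
indexed by the images of \<open>A\<close>. The multiplicity disappears, which is what keeps straightening
integral.\<close>

lemma garnir_subsets:
  assumes X: "X \<subseteq> N" "A \<subseteq> X"
    and pigeon: "\<And>p. p \<in> R \<Longrightarrow> \<exists>x\<in>X. \<exists>y\<in>X. x \<noteq> y \<and> col (p x) = col (p y)"
    and rows: "\<And>x y. x \<in> A \<Longrightarrow> y \<in> A \<Longrightarrow> row x = row y"
      "\<And>x y. x \<in> X - A \<Longrightarrow> y \<in> X - A \<Longrightarrow> row x = row y"
    and \<sigma>: "\<And>B. B \<subseteq> X \<Longrightarrow> card B = card A \<Longrightarrow> \<sigma> B permutes X \<and> \<sigma> B ` A = B"
  shows "(\<Sum>B | B \<subseteq> X \<and> card B = card A. polytabloid (w \<circ> \<sigma> B) u) = 0"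
proof -
  let ?\<B> = "{B. B \<subseteq> X \<and> card B = card A}" and ?P = "{\<sigma>. \<sigma> permutes X}"
  have finX: "finite X" using X finite_N finite_subset by blast
  hence fin: "finite ?P" "finite ?\<B>" by (auto intro: finite_permutations)
  define Y where "Y = {\<tau>. \<tau> permutes X \<and> \<tau> ` A = A}"
  have YR: "\<tau> \<in> R" if "\<tau> \<in> Y" for \<tau>
  proof -
    have \<tau>: "\<tau> permutes X" "\<tau> ` A = A" using that by (auto simp: Y_def)
    have "row (\<tau> x) = row x" for x
    proof -
      consider "x \<in> A" | "x \<in> X - A" | "x \<notin> X" by blast
      thus ?thesis
      proof cases
        case 1
        hence "\<tau> x \<in> A" using \<tau> by blast
        thus ?thesis using rows(1) 1 by blast
      next
        case 2
        moreover have "\<tau> x \<notin> A"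
        proof
          assume "\<tau> x \<in> A"
          then obtain a where "a \<in> A" "\<tau> x = \<tau> a" using \<tau>(2) by blast
          thus False using 2 injD[OF permutes_inj[OF \<tau>(1)]] by blast
        qed
        ultimately have "\<tau> x \<in> X - A" using \<tau>(1) by (simp add: permutes_in_image)
        thus ?thesis using rows(2) 2 by blast
      qed (use permutes_not_in[OF \<tau>(1)] in simp)
    qed
    thus ?thesis using permutes_subset[OF \<tau>(1) X(1)] by (simp add: block_stab_def)
  qed
  have inner: "(\<Sum>\<tau> | \<tau> \<in> ?P \<and> \<tau> ` A = B. polytabloid (w \<circ> \<tau>) u) = of_nat (card Y) * polytabloid (w \<circ> \<sigma> B) u"
    if B: "B \<in> ?\<B>" for B
  proof -
    have s: "\<sigma> B permutes X" "\<sigma> B ` A = B" using \<sigma>[of B] B by simp_all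
    have "inv (\<sigma> B) ` \<sigma> B ` A = A" by (simp add: image_comp perm_comp_inv(2)[OF s(1)])
    hence i: "inv (\<sigma> B) ` B = A" by (simp only: s(2))
    have *: "(\<sigma> B \<circ> \<tau>) ` A = B" if "\<tau> ` A = A" for \<tau>
      unfolding image_comp[symmetric] that s(2) ..
    have **: "(inv (\<sigma> B) \<circ> \<tau>) ` A = A" if "\<tau> ` A = B" for \<tau>
      unfolding image_comp[symmetric] that i ..
    have "(\<Sum>\<tau> | \<tau> \<in> ?P \<and> \<tau> ` A = B. polytabloid (w \<circ> \<tau>) u) = (\<Sum>\<tau>\<in>Y. polytabloid (w \<circ> (\<sigma> B \<circ> \<tau>)) u)"
      by (rule sum.reindex_bij_witness[where i = "\<lambda>\<tau>. \<sigma> B \<circ> \<tau>" and j = "\<lambda>\<tau>. inv (\<sigma> B) \<circ> \<tau>"])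
         (simp_all add: Y_def perm_comp_inv[OF s(1)] s(1) permutes_compose permutes_inv
            * ** *[unfolded o_def] **[unfolded o_def])
    also have "\<dots> = (\<Sum>\<tau>\<in>Y. polytabloid (w \<circ> \<sigma> B) u)"
      by (rule sum.cong) (simp_all add: polytabloid_row[OF YR] flip: comp_assoc)
    finally show ?thesis by simp
  qed
  have "0 = (\<Sum>\<tau>\<in>?P. polytabloid (w \<circ> \<tau>) u)"
    by (rule garnir_full[OF X(1) pigeon, symmetric])
  also have "\<dots> = (\<Sum>B\<in>?\<B>. \<Sum>\<tau> | \<tau> \<in> ?P \<and> \<tau> ` A = B. polytabloid (w \<circ> \<tau>) u)"
  proof (rule sum.group[OF fin, symmetric])
    show "(\<lambda>\<tau>. \<tau> ` A) ` ?P \<subseteq> ?\<B>"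
    proof
      fix B assume "B \<in> (\<lambda>\<tau>. \<tau> ` A) ` ?P"
      then obtain \<tau> where \<tau>: "\<tau> permutes X" "B = \<tau> ` A" by blast
      thus "B \<in> ?\<B>"
        using X card_image[OF permutes_inj_on[OF \<tau>(1)]] permutes_image[OF \<tau>(1)]
          permutes_in_image[OF \<tau>(1)] by auto
    qed
  qed
  also have "\<dots> = of_nat (card Y) * (\<Sum>B\<in>?\<B>. polytabloid (w \<circ> \<sigma> B) u)"
    unfolding sum_distrib_left by (rule sum.cong) (simp_all only: inner)
  finally have "of_nat (card Y) * (\<Sum>B\<in>?\<B>. polytabloid (w \<circ> \<sigma> B) u) = 0" by simp
  moreover have "id \<in> Y" "finite Y"
    using finite_subset[OF _ fin(1), of Y] by (auto simp: Y_def)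
  ultimately show ?thesis by (auto simp: card_eq_0_iff)
qed

text \<open>Moving entries from the upper row to the lower row cannot decrease the weight, since every entry
of the lower part \<open>A\<close> is at most every entry of the upper part \<open>X - A\<close>. The weight stays the same
only if all exchanged entries are equal, and then the involution \<open>\<sigma>\<close> fixes the word itself.\<close>

lemma weight_exchange:
  assumes X: "X \<subseteq> N" "A \<subseteq> X" "B \<subseteq> X"
    and rows: "\<And>x. x \<in> A \<Longrightarrow> row x = Suc i" "\<And>x. x \<in> X - A \<Longrightarrow> row x = i"
    and \<sigma>: "\<sigma> permutes X" "\<sigma> ` A = B" "\<sigma> \<circ> \<sigma> = id" "\<And>x. x \<notin> (A - B) \<union> (B - A) \<Longrightarrow> \<sigma> x = x"
    and le: "\<And>x y. x \<in> A \<Longrightarrow> y \<in> X - A \<Longrightarrow> w x \<le> w y"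
  shows "weight N row w < weight N row (w \<circ> \<sigma>) \<or> w \<circ> \<sigma> = w"
proof -
  have \<sigma>\<sigma>: "\<sigma> (\<sigma> x) = x" for x using \<sigma>(3) by (simp add: fun_eq_iff)
  have swap: "\<sigma> ` (A - B) = B - A"
  proof -
    have "\<sigma> ` \<sigma> ` A = A" by (simp add: image_comp \<sigma>(3))
    hence "\<sigma> ` B = A" by (simp only: \<sigma>(2))
    moreover have "\<sigma> ` (A - B) = \<sigma> ` A - \<sigma> ` B"
      by (rule image_set_diff[OF permutes_inj[OF \<sigma>(1)]])
    ultimately show ?thesis using \<sigma>(2) by simp
  qed
  have swap': "\<sigma> x \<in> B - A" if "x \<in> A - B" for x using swap that by blast
  have swap'': "\<sigma> x \<in> A - B" if x: "x \<in> B - A" for x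
  proof -
    obtain a where "a \<in> A - B" "x = \<sigma> a" using x unfolding swap[symmetric] by blast
    thus ?thesis by (simp only: \<sigma>\<sigma>)
  qed
  have N: "\<sigma> permutes N" by (rule permutes_subset[OF \<sigma>(1) X(1)])
  have row: "row (\<sigma> x) + (if x \<in> A - B then 1 else 0) = row x + (if x \<in> B - A then 1 else 0)" for x
  proof -
    consider "x \<in> A - B" | "x \<in> B - A" | "x \<notin> (A - B) \<union> (B - A)" by blast
    thus ?thesis
    proof cases
      case 1
      hence "row x = Suc i" "row (\<sigma> x) = i" using rows swap'[OF 1] X by auto
      thus ?thesis using 1 by simp
    next
      case 2
      hence "row x = i" "row (\<sigma> x) = Suc i" using rows swap''[OF 2] X by auto
      thus ?thesis using 2 by simp
    next
      case 3
      show ?thesis unfolding \<sigma>(4)[OF 3] using 3 by simp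
    qed
  qed
  have "weight N row (w \<circ> \<sigma>) = (\<Sum>x\<in>N. row (\<sigma> x) * w x)"
    unfolding weight_def using sum.permute[OF N, of "\<lambda>x. row x * w (\<sigma> x)"] by (simp add: o_def \<sigma>\<sigma>)
  moreover have sub: "(\<Sum>x\<in>N. if x \<in> Y then w x else 0) = sum w Y" if "Y \<subseteq> N" for Y
    using that finite_N by (simp add: sum.If_cases Int_absorb1)
  have "(\<Sum>x\<in>N. row (\<sigma> x) * w x) + sum w (A - B)
      = (\<Sum>x\<in>N. (row (\<sigma> x) + (if x \<in> A - B then 1 else 0)) * w x)"
    using X by (subst sub[symmetric]) (auto simp: distrib_right sum.distrib intro!: sum.cong)
  also have "\<dots> = (\<Sum>x\<in>N. row x * w x) + sum w (B - A)"
    unfolding row using X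
    by (subst sub[symmetric]) (auto simp: distrib_right sum.distrib intro!: sum.cong)
  also have "sum w (B - A) = (\<Sum>x\<in>A - B. w (\<sigma> x))"
    unfolding swap[symmetric]
    by (subst sum.reindex[OF permutes_inj_on[OF \<sigma>(1)]]) simp
  ultimately have eq: "weight N row (w \<circ> \<sigma>) + sum w (A - B) = weight N row w + (\<Sum>x\<in>A - B. w (\<sigma> x))"
    by (simp add: weight_def)
  have le': "w x \<le> w (\<sigma> x)" if "x \<in> A - B" for x
    using le[of x "\<sigma> x"] swap'[OF that] that X by auto
  show ?thesis
  proof (cases "sum w (A - B) < (\<Sum>x\<in>A - B. w (\<sigma> x))")
    case False
    hence "sum w (A - B) = (\<Sum>x\<in>A - B. w (\<sigma> x))"
      using sum_mono[of "A - B" w "\<lambda>x. w (\<sigma> x)"] le' by force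
    moreover have "finite (A - B)"
      using finite_subset[OF X(1) finite_N] finite_subset[OF X(2)] by simp
    ultimately have same: "w x = w (\<sigma> x)" if "x \<in> A - B" for x
      using sum_mono_inv[of w "A - B" "\<lambda>x. w (\<sigma> x)" x] le' that by simp
    have "w (\<sigma> x) = w x" for x
    proof -
      consider "x \<in> A - B" | "x \<in> B - A" | "x \<notin> (A - B) \<union> (B - A)" by blast
      thus ?thesis
      proof cases
        case 1
        thus ?thesis using same by simp
      next
        case 2
        thus ?thesis using same[OF swap''[OF 2]] by (simp add: \<sigma>\<sigma>)
      next
        case 3
        show ?thesis by (simp only: \<sigma>(4)[OF 3])
      qed
    qed
    thus ?thesis by (simp add: fun_eq_iff)
  qed (use eq in linarith)
qed

lemma columns_strictI:
  assumes adj: "\<And>x y. x \<in> N \<Longrightarrow> y \<in> N \<Longrightarrow> col x = col y \<Longrightarrow> row y = Suc (row x) \<Longrightarrow> w x < (w y :: nat)"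
    and "x \<in> N" "y \<in> N" "col x = col y" "row x < row y"
  shows "w x < w y"
  using assms(3-)
proof (induction "row y" arbitrary: y rule: less_induct)
  case (less y)
  obtain z where z: "z \<in> N" "row z = row y - 1" "col z = col y"
  proof -
    have "1 \<le> row y - 1" "1 \<le> col y" using less.prems cell_pos(1)[OF assms(2)] cell_pos(2) by auto
    from cell_below[OF less.prems(1) this(1) _ this(2)] show ?thesis using that by auto
  qed
  have zy: "w z < w y" using adj[of z y] z less.prems by auto
  show ?case
  proof (cases "row x = row z")
    case True
    thus ?thesis using cell_inj[of x z] z less.prems assms(2) zy by auto
  next
    case False
    hence "row x < row z" using z less.prems by simp
    hence "w x < w z" using less.hyps[of z] z less.prems by simp
    thus ?thesis using zy by simp
  qed
qed

text \<open>At a violation of strictness in a column, the Garnir relation of the cells between the two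
offending entries expresses the polytabloid by polytabloids of larger row weight. The factor \<open>k\<close> counts the
exchanges that leave \<open>w\<close> unchanged; it is \<open>1\<close> when the entries are distinct.\<close>

lemma straighten_step:
  assumes rs: "block_sorted N row col w" and ns: "\<not> semistandard w"
  shows "\<exists>(J :: nat set set) \<sigma> k. finite J \<and> k > 0 \<and> (inj_on w N \<longrightarrow> k = 1) \<and>
    (\<forall>B\<in>J. \<sigma> B permutes N \<and> weight N row w < weight N row (w \<circ> \<sigma> B)) \<and>
    gscale (of_nat k) (polytabloid w) = - (\<Sum>B\<in>J. polytabloid (w \<circ> \<sigma> B))"
proof -
  obtain x0 y0 where v: "x0 \<in> N" "y0 \<in> N" "col x0 = col y0" "row y0 = Suc (row x0)" "w y0 \<le> w x0"
  proof -
    have "\<exists>x\<in>N. \<exists>y\<in>N. col x = col y \<and> row y = Suc (row x) \<and> \<not> w x < w y"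
    proof (rule ccontr)
      assume "\<not> ?thesis"
      hence adj: "w x < w y" if "x \<in> N" "y \<in> N" "col x = col y" "row y = Suc (row x)" for x y
        using that by blast
      have "w x < w y" if "x \<in> N" "y \<in> N" "col x = col y" "row x < row y" for x y
        by (rule columns_strictI[OF adj that])
      thus False using rs ns unfolding semistandard_def by blast
    qed
    thus ?thesis using that by (auto simp: not_less)
  qed
  \<comment> \<open>From \<open>x0\<close> to the end of its row, and from the beginning of the next row to the cell below \<open>x0\<close>:
    these cells meet the column of \<open>x0\<close> twice and every other column of that row at least once.\<close>
  define X1 where "X1 = {x\<in>N. row x = row x0 \<and> col x0 \<le> col x}"
  define X2 where "X2 = {x\<in>N. row x = Suc (row x0) \<and> col x \<le> col x0}"
  define X where "X = X1 \<union> X2"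
  have XN: "X \<subseteq> N" "X2 \<subseteq> X" and X1: "X - X2 = X1" by (auto simp: X_def X1_def X2_def)
  have fin: "finite X1" "finite X2" "finite X" using finite_N by (auto simp: X_def X1_def X2_def)
  have pigeon: "\<exists>x\<in>X. \<exists>y\<in>X. x \<noteq> y \<and> col (p x) = col (p y)" if p: "p \<in> R" for p
  proof -
    define K where "K = col ` {x\<in>N. row x = row x0}"
    have finK: "finite K" using finite_N by (simp add: K_def)
    have below: "col y \<in> K" if "y \<in> N" "row y = Suc (row x0)" for y
    proof -
      have "\<exists>z\<in>N. row z = row x0 \<and> col z = col y"
        by (rule cell_below[OF that(1)]) (use that v cell_pos in auto)
      then obtain z where z: "z \<in> N" "row z = row x0" "col z = col y" by blast
      thus ?thesis unfolding K_def z(3)[symmetric] by blast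
    qed
    have "K \<subseteq> col ` X1 \<union> col ` X2"
    proof
      fix k assume "k \<in> K"
      then obtain x where x: "x \<in> N" "row x = row x0" "k = col x" by (auto simp: K_def)
      show "k \<in> col ` X1 \<union> col ` X2"
      proof (cases "col x0 \<le> k")
        case True
        thus ?thesis using x by (auto simp: X1_def)
      next
        case False
        then obtain y where "y \<in> N" "row y = row y0" "col y = k"
          using cell_below[of y0 "row y0" k] v cell_pos x by fastforce
        thus ?thesis using False v by (auto simp: X2_def)
      qed
    qed
    hence "card K \<le> card (col ` X1 \<union> col ` X2)" using fin by (intro card_mono) auto
    moreover have "x0 \<in> X1" "y0 \<in> X2" using v by (simp_all add: X1_def X2_def)
    hence "col x0 \<in> col ` X1 \<inter> col ` X2" by (intro IntI, blast, simp only: v(3), blast)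
    hence "card (col ` X1 \<inter> col ` X2) > 0" using fin card_gt_0_iff by blast
    moreover have "card (col ` X1) = card X1" "card (col ` X2) = card X2"
      by (rule card_image, rule inj_onI, rule cell_inj, simp_all add: X1_def X2_def)+
    moreover have "card X = card X1 + card X2"
      unfolding X_def using fin by (intro card_Un_disjoint) (auto simp: X1_def X2_def)
    ultimately have "card K < card X" using card_Un_Int[of "col ` X1" "col ` X2"] fin by simp
    moreover have "(\<lambda>x. col (p x)) ` X \<subseteq> K"
    proof
      fix k assume "k \<in> (\<lambda>x. col (p x)) ` X"
      then obtain x where x: "x \<in> X" "k = col (p x)" by blast
      hence "p x \<in> N" "row (p x) = row x" using p XN by (auto simp: block_stab_def permutes_in_image)
      thus "k \<in> K" using x below by (auto simp: X_def X1_def X2_def K_def)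
    qed
    ultimately have "card ((\<lambda>x. col (p x)) ` X) < card X"
      using card_mono[OF finK] by (meson le_less_trans)
    hence "\<not> inj_on (\<lambda>x. col (p x)) X" by (rule pigeonhole)
    thus ?thesis by (auto simp: inj_on_def)
  qed
  let ?\<B> = "{B. B \<subseteq> X \<and> card B = card X2}"
  have "\<exists>\<sigma>. \<forall>B\<in>?\<B>. \<sigma> B permutes X \<and> \<sigma> B ` X2 = B \<and> \<sigma> B \<circ> \<sigma> B = id \<and>
      (\<forall>x. x \<notin> (X2 - B) \<union> (B - X2) \<longrightarrow> \<sigma> B x = x)"
  proof (rule bchoice, rule ballI)
    fix B assume B: "B \<in> ?\<B>"
    show "\<exists>\<sigma>. \<sigma> permutes X \<and> \<sigma> ` X2 = B \<and> \<sigma> \<circ> \<sigma> = id \<and>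
        (\<forall>x. x \<notin> (X2 - B) \<union> (B - X2) \<longrightarrow> \<sigma> x = x)"
      by (rule exchange_permutation[OF fin(3) XN(2), of B]) (use B in blast)+
  qed
  then obtain \<sigma> where *: "\<forall>B\<in>?\<B>. \<sigma> B permutes X \<and> \<sigma> B ` X2 = B \<and> \<sigma> B \<circ> \<sigma> B = id \<and>
      (\<forall>x. x \<notin> (X2 - B) \<union> (B - X2) \<longrightarrow> \<sigma> B x = x)"
    by (rule exE)
  have \<sigma>: "\<sigma> B permutes X" "\<sigma> B ` X2 = B" "\<sigma> B \<circ> \<sigma> B = id" if "B \<in> ?\<B>" for B
    using bspec[OF * that] by - (elim conjE, assumption)+
  have \<sigma>4: "\<sigma> B x = x" if "B \<in> ?\<B>" "x \<notin> (X2 - B) \<union> (B - X2)" for B x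
    using bspec[OF * that(1)] that(2) by (elim conjE allE impE)
  have le: "w x \<le> w y" if "x \<in> X2" "y \<in> X - X2" for x y
  proof -
    have "w x \<le> w y0"
    proof (cases "col x = col y0")
      case True
      hence "x = y0" using cell_inj that(1) v by (simp add: X2_def)
      thus ?thesis by simp
    next
      case False
      hence "x \<in> N" "row x = row y0" "col x < col y0" using that(1) v by (auto simp: X2_def)
      thus ?thesis using rs v(2) unfolding block_sorted_def by blast
    qed
    moreover have "w x0 \<le> w y"
    proof (cases "col y = col x0")
      case True
      hence "y = x0" using cell_inj that(2) v unfolding X1 by (simp add: X1_def)
      thus ?thesis by simp
    next
      case False
      hence "y \<in> N" "row x0 = row y" "col x0 < col y" using that(2) v unfolding X1 by (auto simp: X1_def)
      thus ?thesis using rs v(1) unfolding block_sorted_def by blast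
    qed
    ultimately show ?thesis using v by simp
  qed
  have dich: "weight N row w < weight N row (w \<circ> \<sigma> B) \<or> w \<circ> \<sigma> B = w" if B: "B \<in> ?\<B>" for B
  proof (rule weight_exchange[OF XN])
    show "B \<subseteq> X" using B by blast
    show "row x = Suc (row x0)" if "x \<in> X2" for x using that by (simp add: X2_def)
    show "row x = row x0" if "x \<in> X - X2" for x using that unfolding X1 by (simp add: X1_def)
    show "\<sigma> B permutes X" "\<sigma> B ` X2 = B" "\<sigma> B \<circ> \<sigma> B = id" by (rule \<sigma>[OF B])+
    show "\<sigma> B x = x" if "x \<notin> (X2 - B) \<union> (B - X2)" for x by (rule \<sigma>4[OF B that])
    show "w x \<le> w y" if "x \<in> X2" "y \<in> X - X2" for x y by (rule le[OF that])
  qed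
  \<comment> \<open>The exchanges in \<open>K\<close> produce \<open>w\<close> again; those in \<open>J\<close> increase the weight.\<close>
  define J where "J = {B\<in>?\<B>. w \<circ> \<sigma> B \<noteq> w}"
  define K where "K = {B\<in>?\<B>. w \<circ> \<sigma> B = w}"
  have finB: "finite ?\<B>" using fin by simp
  have KX2: "X2 \<in> K"
  proof -
    have "X2 \<in> ?\<B>" using XN by simp
    moreover from this have "\<sigma> X2 = id" using \<sigma>4[of X2] by (auto simp: fun_eq_iff)
    ultimately show ?thesis by (simp add: K_def)
  qed
  have KJ: "?\<B> = K \<union> J" "K \<inter> J = {}" by (auto simp: K_def J_def)
  have finKJ: "finite K" "finite J" using finB unfolding KJ(1) by simp_all
  have zero: "of_nat (card K) * polytabloid w u + (\<Sum>B\<in>J. polytabloid (w \<circ> \<sigma> B) u) = 0" for u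
  proof -
    have "0 = (\<Sum>B\<in>?\<B>. polytabloid (w \<circ> \<sigma> B) u)"
    proof (rule garnir_subsets[OF XN pigeon, symmetric])
      show "row x = row y" if "x \<in> X2" "y \<in> X2" for x y using that by (simp add: X2_def)
      show "row x = row y" if "x \<in> X - X2" "y \<in> X - X2" for x y
        using that unfolding X1 by (simp add: X1_def)
      show "\<sigma> B permutes X \<and> \<sigma> B ` X2 = B" if "B \<subseteq> X" "card B = card X2" for B
        using \<sigma>[of B] that by simp
    qed
    also have "\<dots> = (\<Sum>B\<in>K. polytabloid (w \<circ> \<sigma> B) u) + (\<Sum>B\<in>J. polytabloid (w \<circ> \<sigma> B) u)"
      unfolding KJ(1) by (rule sum.union_disjoint[OF finKJ KJ(2)])
    also have "(\<Sum>B\<in>K. polytabloid (w \<circ> \<sigma> B) u) = of_nat (card K) * polytabloid w u"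
      by (simp add: K_def)
    finally show ?thesis by (simp add: o_def)
  qed
  have rel: "gscale (of_nat (card K)) (polytabloid w) = - (\<Sum>B\<in>J. polytabloid (w \<circ> \<sigma> B))"
  proof
    fix u
    have "of_nat (card K) * polytabloid w u = - (\<Sum>B\<in>J. polytabloid (w \<circ> \<sigma> B) u)"
      by (rule eq_neg_iff_add_eq_0[THEN iffD2, OF zero])
    thus "gscale (of_nat (card K)) (polytabloid w) u = (- (\<Sum>B\<in>J. polytabloid (w \<circ> \<sigma> B))) u"
      unfolding gscale_def uminus_apply sum_fun_apply .
  qed
  have c1: "card K > 0" using KX2 finKJ card_gt_0_iff by blast
  have c2: "card K = 1" if "inj_on w N"
    proof -
      have "B = X2" if B: "B \<in> K" for B
      proof -
        have *: "B \<in> ?\<B>" "w \<circ> \<sigma> B = w" using B by (auto simp: K_def)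
        have "\<sigma> B x = x" if "x \<in> X2" for x
        proof -
          have "x \<in> X" using that XN(2) by blast
          hence "x \<in> N" "\<sigma> B x \<in> N"
            using XN(1) permutes_in_image[OF \<sigma>(1)[OF *(1)], of x] by blast+
          moreover have "w (\<sigma> B x) = w x" using fun_cong[OF *(2), of x] by simp
          ultimately show ?thesis using \<open>inj_on w N\<close> by (simp add: inj_on_eq_iff)
        qed
        thus ?thesis using \<sigma>(2)[OF *(1)] by simp
      qed
      hence "K = {X2}" using KX2 by blast
      thus ?thesis by simp
    qed
  have c3: "\<sigma> B permutes N \<and> weight N row w < weight N row (w \<circ> \<sigma> B)" if "B \<in> J" for B
    proof -
      have B: "B \<in> ?\<B>" "w \<circ> \<sigma> B \<noteq> w" using that by (simp_all add: J_def)
      show ?thesis using dich[OF B(1)] B(2) permutes_subset[OF \<sigma>(1)[OF B(1)] XN(1)] by blast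
    qed
  show ?thesis
    by (rule exI[of _ J], rule exI[of _ \<sigma>], rule exI[of _ "card K"])
       (intro conjI impI ballI finKJ(2) c1 c2 c3 rel; assumption)
qed

text \<open>Sorting the rows does not change the polytabloid, and each further step increases the row weight,
which is bounded on the finite set \<open>W\<close>.\<close>

lemma straighten:
  assumes W: "finite W" and inv: "\<And>w g. w \<in> W \<Longrightarrow> g permutes N \<Longrightarrow> w \<circ> g \<in> W" and w: "w \<in> W"
  shows "\<exists>f. (inj_on w N \<longrightarrow> (\<forall>T. f T \<in> \<int>)) \<and>
    polytabloid w = (\<Sum>T | T \<in> W \<and> semistandard T. gscale (f T) (polytabloid T))"
  using w
proof (induction "Max (weight N row ` W) - weight N row w" arbitrary: w rule: less_induct)
  case (less w)
  let ?T = "{T. T \<in> W \<and> semistandard T}"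
  have finT: "finite ?T" using W by simp
  obtain p where p: "p \<in> R" "\<And>q. q \<in> R \<Longrightarrow> weight N col (w \<circ> q) \<le> weight N col (w \<circ> p)"
    using weight_maximal_exists[OF finite_N] by metis
  define v where "v = w \<circ> p"
  have v: "v \<in> W" "polytabloid v = polytabloid w" "block_sorted N row col v" "weight N row v = weight N row w"
    using inv[OF less.prems R_perm[OF p(1)]] polytabloid_row[OF p(1)]
      weight_maximal_sorted[OF finite_N p] weight_block_constant[OF p(1)] by (auto simp: v_def)
  have inj: "inj_on (u \<circ> g) N" if "inj_on u N" "g permutes N" for u :: "nat \<Rightarrow> nat" and g
    using that by (metis comp_inj_on permutes_image permutes_inj_on)
  show ?case
  proof (cases "semistandard v")
    case True
    define f where "f T = (if T = v then 1 else 0 :: complex)" for T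
    have "(\<Sum>T\<in>?T. gscale (f T) (polytabloid T)) = (\<Sum>T\<in>?T. if T = v then polytabloid v else 0)"
      by (rule sum.cong) (simp_all add: f_def)
    also have "\<dots> = polytabloid w" using finT True v by simp
    finally show ?thesis by (intro exI[of _ f]) (auto simp: f_def)
  next
    case False
    obtain J :: "nat set set" and \<sigma> k where J: "finite J" "k > 0" "inj_on v N \<longrightarrow> k = 1"
      "\<forall>B\<in>J. \<sigma> B permutes N \<and> weight N row v < weight N row (v \<circ> \<sigma> B)"
      "gscale (of_nat k) (polytabloid v) = - (\<Sum>B\<in>J. polytabloid (v \<circ> \<sigma> B))"
      using straighten_step[OF v(3) False] by (elim exE conjE)
    note step = bspec[OF J(4)]
    have "\<exists>f. \<forall>B\<in>J. (inj_on (v \<circ> \<sigma> B) N \<longrightarrow> (\<forall>T. f B T \<in> \<int>)) \<and>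
      polytabloid (v \<circ> \<sigma> B) = (\<Sum>T\<in>?T. gscale (f B T) (polytabloid T))"
    proof (rule bchoice, rule ballI, rule less.hyps)
      fix B assume B: "B \<in> J"
      show mem: "v \<circ> \<sigma> B \<in> W" using inv[OF v(1)] step[OF B] by blast
      have "weight N row (v \<circ> \<sigma> B) \<le> Max (weight N row ` W)" using mem W by simp
      thus "Max (weight N row ` W) - weight N row (v \<circ> \<sigma> B) < Max (weight N row ` W) - weight N row w"
        using step[OF B] v(4) by linarith
    qed
    then obtain f where *: "\<forall>B\<in>J. (inj_on (v \<circ> \<sigma> B) N \<longrightarrow> (\<forall>T. f B T \<in> \<int>)) \<and>
      polytabloid (v \<circ> \<sigma> B) = (\<Sum>T\<in>?T. gscale (f B T) (polytabloid T))" by (rule exE)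
    have f: "inj_on (v \<circ> \<sigma> B) N \<Longrightarrow> f B T \<in> \<int>"
      "polytabloid (v \<circ> \<sigma> B) = (\<Sum>T\<in>?T. gscale (f B T) (polytabloid T))" if "B \<in> J" for B T
      using bspec[OF * that] by simp_all
    define F where "F T = - (\<Sum>B\<in>J. f B T) / of_nat k" for T
    have "F T \<in> \<int>" if "inj_on w N" for T
    proof -
      have "inj_on v N" using inj[OF that R_perm[OF p(1)]] by (simp add: v_def)
      hence "f B T \<in> \<int>" if "B \<in> J" for B
        using f(1)[OF that inj] step[OF that] by blast
      moreover from \<open>inj_on v N\<close> have "k = 1" using J(3) by blast
      ultimately show ?thesis by (auto simp: F_def intro!: Ints_minus Ints_sum)
    qed
    moreover have "polytabloid w u = (\<Sum>T\<in>?T. gscale (F T) (polytabloid T)) u" for u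
    proof -
      have "of_nat k * polytabloid w u = - (\<Sum>B\<in>J. polytabloid (v \<circ> \<sigma> B) u)"
        using fun_cong[OF J(5), of u] v(2) by (simp add: gscale_def sum_fun_apply)
      also have "\<dots> = - (\<Sum>B\<in>J. \<Sum>T\<in>?T. f B T * polytabloid T u)"
        using f(2) by (simp add: sum_fun_apply gscale_def)
      also have "\<dots> = of_nat k * (\<Sum>T\<in>?T. F T * polytabloid T u)"
      proof -
        have "of_nat k * F T = - (\<Sum>B\<in>J. f B T)" for T using J(2) by (simp add: F_def)
        hence "of_nat k * (F T * polytabloid T u) = - (\<Sum>B\<in>J. f B T * polytabloid T u)" for T
          by (metis mult.assoc mult_minus_left sum_distrib_right)
        thus ?thesis by (subst sum.swap) (simp add: sum_distrib_left sum_negf)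
      qed
      finally show ?thesis using J(2) by (simp add: sum_fun_apply gscale_def)
    qed
    ultimately show ?thesis by (intro exI[of _ F] conjI impI allI ext)
  qed
qed

end

lemma linear_left_mult: "Vector_Spaces.linear gscale gscale (left_mult g)"
  by (simp add: Vector_Spaces.linear_def module_hom_def module_hom_axioms_def
      galg.vector_space_axioms galg.module_axioms left_mult_def fun_eq_iff gscale_def)

context young_cells
begin

section \<open>The Young symmetrizer is a multiple of an idempotent\<close>

lemma R_alt: "R = {u \<in> S. row \<circ> u = row}"
proof (intro set_eqI iffI)
  fix u assume u: "u \<in> R"
  have "row (u x) = row x" for x
    using u permutes_not_in[OF R_perm[OF u]] by (cases "x \<in> N") (auto simp: block_stab_def)
  thus "u \<in> {u \<in> S. row \<circ> u = row}" using R_perm[OF u] by (auto simp: fun_eq_iff)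
qed (auto simp: block_stab_def fun_eq_iff)

lemma semistandard_row: "semistandard row"
  by (simp add: semistandard_def block_sorted_def)

text \<open>Strictness of the columns forces every entry to be at least its row index, and a rearrangement of
the row indices has the same sum.\<close>

lemma semistandard_row_unique:
  assumes g: "g permutes N" and T: "semistandard (row \<circ> g)"
  shows "row \<circ> g = row"
proof -
  have ge: "row x \<le> row (g x)" if "x \<in> N" for x
    using that
  proof (induction "row x" arbitrary: x rule: less_induct)
    case (less x)
    show ?case
    proof (cases "row x \<le> 1")
      case True
      have "g x \<in> N" using less.prems g by (simp add: permutes_in_image)
      thus ?thesis using cell_pos(1)[of "g x"] True by simp
    next
      case False
      have "\<exists>z\<in>N. row z = row x - 1 \<and> col z = col x"
        by (rule cell_below[OF less.prems]) (use False less.prems cell_pos(2) in auto)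
      then obtain z where z: "z \<in> N" "row z = row x - 1" "col z = col x" by blast
      have "row z < row x" using z False by simp
      hence "row (g z) < row (g x)"
        using T z less.prems unfolding semistandard_def by simp
      moreover have "row z \<le> row (g z)" using less.hyps[of z] z \<open>row z < row x\<close> by simp
      ultimately show ?thesis using z(2) by simp
    qed
  qed
  have "(\<Sum>x\<in>N. row x) = (\<Sum>x\<in>N. row (g x))"
    using sum.permute[OF g, of row] by (simp add: o_def)
  hence "row x = row (g x)" if "x \<in> N" for x
    using sum_mono_inv[of row N "\<lambda>x. row (g x)" x] ge that finite_N by simp
  thus ?thesis using permutes_not_in[OF g] by (metis comp_apply ext)
qed

text \<open>The span of all polytabloids of rearrangements of the word \<open>row\<close> is a line, because straightening
ends in the only semistandard one. This replaces the usual combinatorial lemma that a permutation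
without a pair of entries in a common row and a common column factors as \<open>p \<circ> q\<close>.\<close>

lemma polytabloid_row_orbit:
  obtains k where "\<And>g. g \<in> S \<Longrightarrow> polytabloid (row \<circ> g) = gscale (k g) (polytabloid row)"
proof -
  let ?W = "(\<lambda>g. row \<circ> g) ` S"
  have W: "finite ?W" using finite_S by simp
  have inv: "w \<circ> g \<in> ?W" if w: "w \<in> ?W" and g: "g permutes N" for w g
  proof -
    obtain h where h: "h permutes N" "w = row \<circ> h" using w by auto
    have "w \<circ> g = row \<circ> (h \<circ> g)" by (simp add: h(2) comp_assoc)
    thus ?thesis using permutes_compose[OF g h(1)] by blast
  qed
  have "row \<circ> id \<in> ?W" using permutes_id by blast
  hence sst: "{T. T \<in> ?W \<and> semistandard T} = {row}"
    using semistandard_row semistandard_row_unique by auto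
  have "\<exists>c. polytabloid (row \<circ> g) = gscale c (polytabloid row)" if g: "g \<in> S" for g
  proof -
    have "row \<circ> g \<in> ?W" using g by blast
    from straighten[OF W inv this] show ?thesis unfolding sst by auto
  qed
  hence "\<exists>k. \<forall>g\<in>S. polytabloid (row \<circ> g) = gscale (k g) (polytabloid row)"
    by (intro bchoice) blast
  thus ?thesis using that by blast
qed

text \<open>Words of the form \<open>row \<circ> u\<close> are cosets of the row group. This lemma lifts a statement about such
words to the permutations themselves, at the price of one more sum over the row group.\<close>

lemma row_orbit_convolution:
  assumes h: "h \<in> S"
  shows "(\<Sum>u\<in>S. H (inv u) * polytabloid (row \<circ> h) (row \<circ> u))
    = (\<Sum>q\<in>C. \<Sum>p\<in>R. \<Sum>p'\<in>R. of_int (sign q) * H (q \<circ> p \<circ> inv h \<circ> p'))"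
proof -
  have hN: "h permutes N" using h by simp
  have *: "(\<Sum>u\<in>S. H (inv u) * delta (row \<circ> h) (row \<circ> u \<circ> q \<circ> p)) = (\<Sum>p'\<in>R. H (q \<circ> p \<circ> inv h \<circ> p'))"
    if q: "q \<in> C" and p: "p \<in> R" for q p
  proof -
    \<comment> \<open>The substitution \<open>u \<mapsto> u \<circ> inv m\<close> turns the condition on \<open>u\<close> into membership in the row group.\<close>
    define m where "m = q \<circ> p \<circ> inv h"
    have m: "m permutes N"
      unfolding m_def by (intro permutes_compose permutes_inv hN C_perm[OF q] R_perm[OF p])
    have mh: "inv m \<circ> (q \<circ> p) = h"
    proof -
      have "q \<circ> p = m \<circ> h" by (simp add: m_def perm_comp_inv(6)[OF hN])
      thus ?thesis by (simp add: perm_comp_inv(4)[OF m])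
    qed
    have "(\<Sum>u\<in>S. H (inv u) * delta (row \<circ> h) (row \<circ> u \<circ> q \<circ> p))
        = (\<Sum>u\<in>S. H (inv (u \<circ> inv m)) * delta (row \<circ> h) (row \<circ> (u \<circ> inv m) \<circ> q \<circ> p))"
      by (rule sum_group_right[OF perm_group_all, symmetric]) (simp add: permutes_inv[OF m])
    also have "\<dots> = (\<Sum>u\<in>S. if row \<circ> u = row then H (m \<circ> inv u) else 0)"
    proof (rule sum.cong)
      fix u assume "u \<in> S"
      hence u: "u permutes N" by simp
      have "inv (u \<circ> inv m) = m \<circ> inv u"
        using o_inv_distrib[OF permutes_bij[OF u] permutes_bij[OF permutes_inv[OF m]]]
        by (simp add: perm_comp_inv(7)[OF m])
      moreover have "row \<circ> (u \<circ> inv m) \<circ> q \<circ> p = row \<circ> u \<circ> h"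
        using arg_cong[OF mh, of "\<lambda>x. row \<circ> u \<circ> x"] by (simp add: comp_assoc)
      ultimately show "H (inv (u \<circ> inv m)) * delta (row \<circ> h) (row \<circ> (u \<circ> inv m) \<circ> q \<circ> p)
          = (if row \<circ> u = row then H (m \<circ> inv u) else 0)"
        using comp_perm_cancel[OF hN, of "row \<circ> u" row] by (simp add: delta_def)
    qed simp
    also have "\<dots> = (\<Sum>u\<in>R. H (m \<circ> inv u))"
      unfolding R_alt by (rule sum.inter_filter[OF finite_S, symmetric])
    also have "\<dots> = (\<Sum>p'\<in>R. H (m \<circ> p'))"
      by (rule sum_group_inv[OF perm_group_stab])
    finally show ?thesis by (simp add: m_def)
  qed
  have "(\<Sum>u\<in>S. H (inv u) * polytabloid (row \<circ> h) (row \<circ> u))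
      = (\<Sum>u\<in>S. \<Sum>q\<in>C. \<Sum>p\<in>R. of_int (sign q) * (H (inv u) * delta (row \<circ> h) (row \<circ> u \<circ> q \<circ> p)))"
    by (simp add: symmetrize_apply sum_distrib_left mult.left_commute)
  also have "\<dots> = (\<Sum>q\<in>C. \<Sum>u\<in>S. \<Sum>p\<in>R. of_int (sign q) * (H (inv u) * delta (row \<circ> h) (row \<circ> u \<circ> q \<circ> p)))"
    by (rule sum.swap)
  also have "\<dots> = (\<Sum>q\<in>C. \<Sum>p\<in>R. \<Sum>u\<in>S. of_int (sign q) * (H (inv u) * delta (row \<circ> h) (row \<circ> u \<circ> q \<circ> p)))"
    by (intro sum.cong refl sum.swap)
  also have "\<dots> = (\<Sum>q\<in>C. \<Sum>p\<in>R. \<Sum>p'\<in>R. of_int (sign q) * H (q \<circ> p \<circ> inv h \<circ> p'))"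
    by (rule sum.cong[OF refl], rule sum.cong[OF refl]) (simp add: * flip: sum_distrib_left)
  finally show ?thesis .
qed

text \<open>In the group algebra, with \<open>a\<close> the row sum and \<open>b\<close> the signed column sum, this says that \<open>a x a b\<close> is
a multiple of \<open>a b\<close> for all \<open>x\<close>. The case \<open>x = b\<close> makes the Young symmetrizer quasi-idempotent.\<close>

lemma row_sandwich:
  obtains k where "\<And>g H. g \<in> S \<Longrightarrow>
    (\<Sum>q\<in>C. \<Sum>p\<in>R. \<Sum>p'\<in>R. of_int (sign q) * H (q \<circ> p \<circ> g \<circ> p'))
    = k g * (\<Sum>q\<in>C. \<Sum>p\<in>R. of_int (sign q) * (H (q \<circ> p) :: complex))"
proof -
  obtain k where k: "\<And>g. g \<in> S \<Longrightarrow> polytabloid (row \<circ> g) = gscale (k g) (polytabloid row)"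
    using polytabloid_row_orbit by blast
  have "(\<Sum>q\<in>C. \<Sum>p\<in>R. \<Sum>p'\<in>R. of_int (sign q) * H (q \<circ> p \<circ> g \<circ> p'))
      = k (inv g) * of_nat (card R) * (\<Sum>q\<in>C. \<Sum>p\<in>R. of_int (sign q) * H (q \<circ> p))"
    if g: "g \<in> S" for g and H :: "(nat \<Rightarrow> nat) \<Rightarrow> complex"
  proof -
    have g': "inv g \<in> S" "inv (inv g) = g" using g perm_comp_inv(7) by (auto simp: permutes_inv)
    have "(\<Sum>q\<in>C. \<Sum>p\<in>R. \<Sum>p'\<in>R. of_int (sign q) * H (q \<circ> p \<circ> g \<circ> p'))
        = (\<Sum>u\<in>S. H (inv u) * polytabloid (row \<circ> inv g) (row \<circ> u))"
      using row_orbit_convolution[OF g'(1), of H] by (simp add: g'(2))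
    also have "\<dots> = k (inv g) * (\<Sum>u\<in>S. H (inv u) * polytabloid (row \<circ> id) (row \<circ> u))"
      by (simp add: k[OF g'(1)] gscale_def sum_distrib_left mult.left_commute)
    also have "(\<Sum>u\<in>S. H (inv u) * polytabloid (row \<circ> id) (row \<circ> u))
        = (\<Sum>q\<in>C. \<Sum>p\<in>R. \<Sum>p'\<in>R. of_int (sign q) * H (q \<circ> (p \<circ> p')))"
      by (subst row_orbit_convolution) (simp_all add: comp_assoc)
    also have "\<dots> = (\<Sum>q\<in>C. \<Sum>p'\<in>R. \<Sum>p\<in>R. of_int (sign q) * H (q \<circ> (p \<circ> p')))"
      by (intro sum.cong refl sum.swap)
    also have "\<dots> = (\<Sum>q\<in>C. \<Sum>p'\<in>R. \<Sum>p\<in>R. of_int (sign q) * H (q \<circ> p))"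
      by (intro sum.cong refl sum_group_right[OF perm_group_stab])
    also have "\<dots> = of_nat (card R) * (\<Sum>q\<in>C. \<Sum>p\<in>R. of_int (sign q) * H (q \<circ> p))"
      by (simp add: sum_distrib_left)
    finally show ?thesis by (simp add: o_def mult.assoc)
  qed
  thus ?thesis using that[of "\<lambda>g. k (inv g) * of_nat (card R)"] by blast
qed

lemma symmetrize_symmetrize_exists:
  "\<exists>\<kappa>. \<forall>F. symmetrize (symmetrize F) = gscale \<kappa> (symmetrize F)"
proof -
  obtain k where k: "\<And>g H. g \<in> S \<Longrightarrow>
    (\<Sum>q\<in>C. \<Sum>p\<in>R. \<Sum>p'\<in>R. of_int (sign q) * H (q \<circ> p \<circ> g \<circ> p'))
    = k g * (\<Sum>q\<in>C. \<Sum>p\<in>R. of_int (sign q) * (H (q \<circ> p) :: complex))"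
    using row_sandwich by blast
  have "symmetrize (symmetrize F) w = (\<Sum>g\<in>C. of_int (sign g) * k g) * symmetrize F w" for F w
  proof -
    let ?f = "\<lambda>q p g p'. of_int (sign q) * (of_int (sign g) * F (w \<circ> (q \<circ> p \<circ> g \<circ> p')))"
    have "symmetrize (symmetrize F) w = (\<Sum>q\<in>C. \<Sum>p\<in>R. \<Sum>g\<in>C. \<Sum>p'\<in>R. ?f q p g p')"
      by (simp add: symmetrize_apply sum_distrib_left comp_assoc)
    also have "\<dots> = (\<Sum>q\<in>C. \<Sum>g\<in>C. \<Sum>p\<in>R. \<Sum>p'\<in>R. ?f q p g p')"
      by (intro sum.cong refl sum.swap)
    also have "\<dots> = (\<Sum>g\<in>C. \<Sum>q\<in>C. \<Sum>p\<in>R. \<Sum>p'\<in>R. ?f q p g p')"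
      by (rule sum.swap)
    also have "\<dots> = (\<Sum>g\<in>C. of_int (sign g) *
        (\<Sum>q\<in>C. \<Sum>p\<in>R. \<Sum>p'\<in>R. of_int (sign q) * F (w \<circ> (q \<circ> p \<circ> g \<circ> p'))))"
      by (simp add: sum_distrib_left mult.left_commute)
    also have "\<dots> = (\<Sum>g\<in>C. of_int (sign g) * (k g * symmetrize F w))"
    proof (rule sum.cong)
      fix g assume "g \<in> C"
      hence "g \<in> S" using C_perm by simp
      from k[OF this, of "\<lambda>v. F (w \<circ> v)"]
      show "of_int (sign g) * (\<Sum>q\<in>C. \<Sum>p\<in>R. \<Sum>p'\<in>R. of_int (sign q) * F (w \<circ> (q \<circ> p \<circ> g \<circ> p')))
        = of_int (sign g) * (k g * symmetrize F w)"
        by (simp add: symmetrize_apply comp_assoc)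
    qed simp
    finally show ?thesis by (simp add: sum_distrib_right mult.assoc)
  qed
  thus ?thesis by (intro exI[of _ "\<Sum>g\<in>C. of_int (sign g) * k g"]) (auto simp: gscale_def fun_eq_iff)
qed

lemma group_sum_self_adjoint:
  fixes c :: "(nat \<Rightarrow> nat) \<Rightarrow> int"
  assumes W: "\<And>w g. w \<in> W \<Longrightarrow> g permutes N \<Longrightarrow> w \<circ> g \<in> W"
    and G: "perm_group N G" and c: "\<And>p. p \<in> G \<Longrightarrow> c (inv p) = c p"
  shows "(\<Sum>w\<in>W. (\<Sum>p\<in>G. of_int (c p) * F (w \<circ> p)) * cnj (K w))
       = (\<Sum>w\<in>W. F w * cnj (\<Sum>p\<in>G. of_int (c p) * K (w \<circ> p)))"
proof -
  have "(\<Sum>w\<in>W. (\<Sum>p\<in>G. of_int (c p) * F (w \<circ> p)) * cnj (K w))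
      = (\<Sum>p\<in>G. \<Sum>w\<in>W. of_int (c p) * (F (w \<circ> p) * cnj (K w)))"
    by (subst sum.swap) (simp add: sum_distrib_right mult.assoc)
  also have "\<dots> = (\<Sum>p\<in>G. \<Sum>w\<in>W. of_int (c (inv p)) * (F w * cnj (K (w \<circ> inv p))))"
  proof (rule sum.cong)
    fix p assume p: "p \<in> G"
    have pN: "p permutes N" by (rule perm_groupD(1)[OF G p])
    show "(\<Sum>w\<in>W. of_int (c p) * (F (w \<circ> p) * cnj (K w)))
        = (\<Sum>w\<in>W. of_int (c (inv p)) * (F w * cnj (K (w \<circ> inv p))))"
      by (rule sum.reindex_bij_witness[where i = "\<lambda>w. w \<circ> inv p" and j = "\<lambda>w. w \<circ> p"])
         (simp_all add: W pN permutes_inv perm_comp_inv(5,6)[OF pN] c[OF p])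
  qed simp
  also have "\<dots> = (\<Sum>p\<in>G. \<Sum>w\<in>W. of_int (c p) * (F w * cnj (K (w \<circ> p))))"
    by (rule sum_group_inv[OF G])
  also have "\<dots> = (\<Sum>w\<in>W. F w * cnj (\<Sum>p\<in>G. of_int (c p) * K (w \<circ> p)))"
    by (subst sum.swap) (simp add: sum_distrib_left mult.left_commute)
  finally show ?thesis .
qed

lemma row_sum_row_sum: "row_sum (row_sum F) = gscale (of_nat (card R)) (row_sum F)"
proof
  fix w
  have "(\<Sum>p'\<in>R. F (w \<circ> (p \<circ> p'))) = (\<Sum>p'\<in>R. F (w \<circ> p'))" if "p \<in> R" for p
    by (rule sum_group_left[OF perm_group_stab that])
  thus "row_sum (row_sum F) w = gscale (of_nat (card R)) (row_sum F) w"
    by (simp add: row_sum_def gscale_def comp_assoc)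
qed

lemma col_alt_col_alt: "col_alt (col_alt F) = gscale (of_nat (card C)) (col_alt F)"
proof
  fix w
  have "of_int (sign q) * (\<Sum>q'\<in>C. of_int (sign q') * F (w \<circ> (q \<circ> q'))) = (\<Sum>q'\<in>C. of_int (sign q') * F (w \<circ> q'))"
    if q: "q \<in> C" for q
  proof -
    have "of_int (sign q) * (of_int (sign q') * F (w \<circ> (q \<circ> q'))) = of_int (sign (q \<circ> q')) * F (w \<circ> (q \<circ> q'))"
      if "q' \<in> C" for q'
      using C_perm[OF q] C_perm[OF that] finite_N
      by (simp add: sign_compose permutes_imp_permutation)
    hence "of_int (sign q) * (\<Sum>q'\<in>C. of_int (sign q') * F (w \<circ> (q \<circ> q')))
        = (\<Sum>q'\<in>C. of_int (sign (q \<circ> q')) * F (w \<circ> (q \<circ> q')))"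
      unfolding sum_distrib_left by (intro sum.cong refl)
    also have "\<dots> = (\<Sum>q'\<in>C. of_int (sign q') * F (w \<circ> q'))"
      by (rule sum_group_left[OF perm_group_stab q])
    finally show ?thesis .
  qed
  thus "col_alt (col_alt F) w = gscale (of_nat (card C)) (col_alt F) w"
    by (simp add: col_alt_def gscale_def comp_assoc)
qed

text \<open>Write \<open>a\<close> and \<open>b\<close> for the operators \<open>row_sum\<close> and \<open>col_alt\<close>. They are self-adjoint with squares
\<open>|R| a\<close> and \<open>|C| b\<close>. If \<open>b a b a = 0\<close> then \<open>M = a b a\<close> satisfies \<open>M M = 0\<close>, hence \<open>M = 0\<close>, hence the norm of
every \<open>b a F\<close> vanishes; but the polytabloid of \<open>row\<close> is not zero.\<close>

lemma symmetrize_symmetrize_nonzero: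
  assumes 0: "\<And>F. symmetrize (symmetrize F) = 0"
  shows False
proof -
  let ?W = "(\<lambda>g. row \<circ> g) ` S"
  define ip where "ip F K = (\<Sum>w\<in>?W. F w * cnj (K w))" for F K :: "(nat \<Rightarrow> nat) \<Rightarrow> complex"
  have finW: "finite ?W" using finite_S by simp
  have inv: "w \<circ> g \<in> ?W" if w: "w \<in> ?W" and g: "g permutes N" for w g
  proof -
    obtain h where h: "h permutes N" "w = row \<circ> h" using w by auto
    have "w \<circ> g = row \<circ> (h \<circ> g)" by (simp add: h(2) comp_assoc)
    thus ?thesis using permutes_compose[OF g h(1)] by blast
  qed
  have row_adj: "ip (row_sum F) K = ip F (row_sum K)" for F K
    using group_sum_self_adjoint[OF inv perm_group_stab[of N row], of "\<lambda>_. 1" F K]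
    by (simp add: ip_def row_sum_def)
  have col_adj: "ip (col_alt F) K = ip F (col_alt K)" for F K
    unfolding ip_def col_alt_def
    by (rule group_sum_self_adjoint[OF inv perm_group_stab])
       (use C_perm finite_N permutes_imp_permutation in \<open>auto intro: sign_inverse\<close>)
  have ip_scale: "ip F (gscale c K) = cnj c * ip F K" for F K c
    by (simp add: ip_def gscale_def sum_distrib_left mult.left_commute)
  have ip_zero: "ip F 0 = 0" "ip F (\<lambda>_. 0) = 0" for F by (simp_all add: ip_def)
  have definite: "F w = 0" if "ip F F = 0" "w \<in> ?W" for F w
  proof -
    have "ip F F = of_real (\<Sum>w\<in>?W. (cmod (F w))\<^sup>2)"
      unfolding ip_def of_real_sum by (intro sum.cong refl) (simp only: complex_norm_square)
    hence "(\<Sum>w\<in>?W. (cmod (F w))\<^sup>2) = 0" using that(1) by (metis of_real_eq_0_iff)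
    hence "\<forall>w\<in>?W. (cmod (F w))\<^sup>2 = 0"
      using sum_nonneg_eq_0_iff[OF finW, of "\<lambda>w. (cmod (F w))\<^sup>2"] by simp
    from bspec[OF this that(2)] show ?thesis by simp
  qed
  have ip_cong: "ip F K = ip F K'" if "\<And>w. w \<in> ?W \<Longrightarrow> K w = K' w" for F K K'
    unfolding ip_def using that by (intro sum.cong) auto
  let ?f = "delta row"
  let ?M = "row_sum (col_alt (row_sum ?f))"
  have "ip ?M ?M = ip ?f (row_sum (col_alt (row_sum ?M)))"
    by (simp only: row_adj col_adj)
  also have "row_sum ?M = gscale (of_nat (card R)) ?M" by (rule row_sum_row_sum)
  also have "row_sum (col_alt (gscale (of_nat (card R)) ?M))
      = gscale (of_nat (card R)) (row_sum (symmetrize (symmetrize ?f)))"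
    by (simp add: symmetrize_def row_sum_row_sum)
       (simp add: fun_eq_iff row_sum_def col_alt_def gscale_def sum_distrib_left mult.left_commute)
  also have "row_sum (symmetrize (symmetrize ?f)) = 0"
    by (simp add: 0 row_sum_def fun_eq_iff)
  finally have "ip ?M ?M = 0" by (simp add: ip_scale ip_zero)
  hence M: "?M w = 0" if "w \<in> ?W" for w using definite that by blast
  have "ip (col_alt (row_sum ?f)) (col_alt (row_sum ?f)) = ip ?f (row_sum (col_alt (col_alt (row_sum ?f))))"
    by (simp only: row_adj col_adj)
  also have "row_sum (col_alt (col_alt (row_sum ?f))) = gscale (of_nat (card C)) ?M"
    unfolding col_alt_col_alt
    by (simp add: fun_eq_iff row_sum_def gscale_def sum_distrib_left)
  also have "ip ?f \<dots> = ip ?f 0" by (rule ip_cong) (simp add: M gscale_def)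
  finally have "ip (polytabloid row) (polytabloid row) = 0" by (simp add: symmetrize_def ip_zero)
  moreover have "row \<circ> id \<in> ?W" using permutes_id by blast
  ultimately have "polytabloid row row = 0" using definite by simp
  thus False using polytabloid_diagonal[OF semistandard_row] by simp
qed

text \<open>For the Young symmetrizer \<open>c\<close> this is the scalar in \<open>c c = \<kappa> c\<close>, the product of the hook lengths.\<close>

definition symmetrizer_scalar :: complex where
  "symmetrizer_scalar = (SOME \<kappa>. \<forall>F. symmetrize (symmetrize F) = gscale \<kappa> (symmetrize F))"

lemma symmetrize_symmetrize: "symmetrize (symmetrize F) = gscale symmetrizer_scalar (symmetrize F)"
  using someI_ex[OF symmetrize_symmetrize_exists] unfolding symmetrizer_scalar_def by blast

lemma symmetrizer_scalar_nonzero: "symmetrizer_scalar \<noteq> 0"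
proof
  assume "symmetrizer_scalar = 0"
  hence "symmetrize (symmetrize F) = 0" for F
    by (simp add: symmetrize_symmetrize)
  thus False by (rule symmetrize_symmetrize_nonzero)
qed

section \<open>Traces on the modules generated by the symmetrizer\<close>

lemma module_span:
  assumes W: "\<And>w g. w \<in> W \<Longrightarrow> g permutes N \<Longrightarrow> w \<circ> g \<in> W"
    and v: "v \<in> galg.span (polytabloid ` W)"
  shows "u \<notin> W \<Longrightarrow> v u = 0" and "symmetrize v = gscale symmetrizer_scalar v"
proof -
  interpret E: Vector_Spaces.linear gscale gscale symmetrize by (rule linear_symmetrize)
  have zero: "polytabloid w u = 0" if w: "w \<in> W" and u: "u \<notin> W" for w u
  proof -
    have "delta w (u \<circ> q \<circ> p) = 0" if q: "q \<in> C" and p: "p \<in> R" for q p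
    proof (rule ccontr)
      assume "delta w (u \<circ> q \<circ> p) \<noteq> 0"
      hence "w = u \<circ> q \<circ> p" by (auto simp: delta_def split: if_splits)
      hence "w \<circ> inv p \<circ> inv q = u"
        by (simp add: perm_comp_inv(5)[OF R_perm[OF p]] perm_comp_inv(5)[OF C_perm[OF q]])
      thus False using u W[OF W[OF w permutes_inv[OF R_perm[OF p]]] permutes_inv[OF C_perm[OF q]]]
        by simp
    qed
    thus ?thesis by (simp add: symmetrize_apply)
  qed
  show "u \<notin> W \<Longrightarrow> v u = 0"
    using v by (induction rule: galg.span_induct_alt) (auto simp: gscale_def zero)
  show "symmetrize v = gscale symmetrizer_scalar v"
    using v
  proof (induction rule: galg.span_induct_alt)
    case base
    show ?case by (simp only: E.zero galg.scale_zero_right)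
  next
    case (step c x y)
    then obtain w where "x = polytabloid w" by blast
    hence "symmetrize x = gscale symmetrizer_scalar x" by (simp only: symmetrize_symmetrize)
    thus ?case
      by (simp only: E.add E.scale step.IH galg.scale_right_distrib galg.scale_scale mult.commute)
  qed
qed

text \<open>On the module, \<open>symmetrize\<close> acts as a nonzero scalar, so \<open>T\<close> may be replaced there by \<open>T\<close> after
\<open>symmetrize\<close>, which maps all functions on \<open>W\<close> into the module; then \<open>basis_trace\<close> applies.\<close>

lemma module_trace:
  assumes W: "finite W" "\<And>w g. w \<in> W \<Longrightarrow> g permutes N \<Longrightarrow> w \<circ> g \<in> W"
    and B: "finite B" "galg.independent B" "galg.span B = galg.span (polytabloid ` W)"
    and T: "Vector_Spaces.linear gscale gscale T"
    and TW: "\<And>w. w \<in> W \<Longrightarrow> T (polytabloid w) \<in> galg.span (polytabloid ` W)"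
  shows "(\<Sum>b\<in>B. galg.representation B (T b) b) = (\<Sum>w\<in>W. T (polytabloid w) w) / symmetrizer_scalar"
proof -
  interpret E: Vector_Spaces.linear gscale gscale symmetrize by (rule linear_symmetrize)
  interpret T: Vector_Spaces.linear gscale gscale T by (rule T)
  define Q where "Q F = gscale (1 / symmetrizer_scalar) (T (symmetrize F))" for F
  have BV: "b \<in> galg.span (polytabloid ` W)" if "b \<in> B" for b
    using galg.span_base[OF that] B(3) by simp
  have lin: "Vector_Spaces.linear gscale gscale Q"
    by (simp add: Vector_Spaces.linear_def module_hom_def module_hom_axioms_def
        galg.vector_space_axioms galg.module_axioms Q_def E.add T.add E.scale T.scale
        galg.scale_right_distrib mult.commute)
  have "(\<Sum>b\<in>B. galg.representation B (T b) b) = (\<Sum>b\<in>B. galg.representation B (Q b) b)"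
  proof (rule sum.cong)
    fix b assume "b \<in> B"
    hence "symmetrize b = gscale symmetrizer_scalar b" using module_span(2)[OF W(2) BV] by blast
    hence "Q b = T b" using symmetrizer_scalar_nonzero by (simp add: Q_def T.scale)
    thus "galg.representation B (T b) b = galg.representation B (Q b) b" by simp
  qed simp
  also have "\<dots> = (\<Sum>w\<in>W. Q (delta w) w)"
    by (rule basis_trace[OF W(1) B(1,2) _ lin])
       (use module_span(1)[OF W(2) BV] TW B(3) in \<open>auto simp: Q_def intro!: galg.span_scale\<close>)
  also have "\<dots> = (\<Sum>w\<in>W. T (polytabloid w) w) / symmetrizer_scalar"
    by (simp add: Q_def gscale_def sum_divide_distrib)
  finally show ?thesis .
qed

lemma semistandard_basis:
  assumes W: "finite W" "\<And>w g. w \<in> W \<Longrightarrow> g permutes N \<Longrightarrow> w \<circ> g \<in> W"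
  defines "B \<equiv> polytabloid ` {T. T \<in> W \<and> semistandard T}"
  shows "finite B" "galg.independent B" "galg.span B = galg.span (polytabloid ` W)"
    "card B = card {T. T \<in> W \<and> semistandard T}"
proof -
  let ?T = "{T. T \<in> W \<and> semistandard T}"
  have finT: "finite ?T" using W(1) by simp
  note ind = polytabloid_independent[OF finT]
  show "finite B" using finT by (simp add: B_def)
  show "galg.independent B" unfolding B_def by (rule ind(2)) simp
  show "card B = card ?T" unfolding B_def by (rule card_image, rule ind(1)) simp
  have "polytabloid w \<in> galg.span B" if w: "w \<in> W" for w
  proof -
    obtain f where f: "polytabloid w = (\<Sum>T\<in>?T. gscale (f T) (polytabloid T))"
      using straighten[OF W w] by blast
    show ?thesis unfolding B_def f
      by (rule galg.span_sum, rule galg.span_scale, rule galg.span_base, rule imageI)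
  qed
  hence "galg.span (polytabloid ` W) \<subseteq> galg.span B"
    by (intro galg.span_minimal galg.subspace_span) auto
  moreover have "galg.span B \<subseteq> galg.span (polytabloid ` W)"
    unfolding B_def by (intro galg.span_mono) auto
  ultimately show "galg.span B = galg.span (polytabloid ` W)" by blast
qed

lemma card_semistandard:
  assumes W: "finite W" "\<And>w g. w \<in> W \<Longrightarrow> g permutes N \<Longrightarrow> w \<circ> g \<in> W"
  shows "of_nat (card {T. T \<in> W \<and> semistandard T}) = (\<Sum>w\<in>W. polytabloid w w) / symmetrizer_scalar"
proof -
  define B where "B = polytabloid ` {T. T \<in> W \<and> semistandard T}"
  note B = semistandard_basis[OF W, folded B_def]
  have "of_nat (card {T. T \<in> W \<and> semistandard T}) = (\<Sum>b\<in>B. galg.representation B (id b) b)"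
    using B by (simp add: galg.representation_basis)
  also have "\<dots> = (\<Sum>w\<in>W. id (polytabloid w) w) / symmetrizer_scalar"
  proof (rule module_trace[OF W B(1-3)])
    show "Vector_Spaces.linear gscale gscale id"
      by (simp add: Vector_Spaces.linear_def module_hom_def module_hom_axioms_def
          galg.vector_space_axioms galg.module_axioms)
  qed (simp_all add: galg.span_base)
  finally show ?thesis by simp
qed

lemma left_mult_polytabloid:
  assumes g: "g permutes N"
  shows "left_mult g (polytabloid w) = polytabloid (g \<circ> w)"
proof
  fix u
  have "inv g \<circ> v = w \<longleftrightarrow> v = g \<circ> w" for v
    using perm_comp_inv(3,4)[OF g] by metis
  thus "left_mult g (polytabloid w) u = polytabloid (g \<circ> w) u"
    by (simp add: left_mult_def symmetrize_apply delta_def comp_assoc)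
qed

lemma S_invariant: "w \<in> S \<Longrightarrow> g permutes N \<Longrightarrow> w \<circ> g \<in> S"
  by (simp add: permutes_compose)

lemma left_mult_module:
  assumes g: "g permutes N" and w: "w \<in> S"
  shows "left_mult g (polytabloid w) \<in> galg.span (polytabloid ` S)"
  using w by (simp add: left_mult_polytabloid[OF g] permutes_compose[OF _ g] galg.span_base)

text \<open>Integrality comes from comparing the unknown basis inside \<open>trace_on\<close> with the semistandard one: \<open>g\<close>
maps \<open>polytabloid T\<close> to \<open>polytabloid (g \<circ> T)\<close>, and \<open>g \<circ> T\<close> has distinct entries, so that it
straightens with integer coefficients.\<close>

lemma trace_on_specht:
  assumes g: "g permutes N"
  defines "V \<equiv> galg.span (polytabloid ` S)"
  shows "trace_on V (left_mult g) = (\<Sum>w\<in>S. polytabloid w (inv g \<circ> w)) / symmetrizer_scalar"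
    and "trace_on V (left_mult g) \<in> \<int>"
proof -
  have tr: "(\<Sum>b\<in>B. galg.representation B (left_mult g b) b)
      = (\<Sum>w\<in>S. polytabloid w (inv g \<circ> w)) / symmetrizer_scalar"
    if B: "finite B" "galg.independent B" "galg.span B = V" for B
    using module_trace[OF finite_S S_invariant B(1,2) B(3)[unfolded V_def] linear_left_mult
        left_mult_module[OF g]] by (simp add: left_mult_def)
  define B where "B = (SOME B. galg.independent B \<and> galg.span B = V)"
  obtain B' where B': "B' \<subseteq> V" "galg.independent B'" "V \<subseteq> galg.span B'"
    by (rule galg.basis_exists[of V])
  have "galg.span B' \<subseteq> V"
    unfolding V_def by (rule galg.span_minimal[OF B'(1)[unfolded V_def] galg.subspace_span])
  hence "\<exists>B. galg.independent B \<and> galg.span B = V"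
    using B'(2,3) by (intro exI[of _ B'] conjI subset_antisym)
  from someI_ex[OF this] have B: "galg.independent B" "galg.span B = V"
    unfolding B_def by - (elim conjE, assumption)+
  have "B \<subseteq> galg.span (polytabloid ` S)" using galg.span_superset[of B] B(2) by (simp add: V_def)
  hence fin: "finite B"
    by (rule conjunct1[OF galg.independent_span_bound[OF finite_imageI[OF finite_S] B(1)]])
  show eq: "trace_on V (left_mult g) = (\<Sum>w\<in>S. polytabloid w (inv g \<circ> w)) / symmetrizer_scalar"
    using tr[OF fin B] by (simp add: trace_on_def B_def[symmetric])
  define B0 where "B0 = polytabloid ` {T. T \<in> S \<and> semistandard T}"
  have B0: "finite B0" "galg.independent B0" "galg.span B0 = V"
    unfolding B0_def V_def by (rule semistandard_basis[OF finite_S]; rule S_invariant; assumption)+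
  have "galg.representation B0 (left_mult g b) b \<in> \<int>" if b: "b \<in> B0" for b
  proof -
    obtain T where T: "T \<in> S" "b = polytabloid T" using b by (auto simp: B0_def)
    have gT: "g \<circ> T \<in> S" using T(1) g by (simp add: permutes_compose)
    hence inj: "inj_on (g \<circ> T) N" by (auto intro: permutes_inj_on)
    have "\<exists>f. (inj_on (g \<circ> T) N \<longrightarrow> (\<forall>T. f T \<in> \<int>)) \<and>
      polytabloid (g \<circ> T) = (\<Sum>T | T \<in> S \<and> semistandard T. gscale (f T) (polytabloid T))"
      by (rule straighten[OF finite_S _ gT]) (rule S_invariant)
    then obtain f where f: "\<And>T. f T \<in> \<int>"
      "polytabloid (g \<circ> T) = (\<Sum>T | T \<in> S \<and> semistandard T. gscale (f T) (polytabloid T))"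
      using inj by blast
    have mem: "polytabloid T' \<in> B0" if "T' \<in> {T. T \<in> S \<and> semistandard T}" for T'
      using that by (auto simp: B0_def)
    have "left_mult g b = (\<Sum>T | T \<in> S \<and> semistandard T. gscale (f T) (polytabloid T))"
      using T(2) f(2) left_mult_polytabloid[OF g] by simp
    hence "galg.representation B0 (left_mult g b) b
        = (\<Sum>T | T \<in> S \<and> semistandard T. f T * galg.representation B0 (polytabloid T) b)"
    proof -
      have "galg.representation B0 (left_mult g b)
          = (\<lambda>b. \<Sum>T | T \<in> S \<and> semistandard T. galg.representation B0 (gscale (f T) (polytabloid T)) b)"
        unfolding \<open>left_mult g b = _\<close>
        by (rule galg.representation_sum[OF B0(2)], rule galg.span_scale, rule galg.span_base, rule mem)
      thus ?thesis
        by (auto simp: galg.representation_scale[OF B0(2) galg.span_base[OF mem]] intro!: sum.cong)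
    qed
    also have "\<dots> \<in> \<int>"
      by (intro Ints_sum Ints_mult f(1)) (use mem in \<open>simp add: galg.representation_basis[OF B0(2)]\<close>)
    finally show ?thesis .
  qed
  hence "(\<Sum>b\<in>B0. galg.representation B0 (left_mult g b) b) \<in> \<int>" by (rule Ints_sum)
  thus "trace_on V (left_mult g) \<in> \<int>"
    using tr[OF B0] eq by simp
qed

end

section \<open>Cycle types and centralizers\<close>

text \<open>The set \<open>A\<close> is a union of cycles of \<open>g\<close>; allowing proper subsets of the ground set makes it possible
to remove one cycle at a time.\<close>

definition cyc_type :: "nat set \<Rightarrow> (nat \<Rightarrow> nat) \<Rightarrow> nat multiset" where
  "cyc_type A g = image_mset card (mset_set (orbit g ` A))"

definition z_mset :: "nat multiset \<Rightarrow> nat" where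
  "z_mset M = (\<Prod>i\<in>set_mset M. i ^ count M i * fact (count M i))"

lemma z_part_mset: "z_part mu = z_mset (mset mu)"
  by (simp add: z_part_def z_mset_def count_mset)

lemma z_mset_superset:
  assumes "finite A" "set_mset M \<subseteq> A"
  shows "z_mset M = (\<Prod>i\<in>A. i ^ count M i * fact (count M i))"
  unfolding z_mset_def
  by (rule prod.mono_neutral_left) (use assms in \<open>auto simp: not_in_iff\<close>)

lemma z_mset_remove:
  assumes "k \<in># M"
  shows "z_mset M = k * count M k * z_mset (M - {#k#})"
proof -
  let ?N = "M - {#k#}" and ?A = "set_mset M - {k}"
  obtain c where c: "count M k = Suc c" using assms by (metis count_eq_zero_iff not0_implies_Suc)
  have "(\<Prod>i\<in>?A. i ^ count ?N i * fact (count ?N i)) = (\<Prod>i\<in>?A. i ^ count M i * fact (count M i))"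
    by (rule prod.cong) auto
  moreover have "z_mset M = k ^ count M k * fact (count M k) * (\<Prod>i\<in>?A. i ^ count M i * fact (count M i))"
    unfolding z_mset_def by (rule prod.remove) (use assms in auto)
  moreover have "z_mset ?N = (\<Prod>i\<in>set_mset M. i ^ count ?N i * fact (count ?N i))"
    by (rule z_mset_superset) (auto dest: in_diffD)
  moreover have "\<dots> = k ^ count ?N k * fact (count ?N k) * (\<Prod>i\<in>?A. i ^ count ?N i * fact (count ?N i))"
    by (rule prod.remove) (use assms in auto)
  ultimately show ?thesis by (simp add: c algebra_simps)
qed

lemma z_mset_pos: "0 \<notin># M \<Longrightarrow> z_mset M > 0"
  by (auto simp: z_mset_def intro!: prod_pos gr0I)

context
  fixes N :: "nat set" and g :: "nat \<Rightarrow> nat"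
  assumes N: "finite N" and g: "g permutes N"
begin

lemma perm_g: "permutation g"
  using N g permutes_imp_permutation by blast

lemma in_orbit_self: "x \<in> orbit g x"
  by (rule permutation_self_in_orbit[OF perm_g])

lemma orbit_eq: "y \<in> orbit g x \<Longrightarrow> orbit g y = orbit g x"
  by (rule orbit_cyclic_eq3[OF cyclic_on_orbit[OF g N]])

lemma orbit_subset_invariant:
  assumes "x \<in> A" "\<And>y. y \<in> A \<Longrightarrow> g y \<in> A"
  shows "orbit g x \<subseteq> A"
proof
  fix y assume "y \<in> orbit g x"
  thus "y \<in> A" by induction (use assms in auto)
qed

lemma finite_orbit_g: "finite (orbit g x)"
  by (rule finite_orbit[OF in_orbit_self])

lemma diff_orbit_invariant:
  assumes "\<And>y. y \<in> A \<Longrightarrow> g y \<in> A" "y \<in> A - orbit g x"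
  shows "g y \<in> A - orbit g x"
proof -
  have "g y \<notin> orbit g x"
  proof
    assume "g y \<in> orbit g x"
    hence "orbit g (g y) = orbit g x" by (rule orbit_eq)
    hence "y \<in> orbit g x" using permutation_orbit_step[OF perm_g, of y] in_orbit_self[of y] by simp
    thus False using assms(2) by simp
  qed
  thus ?thesis using assms by blast
qed

lemma cyc_type_remove:
  assumes A: "finite A" "x \<in> A" "\<And>y. y \<in> A \<Longrightarrow> g y \<in> A"
  shows "cyc_type A g = add_mset (card (orbit g x)) (cyc_type (A - orbit g x) g)"
proof -
  have "orbit g ` A = insert (orbit g x) (orbit g ` (A - orbit g x))"
    using A(2) orbit_eq by auto
  moreover have "orbit g x \<notin> orbit g ` (A - orbit g x)"
    using in_orbit_self by auto
  moreover have "finite (orbit g ` (A - orbit g x))" using A(1) by simp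
  ultimately show ?thesis by (simp add: cyc_type_def)
qed

lemma card_cycle_length:
  assumes A: "finite A" "\<And>y. y \<in> A \<Longrightarrow> g y \<in> A"
  shows "card {y \<in> A. card (orbit g y) = k} = k * count (cyc_type A g) k"
proof -
  let ?O = "{U \<in> orbit g ` A. card U = k}"
  have "{y \<in> A. card (orbit g y) = k} = \<Union>?O"
  proof
    show "\<Union>?O \<subseteq> {y \<in> A. card (orbit g y) = k}"
    proof
      fix y assume "y \<in> \<Union>?O"
      then obtain x where x: "x \<in> A" "card (orbit g x) = k" "y \<in> orbit g x" by auto
      hence "y \<in> A" using orbit_subset_invariant[of x A] A(2) by blast
      thus "y \<in> {y \<in> A. card (orbit g y) = k}" using x orbit_eq by simp
    qed
  qed (use in_orbit_self in blast)
  moreover have "card (\<Union>?O) = sum card ?O"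
  proof (rule card_Union_disjoint)
    show "pairwise disjnt ?O"
    proof (rule pairwiseI)
      fix U V assume "U \<in> ?O" "V \<in> ?O" "U \<noteq> V"
      thus "disjnt U V" unfolding disjnt_def using orbit_eq by blast
    qed
  qed (use finite_orbit_g in auto)
  moreover have "sum card ?O = k * card ?O" by simp
  moreover have "count (cyc_type A g) k = card ?O"
  proof -
    have "count (cyc_type A g) k = (\<Sum>U | U \<in># mset_set (orbit g ` A) \<and> k = card U. count (mset_set (orbit g ` A)) U)"
      by (simp add: cyc_type_def count_image_mset')
    also have "\<dots> = (\<Sum>U\<in>?O. 1)"
      by (rule sum.cong) (use A(1) in auto)
    finally show ?thesis by simp
  qed
  ultimately show ?thesis by simp
qed

lemma funpow_eq_iff: "(g ^^ i) x = (g ^^ j) x \<longleftrightarrow> i mod card (orbit g x) = j mod card (orbit g x)"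
proof -
  let ?d = "funpow_dist1 g x x"
  have self: "x \<in> orbit g x" by (rule in_orbit_self)
  have inj: "inj_on (\<lambda>n. (g ^^ n) x) {0..<?d}" by (rule inj_on_funpow_dist1[OF self])
  have card: "card (orbit g x) = ?d"
    using card_image[OF inj] by (simp add: orbit_conv_funpow_dist1[OF self, symmetric])
  have red: "(g ^^ (n mod ?d)) x = (g ^^ n) x" for n
    by (rule funpow_mod_eq[OF funpow_dist1_prop[OF self]])
  have "(g ^^ i) x = (g ^^ j) x \<longleftrightarrow> (g ^^ (i mod ?d)) x = (g ^^ (j mod ?d)) x" by (simp only: red)
  also have "\<dots> \<longleftrightarrow> i mod ?d = j mod ?d"
    using inj_on_eq_iff[OF inj, of "i mod ?d" "j mod ?d"] by simp
  finally show ?thesis by (simp only: card)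
qed

lemma orbit_funpow: "orbit g x = range (\<lambda>n. (g ^^ n) x)"
  using orbit_altdef_permutation[OF perm_g] by auto

end

text \<open>Bijections between unions of cycles that carry \<open>h\<close> to \<open>g\<close>. On the whole ground set they are the
conjugating permutations, and for \<open>g = h\<close> they form the centralizer.\<close>

definition intertwiners ::
    "nat set \<Rightarrow> (nat \<Rightarrow> nat) \<Rightarrow> nat set \<Rightarrow> (nat \<Rightarrow> nat) \<Rightarrow> (nat \<Rightarrow> nat) set" where
  "intertwiners A h B g = {w \<in> A \<rightarrow>\<^sub>E B. bij_betw w A B \<and> (\<forall>x\<in>A. w (h x) = g (w x))}"

context
  fixes N :: "nat set" and g h :: "nat \<Rightarrow> nat"
  assumes N: "finite N" and g: "g permutes N" and h: "h permutes N"
begin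

lemma intertwiner_funpow:
  assumes w: "w \<in> intertwiners A h B g" and hA: "\<And>y. y \<in> A \<Longrightarrow> h y \<in> A" and x: "x \<in> A"
  shows "(h ^^ i) x \<in> A" "w ((h ^^ i) x) = (g ^^ i) (w x)"
proof (induction i)
  case (Suc i)
  { case 1 thus ?case using Suc hA by simp }
  { case 2 thus ?case using Suc w by (simp add: intertwiners_def) }
qed (use x in auto)

lemma intertwiner_orbit:
  assumes w: "w \<in> intertwiners A h B g" and hA: "\<And>y. y \<in> A \<Longrightarrow> h y \<in> A" and x: "x \<in> A"
  shows "w ` orbit h x = orbit g (w x)" "card (orbit g (w x)) = card (orbit h x)"
proof -
  show im: "w ` orbit h x = orbit g (w x)"
    by (simp add: orbit_funpow[OF N g] orbit_funpow[OF N h] image_image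
        intertwiner_funpow(2)[OF w hA x])
  have "orbit h x \<subseteq> A" by (rule orbit_subset_invariant[OF N h x hA])
  moreover have "inj_on w A" using w by (auto simp: intertwiners_def bij_betw_def)
  ultimately have "inj_on w (orbit h x)" by (rule inj_on_subset[rotated])
  from card_image[OF this] show "card (orbit g (w x)) = card (orbit h x)" by (simp add: im)
qed

text \<open>On the cycle through \<open>x\<close> an intertwiner is determined by the image \<open>y\<close> of \<open>x\<close>, which may be any
element on a cycle of the same length, and the remaining cycles are mapped independently.\<close>

lemma card_intertwiners_fibre:
  assumes hA: "\<And>y. y \<in> A \<Longrightarrow> h y \<in> A" and gB: "\<And>y. y \<in> B \<Longrightarrow> g y \<in> B"
    and x: "x \<in> A" and y: "y \<in> B" and card: "card (orbit g y) = card (orbit h x)"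
  shows "card {w \<in> intertwiners A h B g. w x = y}
       = card (intertwiners (A - orbit h x) h (B - orbit g y) g)"
proof -
  let ?O = "orbit h x" and ?U = "orbit g y"
  have OA: "?O \<subseteq> A" by (rule orbit_subset_invariant[OF N h x hA])
  have UB: "?U \<subseteq> B" by (rule orbit_subset_invariant[OF N g y gB])
  have iff: "(h ^^ i) x = (h ^^ j) x \<longleftrightarrow> (g ^^ i) y = (g ^^ j) y" for i j
    by (simp only: funpow_eq_iff[OF N h] funpow_eq_iff[OF N g] card)
  \<comment> \<open>The map \<open>h^i x \<mapsto> g^i y\<close> of cycles; it is well defined because the cycles have the same length.\<close>
  define u where "u z = (g ^^ (SOME i. (h ^^ i) x = z)) y" for z
  have u: "u ((h ^^ i) x) = (g ^^ i) y" for i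
  proof -
    have "(h ^^ (SOME j. (h ^^ j) x = (h ^^ i) x)) x = (h ^^ i) x" by (rule someI) simp
    thus ?thesis unfolding u_def by (simp only: iff)
  qed
  have ubij: "bij_betw u ?O ?U"
  proof (rule bij_betw_imageI)
    show "inj_on u ?O"
      by (rule inj_onI) (auto simp: orbit_funpow[OF N h] u iff)
    show "u ` ?O = ?U"
      by (simp add: orbit_funpow[OF N g] orbit_funpow[OF N h] image_image u)
  qed
  have "bij_betw (\<lambda>w. restrict w (A - ?O)) {w \<in> intertwiners A h B g. w x = y}
      (intertwiners (A - ?O) h (B - ?U) g)"
  proof (rule bij_betw_imageI)
    show "inj_on (\<lambda>w. restrict w (A - ?O)) {w \<in> intertwiners A h B g. w x = y}"
    proof (rule inj_onI)
      fix w w' assume w: "w \<in> {w \<in> intertwiners A h B g. w x = y}"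
        and w': "w' \<in> {w \<in> intertwiners A h B g. w x = y}"
        and eq: "restrict w (A - ?O) = restrict w' (A - ?O)"
      show "w = w'"
      proof
        fix z
        consider "z \<notin> A" | "z \<in> A - ?O" | i where "z = (h ^^ i) x"
          unfolding orbit_funpow[OF N h] by blast
        thus "w z = w' z"
        proof cases
          case 1
          have "w \<in> extensional A" "w' \<in> extensional A"
            using w w' by (auto simp: intertwiners_def PiE_def)
          thus ?thesis using 1 extensional_arb[of w A z] extensional_arb[of w' A z] by simp
        next
          case 2
          thus ?thesis using fun_cong[OF eq, of z] by simp
        next
          case 3
          have "w z = (g ^^ i) y" "w' z = (g ^^ i) y"
            unfolding 3 using w w' intertwiner_funpow(2)[OF _ hA x, of w B i]
              intertwiner_funpow(2)[OF _ hA x, of w' B i] by simp_all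
          thus ?thesis by simp
        qed
      qed
    qed
    show "(\<lambda>w. restrict w (A - ?O)) ` {w \<in> intertwiners A h B g. w x = y}
        = intertwiners (A - ?O) h (B - ?U) g"
    proof
      show "(\<lambda>w. restrict w (A - ?O)) ` {w \<in> intertwiners A h B g. w x = y}
          \<subseteq> intertwiners (A - ?O) h (B - ?U) g"
      proof (rule image_subsetI)
        fix w assume "w \<in> {w \<in> intertwiners A h B g. w x = y}"
        hence w: "w \<in> intertwiners A h B g" "w x = y" by auto
        have bij: "bij_betw w A B" and eqv: "\<And>z. z \<in> A \<Longrightarrow> w (h z) = g (w z)"
          using w by (auto simp: intertwiners_def)
        have "w ` (A - ?O) = B - ?U"
          using inj_on_image_set_diff[of w A A ?O] OA bij intertwiner_orbit(1)[OF w(1) hA x] w(2)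
          by (simp add: bij_betw_def)
        moreover have "inj_on w (A - ?O)" using bij by (auto simp: bij_betw_def intro: inj_on_subset)
        ultimately have "bij_betw w (A - ?O) (B - ?U)" by (simp add: bij_betw_def)
        hence bij': "bij_betw (restrict w (A - ?O)) (A - ?O) (B - ?U)"
          by (subst bij_betw_cong[of _ _ w]) auto
        have "restrict w (A - ?O) (h z) = g (restrict w (A - ?O) z)" if "z \<in> A - ?O" for z
          using diff_orbit_invariant[OF N h hA that] that eqv by simp
        moreover have "restrict w (A - ?O) \<in> (A - ?O) \<rightarrow>\<^sub>E (B - ?U)"
          using bij_betw_imp_funcset[OF bij'] by (simp add: PiE_def)
        ultimately show "restrict w (A - ?O) \<in> intertwiners (A - ?O) h (B - ?U) g"
          using bij' by (simp add: intertwiners_def)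
      qed
      show "intertwiners (A - ?O) h (B - ?U) g
          \<subseteq> (\<lambda>w. restrict w (A - ?O)) ` {w \<in> intertwiners A h B g. w x = y}"
      proof
        fix v assume v: "v \<in> intertwiners (A - ?O) h (B - ?U) g"
        define w where "w z = (if z \<in> ?O then u z else v z)" for z
        have vbij: "bij_betw v (A - ?O) (B - ?U)" and vext: "v \<in> extensional (A - ?O)"
          and veq: "\<And>z. z \<in> A - ?O \<Longrightarrow> v (h z) = g (v z)"
          using v by (auto simp: intertwiners_def PiE_def)
        have "bij_betw w ?O ?U" using ubij by (subst bij_betw_cong[of _ _ u]) (auto simp: w_def)
        moreover have "bij_betw w (A - ?O) (B - ?U)"
          using vbij by (subst bij_betw_cong[of _ _ v]) (auto simp: w_def)
        ultimately have "bij_betw w (?O \<union> (A - ?O)) (?U \<union> (B - ?U))"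
          by (rule bij_betw_combine) auto
        hence wbij: "bij_betw w A B" using OA UB by (simp add: Un_absorb1)
        have wext: "w \<in> extensional A"
          using vext OA by (auto simp: extensional_def w_def)
        have weq: "w (h z) = g (w z)" if z: "z \<in> A" for z
        proof (cases "z \<in> ?O")
          case True
          then obtain i where i: "z = (h ^^ i) x" unfolding orbit_funpow[OF N h] by blast
          have "h z = (h ^^ Suc i) x" by (simp add: i)
          hence "h z \<in> ?O" "u (h z) = (g ^^ Suc i) y"
            unfolding orbit_funpow[OF N h] by (blast, simp only: u)
          thus ?thesis using True u[of i] by (simp add: w_def i)
        next
          case False
          hence zO: "z \<in> A - ?O" using z by simp
          thus ?thesis using diff_orbit_invariant[OF N h hA zO] veq[OF zO] by (simp add: w_def)
        qed
        have "w \<in> intertwiners A h B g"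
          using wbij wext weq bij_betw_imp_funcset[OF wbij] by (simp add: intertwiners_def PiE_def)
        moreover have "w x = y"
          using u[of 0] in_orbit_self[OF N h, of x] by (simp add: w_def)
        moreover have "v = restrict w (A - ?O)"
          using vext by (auto simp: fun_eq_iff w_def extensional_def)
        ultimately show "v \<in> (\<lambda>w. restrict w (A - ?O)) ` {w \<in> intertwiners A h B g. w x = y}"
          by blast
      qed
    qed
  qed
  thus ?thesis by (rule bij_betw_same_card)
qed

text \<open>The image of a chosen \<open>x\<close> on a cycle of length \<open>k\<close> can be any of the \<open>k m\<close> elements on cycles of length
\<open>k\<close>, where \<open>m\<close> is the multiplicity of \<open>k\<close>. This is the recursion \<open>z_mset_remove\<close>.\<close>

lemma card_intertwiners:
  assumes "finite A" "finite B" "\<And>y. y \<in> A \<Longrightarrow> h y \<in> A" "\<And>y. y \<in> B \<Longrightarrow> g y \<in> B"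
  shows "card (intertwiners A h B g)
       = (if cyc_type A h = cyc_type B g then z_mset (cyc_type A h) else 0)"
  using assms
proof (induction "card A" arbitrary: A B rule: less_induct)
  case (less A B)
  show ?case
  proof (cases "A = {}")
    case True
    show ?thesis
    proof (cases "B = {}")
      case True
      hence "intertwiners A h B g = {\<lambda>_. undefined}"
        using \<open>A = {}\<close> by (auto simp: intertwiners_def bij_betw_def)
      thus ?thesis using True \<open>A = {}\<close> by (simp add: cyc_type_def z_mset_def)
    next
      case False
      hence "intertwiners A h B g = {}" using True by (auto simp: intertwiners_def bij_betw_def)
      moreover have "cyc_type B g \<noteq> {#}"
        using False less.prems(2) by (simp add: cyc_type_def mset_set_empty_iff)
      ultimately show ?thesis using True by (auto simp: cyc_type_def)
    qed
  next
    case False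
    then obtain x where x: "x \<in> A" by blast
    let ?k = "card (orbit h x)"
    define Y where "Y = {y \<in> B. card (orbit g y) = ?k}"
    have finY: "finite Y" using less.prems(2) by (simp add: Y_def)
    have fin: "finite (intertwiners A h B g)"
      by (rule finite_subset[of _ "A \<rightarrow>\<^sub>E B"]) (use less.prems in \<open>auto simp: intertwiners_def intro: finite_PiE\<close>)
    have part: "intertwiners A h B g = (\<Union>y\<in>Y. {w \<in> intertwiners A h B g. w x = y})"
    proof -
      have "w x \<in> Y" if w: "w \<in> intertwiners A h B g" for w
        using intertwiner_orbit(2)[OF w less.prems(3) x] w x
        by (auto simp: Y_def intertwiners_def)
      thus ?thesis by blast
    qed
    have "card (intertwiners A h B g) = (\<Sum>y\<in>Y. card {w \<in> intertwiners A h B g. w x = y})"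
      by (subst part, rule card_UN_disjoint) (use fin finY in auto)
    also have "\<dots> = (\<Sum>y\<in>Y. if cyc_type A h = cyc_type B g then z_mset (cyc_type A h - {#?k#}) else 0)"
    proof (rule sum.cong)
      fix y assume "y \<in> Y"
      hence y: "y \<in> B" "card (orbit g y) = ?k" by (auto simp: Y_def)
      let ?A = "A - orbit h x" and ?B = "B - orbit g y"
      have "card {w \<in> intertwiners A h B g. w x = y} = card (intertwiners ?A h ?B g)"
        by (rule card_intertwiners_fibre[OF less.prems(3,4) x y])
      also have "\<dots> = (if cyc_type ?A h = cyc_type ?B g then z_mset (cyc_type ?A h) else 0)"
      proof (rule less.hyps)
        show "card ?A < card A"
          using x in_orbit_self[OF N h, of x] less.prems(1) by (intro psubset_card_mono) auto
        show "h z \<in> ?A" if "z \<in> ?A" for z by (rule diff_orbit_invariant[OF N h less.prems(3) that])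
        show "g z \<in> ?B" if "z \<in> ?B" for z by (rule diff_orbit_invariant[OF N g less.prems(4) that])
      qed (use less.prems in auto)
      finally show "card {w \<in> intertwiners A h B g. w x = y}
          = (if cyc_type A h = cyc_type B g then z_mset (cyc_type A h - {#?k#}) else 0)"
        using cyc_type_remove[OF N h less.prems(1) x less.prems(3)]
          cyc_type_remove[OF N g less.prems(2) y(1) less.prems(4)] y(2) by simp
    qed simp
    also have "\<dots> = (if cyc_type A h = cyc_type B g then card Y * z_mset (cyc_type A h - {#?k#}) else 0)"
      by simp
    also have "\<dots> = (if cyc_type A h = cyc_type B g then z_mset (cyc_type A h) else 0)"
    proof -
      have "?k \<in># cyc_type A h"
        using cyc_type_remove[OF N h less.prems(1) x less.prems(3)] by simp
      moreover have "card Y = ?k * count (cyc_type B g) ?k"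
        unfolding Y_def by (rule card_cycle_length[OF N g less.prems(2,4)])
      ultimately show ?thesis using z_mset_remove[of ?k "cyc_type A h"] by auto
    qed
    finally show ?thesis .
  qed
qed

lemma card_conjugators:
  "card {w. w permutes N \<and> inv g \<circ> w \<circ> h = w}
   = (if cyc_type N h = cyc_type N g then z_mset (cyc_type N h) else 0)"
proof -
  have "bij_betw (\<lambda>w. restrict w N) {w. w permutes N \<and> inv g \<circ> w \<circ> h = w} (intertwiners N h N g)"
  proof (rule bij_betwI[where g = "\<lambda>v x. if x \<in> N then v x else x"])
    show "(\<lambda>w. restrict w N) \<in> {w. w permutes N \<and> inv g \<circ> w \<circ> h = w} \<rightarrow> intertwiners N h N g"
    proof
      fix w assume "w \<in> {w. w permutes N \<and> inv g \<circ> w \<circ> h = w}"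
      hence w: "w permutes N" "inv g \<circ> w \<circ> h = w" by auto
      have "w (h x) = g (w x)" for x
        using fun_cong[OF w(2), of x] permutes_inverses(1)[OF g, of "w (h x)"] by simp
      moreover have "bij_betw (restrict w N) N N"
        using permutes_imp_bij[OF w(1)] by (subst bij_betw_cong[of _ _ w]) auto
      ultimately show "restrict w N \<in> intertwiners N h N g"
        using w(1) h by (auto simp: intertwiners_def permutes_in_image)
    qed
    show "(\<lambda>v x. if x \<in> N then v x else x) \<in> intertwiners N h N g \<rightarrow> {w. w permutes N \<and> inv g \<circ> w \<circ> h = w}"
    proof
      fix v assume v: "v \<in> intertwiners N h N g"
      let ?w = "\<lambda>x. if x \<in> N then v x else x"
      have vbij: "bij_betw v N N" using v by (simp add: intertwiners_def)
      have "bij_betw ?w N N" using vbij by (subst bij_betw_cong[of _ _ v]) auto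
      hence "?w permutes N" by (rule bij_imp_permutes) simp
      moreover have "inv g (?w (h x)) = ?w x" for x
      proof (cases "x \<in> N")
        case True
        thus ?thesis using v h by (simp add: intertwiners_def permutes_in_image permutes_inverses(2)[OF g])
      next
        case False
        thus ?thesis using permutes_not_in[OF h] permutes_not_in[OF permutes_inv[OF g]] by simp
      qed
      ultimately show "?w \<in> {w. w permutes N \<and> inv g \<circ> w \<circ> h = w}" by (auto simp: fun_eq_iff)
    qed
    show "(\<lambda>x. if x \<in> N then restrict w N x else x) = w"
      if "w \<in> {w. w permutes N \<and> inv g \<circ> w \<circ> h = w}" for w
      using that by (auto simp: fun_eq_iff permutes_not_in)
    show "restrict (\<lambda>x. if x \<in> N then v x else x) N = v" if "v \<in> intertwiners N h N g" for v
      using that by (auto simp: intertwiners_def fun_eq_iff PiE_def extensional_def)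
  qed
  hence "card {w. w permutes N \<and> inv g \<circ> w \<circ> h = w} = card (intertwiners N h N g)"
    by (rule bij_betw_same_card)
  also have "\<dots> = (if cyc_type N h = cyc_type N g then z_mset (cyc_type N h) else 0)"
    by (rule card_intertwiners) (use N g h in \<open>simp_all add: permutes_in_image\<close>)
  finally show ?thesis .
qed

end

text \<open>The value of the character at a partition is its value at some permutation of that cycle type, so
one has to exist: each new part \<open>k\<close> contributes the cyclic shift \<open>c\<close> of the next \<open>k\<close> numbers.\<close>

lemma permutation_of_cycle_type:
  assumes "0 \<notin> set mu"
  shows "\<exists>g. g permutes {1..sum_list mu} \<and> cyc_type {1..sum_list mu} g = mset mu"
  using assms
proof (induction mu)
  case Nil
  show ?case by (intro exI[of _ id]) (simp add: cyc_type_def id_def)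
next
  case (Cons k mu)
  let ?m = "sum_list mu"
  obtain g where g: "g permutes {1..?m}" "cyc_type {1..?m} g = mset mu" using Cons by auto
  have k: "k > 0" using Cons.prems by auto
  define c where "c x = (if x \<in> {?m + 1..?m + k} then (if x = ?m + k then ?m + 1 else x + 1) else x)" for x
  have c: "c permutes {?m + 1..?m + k}"
  proof (rule inj_imp_permutes)
    show "inj_on c {?m + 1..?m + k}" by (rule inj_onI) (auto simp: c_def split: if_splits)
  qed (use k in \<open>auto simp: c_def\<close>)
  let ?N = "{1..?m + k}" and ?O = "{?m + 1..?m + k}" and ?f = "c \<circ> g"
  have f: "?f permutes ?N"
    by (intro permutes_compose permutes_subset[OF g(1)] permutes_subset[OF c]) auto
  have f1: "?f x = g x" "?f x \<in> {1..?m}" if "x \<in> {1..?m}" for x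
  proof -
    have "g x \<in> {1..?m}" using that permutes_in_image[OF g(1)] by blast
    thus "?f x = g x" "?f x \<in> {1..?m}" by (auto simp: c_def)
  qed
  have f2: "?f x = c x" if "x \<in> ?O" for x
    using that permutes_not_in[OF g(1), of x] by simp
  have orb: "orbit ?f (?m + 1) = ?O"
  proof
    have "?f x \<in> ?O" if "x \<in> ?O" for x
      using f2[OF that] that by (simp only: permutes_in_image[OF c])
    thus "orbit ?f (?m + 1) \<subseteq> ?O" by (rule orbit_subset_invariant[OF _ f, rotated 2]) (use k in auto)
    have pow: "(?f ^^ i) (?m + 1) = ?m + 1 + i" if "i < k" for i
      using that
    proof (induction i)
      case (Suc i)
      have "(?f ^^ Suc i) (?m + 1) = ?f ((?f ^^ i) (?m + 1))" by simp
      also have "(?f ^^ i) (?m + 1) = ?m + 1 + i" by (rule Suc.IH) (use Suc.prems in simp)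
      also have "?f (?m + 1 + i) = c (?m + 1 + i)" using Suc.prems by (intro f2) auto
      also have "\<dots> = ?m + 1 + Suc i" using Suc.prems by (simp add: c_def)
      finally show ?case .
    qed simp
    show "?O \<subseteq> orbit ?f (?m + 1)"
    proof
      fix x assume "x \<in> ?O"
      hence "x - (?m + 1) < k" "x = ?m + 1 + (x - (?m + 1))" by auto
      hence "x = (?f ^^ (x - (?m + 1))) (?m + 1)" using pow by metis
      thus "x \<in> orbit ?f (?m + 1)" unfolding orbit_funpow[OF _ f, simplified] by blast
    qed
  qed
  have "cyc_type ?N ?f = add_mset (card ?O) (cyc_type (?N - ?O) ?f)"
    unfolding orb[symmetric]
    by (rule cyc_type_remove[OF _ f]) (use k f in \<open>simp_all only: permutes_in_image, auto\<close>)
  also have "?N - ?O = {1..?m}" by auto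
  also have "cyc_type {1..?m} ?f = cyc_type {1..?m} g"
  proof -
    have "orbit ?f x = orbit g x" if "x \<in> {1..?m}" for x
      by (rule orbit_cong0[OF that]) (use f1 in auto)
    hence "orbit ?f ` {1..?m} = orbit g ` {1..?m}" by (rule image_cong[OF refl])
    thus ?thesis by (simp only: cyc_type_def)
  qed
  finally have "cyc_type ?N ?f = mset (k # mu)" using g(2) by (simp add: o_def)
  hence "?f permutes ?N \<and> cyc_type ?N ?f = mset (k # mu)" using f by blast
  moreover have "sum_list (k # mu) = ?m + k" by simp
  ultimately show ?case by (metis (no_types))
qed

section \<open>Power sums in the variables \<open>k powr (- s)\<close>\<close>

lemma has_sum_finite_sum:
  fixes f :: "'i \<Rightarrow> 'a \<Rightarrow> 'b :: topological_comm_monoid_add"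
  assumes "finite I" "\<And>i. i \<in> I \<Longrightarrow> (f i has_sum c i) A"
  shows "((\<lambda>x. \<Sum>i\<in>I. f i x) has_sum (\<Sum>i\<in>I. c i)) A"
  using assms by (induction I rule: finite_induct) (auto intro: has_sum_add)

lemma bij_betw_Suc: "bij_betw Suc UNIV {1..}"
  by (auto simp: bij_betw_def image_def Suc_le_eq gr0_conv_Suc)

lemma riemann_zeta_infsum:
  assumes "Re s > 1"
  shows "(\<lambda>k. norm (of_nat k powr (- s) :: complex)) summable_on {1..}"
    and "(\<Sum>\<^sub>\<infinity>k\<in>{1..}. of_nat k powr (- s)) = riemann_zeta s"
proof -
  note sm = riemann_zeta_summable[OF assms]
  have "(\<lambda>k. norm (of_nat (Suc k) powr (- s) :: complex)) summable_on UNIV"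
    by (rule norm_summable_imp_summable_on) (use sm in simp)
  thus "(\<lambda>k. norm (of_nat k powr (- s) :: complex)) summable_on {1..}"
    using summable_on_reindex_bij_betw[OF bij_betw_Suc, of "\<lambda>k. norm (of_nat k powr (- s) :: complex)"]
    by blast
  have "(\<lambda>k. of_nat (Suc k) powr (- s) :: complex) sums riemann_zeta s"
    unfolding riemann_zeta_def by (rule summable_sums[OF summable_norm_cancel[OF sm]])
  hence "((\<lambda>k. of_nat (Suc k) powr (- s) :: complex) has_sum riemann_zeta s) UNIV"
    by (rule norm_summable_imp_has_sum[OF sm])
  hence "((\<lambda>k. of_nat k powr (- s) :: complex) has_sum riemann_zeta s) {1..}"
    using has_sum_reindex_bij_betw[OF bij_betw_Suc, of "\<lambda>k. of_nat k powr (- s) :: complex"] by blast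
  thus "(\<Sum>\<^sub>\<infinity>k\<in>{1..}. of_nat k powr (- s)) = riemann_zeta s" by (rule infsumI)
qed

definition monomial :: "nat set \<Rightarrow> complex \<Rightarrow> (nat \<Rightarrow> nat) \<Rightarrow> complex" where
  "monomial N s f = (\<Prod>x\<in>N. of_nat (f x) powr (- s))"

definition words :: "nat set \<Rightarrow> (nat \<Rightarrow> nat) set" where
  "words N = N \<rightarrow>\<^sub>E {1..}"

lemma monomial_summable:
  assumes "finite N" "Re s > 1"
  shows "monomial N s summable_on words N"
proof -
  have "Infinite_Set_Sum.abs_summable_on (\<lambda>f. \<Prod>x\<in>N. of_nat (f x) powr (- s) :: complex) (N \<rightarrow>\<^sub>E {1..})"
    by (rule abs_summable_on_prod_PiE[of N "\<lambda>_. {1..}" "\<lambda>_ k. of_nat k powr (- s)"])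
       (use assms riemann_zeta_infsum(1) in \<open>auto simp: abs_summable_equivalent[symmetric]\<close>)
  thus ?thesis unfolding words_def monomial_def[abs_def]
    by (simp add: abs_summable_equivalent[symmetric] abs_summable_summable)
qed

lemma complex_powr_power:
  assumes "x \<noteq> (0 :: complex)"
  shows "(x powr a) ^ n = x powr (of_nat n * a)"
  using assms by (simp add: powr_def exp_of_nat_mult[symmetric] mult.assoc)

lemma words_comp: "f \<in> words N \<Longrightarrow> g permutes N \<Longrightarrow> f \<circ> g \<in> words N"
  unfolding words_def
  by (auto simp: PiE_def Pi_def extensional_def permutes_in_image permutes_not_in)

lemma monomial_comp: "g permutes N \<Longrightarrow> monomial N s (f \<circ> g) = monomial N s f"
  unfolding monomial_def using prod.permute[of g N "\<lambda>x. of_nat (f x) powr (- s)"]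
  by (simp add: o_def)

text \<open>A word fixed by \<open>g\<close> is a free choice of one value for each cycle, and a cycle of length \<open>k\<close> with
value \<open>v\<close> contributes the factor \<open>v powr (- k s)\<close>.\<close>

lemma infsum_fixed_words:
  assumes N: "finite N" and g: "g permutes N" and s: "Re s > 1"
  shows "infsum (monomial N s) {f \<in> words N. f \<circ> g = f}
       = (\<Prod>k\<in>#cyc_type N g. riemann_zeta (of_nat k * s))"
proof -
  let ?O = "orbit g ` N"
  have finO: "finite ?O" using N by simp
  define \<Phi> where "\<Phi> h = (\<lambda>x\<in>N. h (orbit g x) :: nat)" for h
  have gstep: "orbit g (g x) = orbit g x" for x
    by (rule permutation_orbit_step[OF perm_g[OF N g]])
  have bij: "bij_betw \<Phi> (?O \<rightarrow>\<^sub>E {1..}) {f \<in> words N. f \<circ> g = f}"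
  proof (rule bij_betwI[where g = "\<lambda>f. \<lambda>U\<in>?O. f (SOME x. x \<in> U)"])
    have rep: "(SOME y. y \<in> orbit g x) \<in> orbit g x" for x
      by (rule someI[of _ x]) (rule in_orbit_self[OF N g])
    have sub: "orbit g x \<subseteq> N" if "x \<in> N" for x
      by (rule permutes_orbit_subset[OF g that])
    have const: "f y = f x" if "f \<circ> g = f" "y \<in> orbit g x" for f :: "nat \<Rightarrow> nat" and x y
      using that(2)
    proof induction
      case base
      show ?case using fun_cong[OF that(1), of x] by simp
    next
      case (step y)
      thus ?case using fun_cong[OF that(1), of y] by simp
    qed
    show "\<Phi> \<in> (?O \<rightarrow>\<^sub>E {1..}) \<rightarrow> {f \<in> words N. f \<circ> g = f}"
    proof
      fix h :: "nat set \<Rightarrow> nat" assume h: "h \<in> ?O \<rightarrow>\<^sub>E {1..}"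
      have "\<Phi> h (g x) = \<Phi> h x" for x
        by (simp add: \<Phi>_def gstep permutes_in_image[OF g])
      moreover have "\<Phi> h \<in> words N" using h by (auto simp: \<Phi>_def words_def)
      ultimately show "\<Phi> h \<in> {f \<in> words N. f \<circ> g = f}" by (simp add: fun_eq_iff)
    qed
    show "(\<lambda>f. \<lambda>U\<in>?O. f (SOME x. x \<in> U)) \<in> {f \<in> words N. f \<circ> g = f} \<rightarrow> (?O \<rightarrow>\<^sub>E {1..})"
    proof
      fix f assume f: "f \<in> {f \<in> words N. f \<circ> g = f}"
      have "f (SOME y. y \<in> orbit g x) \<in> {1..}" if "x \<in> N" for x
      proof -
        have "(SOME y. y \<in> orbit g x) \<in> N" using rep[of x] sub[OF that] by blast
        thus ?thesis using f by (auto simp: words_def)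
      qed
      thus "(\<lambda>U\<in>?O. f (SOME x. x \<in> U)) \<in> ?O \<rightarrow>\<^sub>E {1..}" by (intro restrict_PiE_iff[THEN iffD2] ballI) auto
    qed
    show "(\<lambda>U\<in>?O. \<Phi> h (SOME x. x \<in> U)) = h" if h: "h \<in> ?O \<rightarrow>\<^sub>E {1..}" for h :: "nat set \<Rightarrow> nat"
    proof
      fix U show "(\<lambda>U\<in>?O. \<Phi> h (SOME x. x \<in> U)) U = h U"
      proof (cases "U \<in> ?O")
        case True
        then obtain x where x: "x \<in> N" "U = orbit g x" by blast
        have "(SOME y. y \<in> orbit g x) \<in> N" using rep[of x] sub[OF x(1)] by blast
        moreover have "orbit g (SOME y. y \<in> orbit g x) = orbit g x"
          by (rule orbit_eq[OF N g rep])
        ultimately show ?thesis using x by (simp add: \<Phi>_def)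
      next
        case False
        thus ?thesis using h extensional_arb[of h ?O U] by (simp add: PiE_def)
      qed
    qed
    show "\<Phi> (\<lambda>U\<in>?O. f (SOME x. x \<in> U)) = f" if f: "f \<in> {f \<in> words N. f \<circ> g = f}" for f
    proof
      fix x show "\<Phi> (\<lambda>U\<in>?O. f (SOME x. x \<in> U)) x = f x"
      proof (cases "x \<in> N")
        case True
        have "f (SOME y. y \<in> orbit g x) = f x" using const[OF _ rep] f by simp
        thus ?thesis using True by (simp add: \<Phi>_def)
      next
        case False
        thus ?thesis using f extensional_arb[of f N x] by (simp add: \<Phi>_def words_def PiE_def)
      qed
    qed
  qed
  have mon: "monomial N s (\<Phi> h) = (\<Prod>U\<in>?O. of_nat (h U) powr (- (of_nat (card U) * s)))"
    if h: "h \<in> ?O \<rightarrow>\<^sub>E {1..}" for h :: "nat set \<Rightarrow> nat"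
  proof -
    have "monomial N s (\<Phi> h) = (\<Prod>x\<in>N. of_nat (h (orbit g x)) powr (- s))"
      unfolding monomial_def by (rule prod.cong) (simp_all add: \<Phi>_def)
    also have "\<dots> = (\<Prod>U\<in>?O. \<Prod>x | x \<in> N \<and> orbit g x = U. of_nat (h (orbit g x)) powr (- s))"
      by (rule prod.group[symmetric]) (use N in auto)
    also have "\<dots> = (\<Prod>U\<in>?O. of_nat (h U) powr (- (of_nat (card U) * s)))"
    proof (rule prod.cong)
      fix U assume U: "U \<in> ?O"
      then obtain y where y: "y \<in> N" "U = orbit g y" by blast
      have "{x. x \<in> N \<and> orbit g x = U} = U"
        using permutes_orbit_subset[OF g y(1)] orbit_eq[OF N g] in_orbit_self[OF N g] y(2) by blast
      hence "(\<Prod>x | x \<in> N \<and> orbit g x = U. of_nat (h (orbit g x)) powr (- s) :: complex)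
          = (\<Prod>x\<in>U. of_nat (h U) powr (- s))"
        by (intro prod.cong) auto
      moreover have "h U \<in> {1..}" using h U by (rule PiE_mem)
      ultimately show "(\<Prod>x | x \<in> N \<and> orbit g x = U. of_nat (h (orbit g x)) powr (- s) :: complex)
          = of_nat (h U) powr (- (of_nat (card U) * s))"
        by (simp add: complex_powr_power)
    qed simp
    finally show ?thesis .
  qed
  have Re: "Re (of_nat (card U) * s) > 1" if U: "U \<in> ?O" for U
  proof -
    obtain x where "U = orbit g x" using U by blast
    hence "finite U" "U \<noteq> {}" using finite_orbit_g[OF N g, of x] orbit_nonempty[of g x] by simp_all
    hence "card U \<ge> 1" by (simp add: Suc_le_eq card_gt_0_iff)
    hence "1 * Re s \<le> real (card U) * Re s" using s by (intro mult_right_mono) auto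
    moreover have "Re (of_nat (card U) * s) = real (card U) * Re s" by simp
    ultimately show ?thesis using s by linarith
  qed
  have "infsum (monomial N s) {f \<in> words N. f \<circ> g = f}
      = infsum (\<lambda>h. monomial N s (\<Phi> h)) (?O \<rightarrow>\<^sub>E {1..})"
    by (rule infsum_reindex_bij_betw[OF bij, symmetric])
  also have "\<dots> = infsum (\<lambda>h. \<Prod>U\<in>?O. of_nat (h U) powr (- (of_nat (card U) * s))) (?O \<rightarrow>\<^sub>E {1..})"
    by (rule infsum_cong) (rule mon)
  also have "\<dots> = (\<Prod>U\<in>?O. \<Sum>\<^sub>\<infinity>k\<in>{1..}. of_nat k powr (- (of_nat (card U) * s)))"
    by (rule infsum_prod_PiE_abs[OF finO]) (rule riemann_zeta_infsum(1)[OF Re])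
  also have "\<dots> = (\<Prod>U\<in>?O. riemann_zeta (of_nat (card U) * s))"
    by (intro prod.cong refl riemann_zeta_infsum(2) Re)
  also have "\<dots> = (\<Prod>k\<in>#cyc_type N g. riemann_zeta (of_nat k * s))"
    by (simp add: cyc_type_def prod_unfold_prod_mset image_mset.compositionality o_def)
  finally show ?thesis .
qed

context young_cells
begin

section \<open>Frobenius' character formula\<close>

text \<open>All fibres of the orbit map \<open>g \<mapsto> f \<circ> g\<close> are cosets of the stabilizer of \<open>f\<close>.\<close>

lemma sum_over_orbit:
  "(\<Sum>g\<in>S. H (f \<circ> g)) = of_nat (card {g \<in> S. f \<circ> g = f}) * (\<Sum>u\<in>(\<lambda>g. f \<circ> g) ` S. H u :: complex)"
proof -
  have "(\<Sum>g\<in>S. H (f \<circ> g)) = (\<Sum>u\<in>(\<lambda>g. f \<circ> g) ` S. \<Sum>g | g \<in> S \<and> f \<circ> g = u. H (f \<circ> g))"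
    by (rule sum.group[symmetric]) (use finite_S in auto)
  also have "\<dots> = (\<Sum>u\<in>(\<lambda>g. f \<circ> g) ` S. of_nat (card {g \<in> S. f \<circ> g = f}) * H u)"
  proof (rule sum.cong)
    fix u assume "u \<in> (\<lambda>g. f \<circ> g) ` S"
    then obtain h where h: "h permutes N" "u = f \<circ> h" by auto
    have eq: "f \<circ> g \<circ> h = f \<circ> h \<longleftrightarrow> f \<circ> g = f" for g by (rule comp_perm_cancel[OF h(1)])
    have "card {g. g \<in> S \<and> f \<circ> g = u} = card {g \<in> S. f \<circ> g = f}"
    proof (rule bij_betw_same_card[of "\<lambda>g. g \<circ> inv h"], rule bij_betwI[where g = "\<lambda>g. g \<circ> h"])
      show "(\<lambda>g. g \<circ> inv h) \<in> {g. g \<in> S \<and> f \<circ> g = u} \<rightarrow> {g \<in> S. f \<circ> g = f}"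
      proof
        fix g assume g: "g \<in> {g. g \<in> S \<and> f \<circ> g = u}"
        have "f \<circ> (g \<circ> inv h) \<circ> h = f \<circ> h"
          using g by (simp add: comp_assoc perm_comp_inv[OF h(1)] h(2))
        hence "f \<circ> (g \<circ> inv h) = f" by (simp only: eq)
        thus "g \<circ> inv h \<in> {g \<in> S. f \<circ> g = f}"
          using g permutes_compose[OF permutes_inv[OF h(1)], of g] by simp
      qed
      show "(\<lambda>g. g \<circ> h) \<in> {g \<in> S. f \<circ> g = f} \<rightarrow> {g. g \<in> S \<and> f \<circ> g = u}"
      proof
        fix g assume g: "g \<in> {g \<in> S. f \<circ> g = f}"
        hence "f \<circ> g \<circ> h = f \<circ> h" by simp
        hence "f \<circ> (g \<circ> h) = u" by (simp only: h(2) comp_assoc)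
        thus "g \<circ> h \<in> {g. g \<in> S \<and> f \<circ> g = u}" using g permutes_compose[OF h(1)] by simp
      qed
    qed (auto simp: perm_comp_inv[OF h(1)])
    thus "(\<Sum>g | g \<in> S \<and> f \<circ> g = u. H (f \<circ> g)) = of_nat (card {g \<in> S. f \<circ> g = f}) * H u"
      by simp
  qed simp
  finally show ?thesis by (simp add: sum_distrib_left)
qed

lemma sum_semistandard_orbit:
  "(\<Sum>g\<in>S. polytabloid (f \<circ> g) (f \<circ> g) / symmetrizer_scalar) = (\<Sum>g\<in>S. of_bool (semistandard (f \<circ> g)))"
proof -
  let ?W = "(\<lambda>g. f \<circ> g) ` S"
  have fin: "finite ?W" using finite_S by simp
  have inv: "w \<circ> g \<in> ?W" if w: "w \<in> ?W" and g: "g permutes N" for w g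
  proof -
    obtain h where h: "h permutes N" "w = f \<circ> h" using w by auto
    have "w \<circ> g = f \<circ> (h \<circ> g)" by (simp add: h(2) comp_assoc)
    thus ?thesis using permutes_compose[OF g h(1)] by blast
  qed
  have "(\<Sum>u\<in>?W. polytabloid u u / symmetrizer_scalar) = of_nat (card {T. T \<in> ?W \<and> semistandard T})"
    by (subst card_semistandard[OF fin]) (rule inv, assumption+, simp add: sum_divide_distrib)
  also have "\<dots> = (\<Sum>u\<in>?W. of_bool (semistandard u))"
    using fin by (simp add: of_bool_def sum.If_cases Int_def)
  finally show ?thesis
    using sum_over_orbit[of "\<lambda>u. polytabloid u u / symmetrizer_scalar" f]
      sum_over_orbit[of "\<lambda>u. of_bool (semistandard u)" f] by simp
qed

text \<open>Averaging over \<open>S\<close> replaces the partition of the infinite set of words into rearrangement classes: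
a sum over one class becomes a finite sum over \<open>S\<close>, and no double series has to be rearranged.\<close>

lemma has_sum_average:
  assumes "(X has_sum I) (words N)"
  shows "((\<lambda>f. \<Sum>g\<in>S. X (f \<circ> g) :: complex) has_sum of_nat (card S) * I) (words N)"
proof -
  have "((\<lambda>f. X (f \<circ> g)) has_sum I) (words N)" if "g \<in> S" for g
  proof -
    have g: "g permutes N" using that by simp
    have "bij_betw (\<lambda>f. f \<circ> g) (words N) (words N)"
      by (rule bij_betwI[where g = "\<lambda>f. f \<circ> inv g"])
         (auto simp: words_comp g permutes_inv perm_comp_inv[OF g])
    thus ?thesis using assms has_sum_reindex_bij_betw by blast
  qed
  from has_sum_finite_sum[OF finite_S this] show ?thesis by simp
qed

lemma polytabloid_diag: "polytabloid f f = (\<Sum>q\<in>C. \<Sum>p\<in>R. of_int (sign q) * of_bool (f \<circ> (q \<circ> p) = f))"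
  by (simp add: symmetrize_apply delta_def of_bool_def comp_assoc)

text \<open>By \<open>sum_semistandard_orbit\<close> the indicator function of the semistandard words and the diagonal
coefficient of the idempotent have the same averages over rearrangements, and the monomial is
constant on rearrangements. So the former can be replaced by the latter, which is a signed sum of
indicator functions of fixed words.\<close>

lemma infsum_semistandard:
  assumes s: "Re s > 1"
  shows "infsum (monomial N s) {f \<in> words N. semistandard f}
    = (\<Sum>q\<in>C. \<Sum>p\<in>R. of_int (sign q) *
        (\<Prod>k\<in>#cyc_type N (q \<circ> p). riemann_zeta (of_nat k * s))) / symmetrizer_scalar"
proof -
  have restrict: "((\<lambda>f. monomial N s f * of_bool (P f)) has_sum infsum (monomial N s) {f \<in> words N. P f}) (words N)"
    for P
  proof -
    have "monomial N s summable_on {f \<in> words N. P f}"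
      by (rule summable_on_subset_banach[OF monomial_summable[OF finite_N s]]) auto
    hence "(monomial N s has_sum infsum (monomial N s) {f \<in> words N. P f}) {f \<in> words N. P f}"
      by (rule has_sum_infsum)
    also have "?this \<longleftrightarrow> ?thesis" by (rule has_sum_cong_neutral) auto
    finally show ?thesis .
  qed
  define P where "P q p = infsum (monomial N s) {f \<in> words N. f \<circ> (q \<circ> p) = f}" for q p :: "nat \<Rightarrow> nat"
  define X where "X f = monomial N s f * (polytabloid f f / symmetrizer_scalar)" for f
  define Y where "Y f = monomial N s f * of_bool (semistandard f)" for f
  let ?I = "(\<Sum>q\<in>C. \<Sum>p\<in>R. of_int (sign q) / symmetrizer_scalar * P q p)"
  let ?J = "infsum (monomial N s) {f \<in> words N. semistandard f}"
  have X: "(X has_sum ?I) (words N)"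
  proof -
    have "((\<lambda>f. \<Sum>q\<in>C. \<Sum>p\<in>R. of_int (sign q) / symmetrizer_scalar * (monomial N s f * of_bool (f \<circ> (q \<circ> p) = f)))
        has_sum ?I) (words N)"
      unfolding P_def by (intro has_sum_finite_sum finite_C finite_R has_sum_cmult_right restrict)
    also have "(\<lambda>f. \<Sum>q\<in>C. \<Sum>p\<in>R. of_int (sign q) / symmetrizer_scalar * (monomial N s f * of_bool (f \<circ> (q \<circ> p) = f))) = X"
      by (rule ext, unfold X_def polytabloid_diag)
         (simp add: sum_distrib_left sum_divide_distrib mult_ac)
    finally show ?thesis .
  qed
  have Y: "(Y has_sum ?J) (words N)"
    unfolding Y_def by (rule restrict)
  have XY: "(\<Sum>g\<in>S. X (f \<circ> g)) = (\<Sum>g\<in>S. Y (f \<circ> g))" for f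
  proof -
    have "(\<Sum>g\<in>S. X (f \<circ> g)) = monomial N s f * (\<Sum>g\<in>S. polytabloid (f \<circ> g) (f \<circ> g) / symmetrizer_scalar)"
      unfolding X_def sum_distrib_left by (intro sum.cong) (simp_all add: monomial_comp)
    also have "\<dots> = (\<Sum>g\<in>S. Y (f \<circ> g))"
      unfolding sum_semistandard_orbit Y_def sum_distrib_left
      by (intro sum.cong) (simp_all add: monomial_comp)
    finally show ?thesis .
  qed
  have "of_nat (card S) * ?I = of_nat (card S) * ?J"
    by (rule has_sum_unique[OF has_sum_average[OF X, unfolded XY] has_sum_average[OF Y]])
  moreover have "card S \<noteq> 0" using finite_S by (auto intro: permutes_id)
  ultimately have "?J = ?I" by simp
  also have "\<dots> = (\<Sum>q\<in>C. \<Sum>p\<in>R. of_int (sign q) *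
        (\<Prod>k\<in>#cyc_type N (q \<circ> p). riemann_zeta (of_nat k * s))) / symmetrizer_scalar"
  proof -
    have "P q p = (\<Prod>k\<in>#cyc_type N (q \<circ> p). riemann_zeta (of_nat k * s))" if "q \<in> C" "p \<in> R" for q p
      unfolding P_def
      by (rule infsum_fixed_words[OF finite_N permutes_compose[OF R_perm C_perm] s]) (use that in auto)
    thus ?thesis by (simp add: sum_divide_distrib)
  qed
  finally show ?thesis .
qed

text \<open>The diagonal coefficient at \<open>w\<close> receives a contribution from \<open>(q, p)\<close> if and only if \<open>w\<close> conjugates
\<open>q \<circ> p\<close> to \<open>g\<close>.\<close>

lemma trace_class_sum:
  assumes g: "g permutes N"
  shows "(\<Sum>w\<in>S. polytabloid w (inv g \<circ> w)) = of_nat (z_mset (cyc_type N g)) *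
    (\<Sum>q\<in>C. \<Sum>p\<in>R. of_int (sign q) * of_bool (cyc_type N (q \<circ> p) = cyc_type N g))"
proof -
  have "(\<Sum>w\<in>S. polytabloid w (inv g \<circ> w))
      = (\<Sum>w\<in>S. \<Sum>q\<in>C. \<Sum>p\<in>R. of_int (sign q) * of_bool (inv g \<circ> w \<circ> (q \<circ> p) = w))"
    by (simp add: symmetrize_apply delta_def of_bool_def comp_assoc)
  also have "\<dots> = (\<Sum>q\<in>C. \<Sum>w\<in>S. \<Sum>p\<in>R. of_int (sign q) * of_bool (inv g \<circ> w \<circ> (q \<circ> p) = w))"
    by (rule sum.swap)
  also have "\<dots> = (\<Sum>q\<in>C. \<Sum>p\<in>R. \<Sum>w\<in>S. of_int (sign q) * of_bool (inv g \<circ> w \<circ> (q \<circ> p) = w))"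
    by (intro sum.cong refl sum.swap)
  also have "\<dots> = (\<Sum>q\<in>C. \<Sum>p\<in>R. of_int (sign q) *
      (of_nat (z_mset (cyc_type N g)) * of_bool (cyc_type N (q \<circ> p) = cyc_type N g)))"
  proof (rule sum.cong[OF refl], rule sum.cong[OF refl])
    fix q p assume "q \<in> C" "p \<in> R"
    hence qp: "(q \<circ> p) permutes N" by (intro permutes_compose R_perm C_perm)
    have "(\<Sum>w\<in>S. of_bool (inv g \<circ> w \<circ> (q \<circ> p) = w) :: complex)
        = of_nat (card {w. w permutes N \<and> inv g \<circ> w \<circ> (q \<circ> p) = w})"
      using finite_S by (simp add: of_bool_def sum.If_cases Int_def)
    also have "\<dots> = of_nat (z_mset (cyc_type N g)) * of_bool (cyc_type N (q \<circ> p) = cyc_type N g)"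
      by (simp add: card_conjugators[OF finite_N g qp])
    finally show "(\<Sum>w\<in>S. of_int (sign q) * of_bool (inv g \<circ> w \<circ> (q \<circ> p) = w) :: complex)
      = of_int (sign q) * (of_nat (z_mset (cyc_type N g)) * of_bool (cyc_type N (q \<circ> p) = cyc_type N g))"
      by (simp flip: sum_distrib_left)
  qed
  also have "\<dots> = of_nat (z_mset (cyc_type N g)) *
    (\<Sum>q\<in>C. \<Sum>p\<in>R. of_int (sign q) * of_bool (cyc_type N (q \<circ> p) = cyc_type N g))"
    by (simp add: sum_distrib_left mult.left_commute)
  finally show ?thesis .
qed

end

section \<open>Diagrams, reading words and partitions\<close>

lemma row_reading_bij: "bij_betw (row_reading lam) (diagram lam) {1..sum_list lam}"
proof (induction lam rule: rev_induct)
  case Nil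
  have "diagram [] = {}" by (auto simp: diagram_def)
  thus ?case by (simp add: bij_betw_def)
next
  case (snoc k lam)
  let ?D = "{Suc (length lam)} \<times> {1..k}" and ?m = "sum_list lam"
  have D: "diagram (lam @ [k]) = diagram lam \<union> ?D"
    by (auto simp: diagram_def nth_append split: if_splits)
  have old: "row_reading (lam @ [k]) c = row_reading lam c" if "c \<in> diagram lam" for c
    using that by (auto simp: diagram_def row_reading_def)
  have new: "row_reading (lam @ [k]) (Suc (length lam), j) = ?m + j" for j
    by (simp add: row_reading_def)
  have "bij_betw (row_reading (lam @ [k])) (diagram lam) {1..?m}"
    using snoc by (subst bij_betw_cong[of _ _ "row_reading lam"]) (simp_all add: old)
  moreover have "bij_betw (row_reading (lam @ [k])) ?D {?m + 1..?m + k}"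
  proof (rule bij_betw_imageI)
    show "inj_on (row_reading (lam @ [k])) ?D" by (rule inj_onI) (auto simp: new)
    show "row_reading (lam @ [k]) ` ?D = {?m + 1..?m + k}"
    proof
      show "{?m + 1..?m + k} \<subseteq> row_reading (lam @ [k]) ` ?D"
      proof
        fix x assume x: "x \<in> {?m + 1..?m + k}"
        have "row_reading (lam @ [k]) (Suc (length lam), x - ?m) = x" using x by (simp add: new)
        moreover have "(Suc (length lam), x - ?m) \<in> ?D" using x by auto
        ultimately show "x \<in> row_reading (lam @ [k]) ` ?D" by (metis imageI)
      qed
    qed (auto simp: new)
  qed
  ultimately have "bij_betw (row_reading (lam @ [k])) (diagram lam \<union> ?D) ({1..?m} \<union> {?m + 1..?m + k})"
    by (rule bij_betw_combine) auto
  moreover have "{1..?m} \<union> {?m + 1..?m + k} = {1..sum_list (lam @ [k])}" by auto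
  ultimately show ?case by (simp only: D)
qed

definition cell :: "nat list \<Rightarrow> nat \<Rightarrow> nat \<times> nat" where
  "cell lam = inv_into (diagram lam) (row_reading lam)"

definition row_of :: "nat list \<Rightarrow> nat \<Rightarrow> nat" where "row_of lam x = fst (cell lam x)"
definition col_of :: "nat list \<Rightarrow> nat \<Rightarrow> nat" where "col_of lam x = snd (cell lam x)"

lemma cell_reading:
  "c \<in> diagram lam \<Longrightarrow> cell lam (row_reading lam c) = c"
  "c \<in> diagram lam \<Longrightarrow> row_reading lam c \<in> {1..sum_list lam}"
  "x \<in> {1..sum_list lam} \<Longrightarrow> cell lam x \<in> diagram lam"
  "x \<in> {1..sum_list lam} \<Longrightarrow> row_reading lam (cell lam x) = x"
  using row_reading_bij[of lam]
  by (auto simp: cell_def bij_betw_inv_into_left bij_betw_inv_into_right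
      dest: bij_betwE bij_betwE[OF bij_betw_inv_into])

lemma cell_eq: "cell lam x = (row_of lam x, col_of lam x)"
  by (simp add: row_of_def col_of_def)

lemma diagram_below:
  assumes lam: "sorted_wrt (\<ge>) lam" and ij: "(i', j') \<in> diagram lam"
    and "1 \<le> i" "i \<le> i'" "1 \<le> j" "j \<le> j'"
  shows "(i, j) \<in> diagram lam"
proof -
  have "lam ! (i' - 1) \<le> lam ! (i - 1)"
  proof (cases "i = i'")
    case False
    thus ?thesis using sorted_wrt_nth_less[OF lam, of "i - 1" "i' - 1"] assms
      by (auto simp: diagram_def)
  qed simp
  thus ?thesis using assms by (auto simp: diagram_def)
qed

lemma young_cells_diagram:
  assumes lam: "sorted_wrt (\<ge>) lam"
  shows "young_cells {1..sum_list lam} (row_of lam) (col_of lam)"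
proof
  fix x y assume xy: "x \<in> {1..sum_list lam}" "y \<in> {1..sum_list lam}"
    "row_of lam x = row_of lam y" "col_of lam x = col_of lam y"
  hence "cell lam x = cell lam y" by (simp add: cell_eq)
  thus "x = y" using cell_reading(4)[OF xy(1)] cell_reading(4)[OF xy(2)] by metis
next
  fix x assume "x \<in> {1..sum_list lam}"
  from cell_reading(3)[OF this] show "1 \<le> row_of lam x" "1 \<le> col_of lam x"
    by (auto simp: cell_eq diagram_def)
next
  fix x i j assume x: "x \<in> {1..sum_list lam}" and ij: "1 \<le> i" "i \<le> row_of lam x" "1 \<le> j" "j \<le> col_of lam x"
  have "(i, j) \<in> diagram lam"
    using diagram_below[OF lam cell_reading(3)[OF x, unfolded cell_eq] ij] .
  hence "row_reading lam (i, j) \<in> {1..sum_list lam}" "cell lam (row_reading lam (i, j)) = (i, j)"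
    by (simp_all only: cell_reading)
  thus "\<exists>y\<in>{1..sum_list lam}. row_of lam y = i \<and> col_of lam y = j"
    by (intro bexI[of _ "row_reading lam (i, j)"]) (simp_all add: row_of_def col_of_def)
qed simp

lemma block_stab_image:
  "block_stab N f = {p. p permutes N \<and> (\<forall>i. p ` {x \<in> N. f x = i} = {x \<in> N. f x = i})}"
proof (intro set_eqI iffI)
  fix p assume p: "p \<in> block_stab N f"
  have pN: "p permutes N" using p by (simp add: block_stab_def)
  have sub: "q ` {x \<in> N. f x = i} \<subseteq> {x \<in> N. f x = i}" if "q \<in> block_stab N f" for q i
    using that by (auto simp: block_stab_def permutes_in_image)
  have "{x \<in> N. f x = i} \<subseteq> p ` {x \<in> N. f x = i}" for i
  proof
    fix x assume "x \<in> {x \<in> N. f x = i}"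
    hence "inv p x \<in> {x \<in> N. f x = i}"
      using sub[OF perm_groupD(4)[OF perm_group_stab p], of i] by blast
    thus "x \<in> p ` {x \<in> N. f x = i}" using permutes_inverses(1)[OF pN, of x] by (metis imageI)
  qed
  thus "p \<in> {p. p permutes N \<and> (\<forall>i. p ` {x \<in> N. f x = i} = {x \<in> N. f x = i})}"
    using sub[OF p] pN by blast
next
  fix p assume p: "p \<in> {p. p permutes N \<and> (\<forall>i. p ` {x \<in> N. f x = i} = {x \<in> N. f x = i})}"
  have "f (p x) = f x" if "x \<in> N" for x
  proof -
    have "p x \<in> p ` {y \<in> N. f y = f x}" using that by blast
    thus ?thesis using p by simp
  qed
  thus "p \<in> block_stab N f" using p by (simp add: block_stab_def)
qed

lemma row_stab_eq: "row_stab lam = block_stab {1..sum_list lam} (row_of lam)"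
proof -
  have "tableau_row lam i = {x \<in> {1..sum_list lam}. row_of lam x = i}" for i
  proof
    show "tableau_row lam i \<subseteq> {x \<in> {1..sum_list lam}. row_of lam x = i}"
      using cell_reading(1,2) by (fastforce simp: tableau_row_def row_of_def)
    show "{x \<in> {1..sum_list lam}. row_of lam x = i} \<subseteq> tableau_row lam i"
    proof
      fix x assume "x \<in> {x \<in> {1..sum_list lam}. row_of lam x = i}"
      hence "cell lam x \<in> diagram lam" "row_reading lam (cell lam x) = x" "cell lam x = (i, col_of lam x)"
        using cell_reading(3,4) cell_eq by auto
      thus "x \<in> tableau_row lam i" unfolding tableau_row_def by (metis (mono_tags, lifting) mem_Collect_eq)
    qed
  qed
  thus ?thesis by (simp add: row_stab_def block_stab_image)
qed

lemma col_stab_eq: "col_stab lam = block_stab {1..sum_list lam} (col_of lam)"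
proof -
  have "tableau_col lam j = {x \<in> {1..sum_list lam}. col_of lam x = j}" for j
  proof
    show "tableau_col lam j \<subseteq> {x \<in> {1..sum_list lam}. col_of lam x = j}"
      using cell_reading(1,2) by (fastforce simp: tableau_col_def col_of_def)
    show "{x \<in> {1..sum_list lam}. col_of lam x = j} \<subseteq> tableau_col lam j"
    proof
      fix x assume "x \<in> {x \<in> {1..sum_list lam}. col_of lam x = j}"
      hence "cell lam x \<in> diagram lam" "row_reading lam (cell lam x) = x" "cell lam x = (row_of lam x, j)"
        using cell_reading(3,4) cell_eq by auto
      thus "x \<in> tableau_col lam j" unfolding tableau_col_def by (metis (mono_tags, lifting) mem_Collect_eq)
    qed
  qed
  thus ?thesis by (simp add: col_stab_def block_stab_image)
qed

lemma finite_partitions: "finite (partitions n)"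
proof (rule finite_subset)
  have "length mu \<le> n \<and> set mu \<subseteq> {..n}" if "mu \<in> partitions n" for mu
  proof -
    have "0 \<notin> set mu \<Longrightarrow> length mu \<le> sum_list mu" for mu :: "nat list"
      by (induction mu) (auto simp: Suc_le_eq)
    thus ?thesis using that member_le_sum_list[of _ mu] by (auto simp: partitions_def)
  qed
  thus "partitions n \<subseteq> {mu. set mu \<subseteq> {..n} \<and> length mu \<le> n}" by blast
qed (simp add: finite_lists_length_le)

lemma partitions_mset_unique:
  assumes M: "0 \<notin># M" "sum_mset M = n"
  shows "\<exists>!mu. mu \<in> partitions n \<and> mset mu = M"
proof (rule ex1I)
  let ?mu = "rev (sorted_list_of_multiset M)"
  have "sum_list ?mu = n" using M(2) by (metis mset_rev mset_sorted_list_of_multiset sum_mset_sum_list)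
  moreover have "sorted_wrt (\<ge>) ?mu" by (simp add: sorted_wrt_rev)
  ultimately show "?mu \<in> partitions n \<and> mset ?mu = M" using M(1) by (simp add: partitions_def)
  fix mu assume mu: "mu \<in> partitions n \<and> mset mu = M"
  have "sorted (rev mu)" using mu by (simp add: partitions_def sorted_wrt_rev)
  hence "sorted_list_of_multiset M = rev mu"
    using mu by (metis mset_rev sort_key_id_if_sorted sorted_list_of_multiset_mset sorted_sort_id)
  thus "mu = ?mu" by simp
qed

lemma sum_cyc_type:
  assumes N: "finite N" and g: "g permutes N"
  shows "sum_mset (cyc_type N g) = card N" "0 \<notin># cyc_type N g"
proof -
  have "sum_mset (cyc_type N g) = sum card (orbit g ` N)"
    by (simp add: cyc_type_def sum_unfold_sum_mset)
  also have "\<dots> = card (\<Union>(orbit g ` N))"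
  proof (rule card_Union_disjoint[symmetric])
    show "pairwise disjnt (orbit g ` N)"
    proof (rule pairwiseI)
      fix U V assume "U \<in> orbit g ` N" "V \<in> orbit g ` N" "U \<noteq> V"
      thus "disjnt U V" unfolding disjnt_def using orbit_eq[OF N g] by blast
    qed
  qed (use finite_orbit_g[OF N g] in auto)
  also have "\<Union>(orbit g ` N) = N"
    using permutes_orbit_subset[OF g] in_orbit_self[OF N g] by blast
  finally show "sum_mset (cyc_type N g) = card N" .
  have "card (orbit g x) \<noteq> 0" for x
    using finite_orbit_g[OF N g, of x] orbit_nonempty[of g x] by simp
  moreover have "set_mset (cyc_type N g) = card ` orbit g ` N" using N by (simp add: cyc_type_def)
  ultimately show "0 \<notin># cyc_type N g" by (metis imageE)
qed

section \<open>The Schur zeta function\<close>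

lemma young_symmetrizer_eq:
  assumes lam: "sorted_wrt (\<ge>) lam"
  shows "young_symmetrizer lam = young_cells.symmetrize {1..sum_list lam} (row_of lam) (col_of lam) (delta id)"
proof
  interpret Y: young_cells "{1..sum_list lam}" "row_of lam" "col_of lam"
    by (rule young_cells_diagram[OF lam])
  fix g
  have "Y.polytabloid id g = (\<Sum>q\<in>Y.C. \<Sum>p\<in>Y.R. if g = inv p \<circ> inv q then of_int (sign (inv q)) else 0)"
    unfolding Y.symmetrize_apply
  proof (rule sum.cong[OF refl], rule sum.cong[OF refl])
    fix q p assume qp: "q \<in> Y.C" "p \<in> Y.R"
    have q: "q permutes {1..sum_list lam}" and p: "p permutes {1..sum_list lam}"
      by (rule Y.C_perm[OF qp(1)], rule Y.R_perm[OF qp(2)])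
    have "g \<circ> q \<circ> p = id \<longleftrightarrow> g = inv p \<circ> inv q"
    proof
      assume "g \<circ> q \<circ> p = id"
      hence "g \<circ> q \<circ> p \<circ> inv p \<circ> inv q = id \<circ> inv p \<circ> inv q" by simp
      thus "g = inv p \<circ> inv q" by (simp only: perm_comp_inv(5)[OF p] perm_comp_inv(5)[OF q] id_comp)
    next
      assume "g = inv p \<circ> inv q"
      thus "g \<circ> q \<circ> p = id"
        by (simp only: perm_comp_inv(6)[OF q] perm_comp_inv(2)[OF p])
    qed
    moreover have "sign (inv q) = sign q"
      by (rule sign_inverse[OF permutes_imp_permutation[OF _ q]]) simp
    ultimately show "of_int (sign q) * delta id (g \<circ> q \<circ> p)
        = (if g = inv p \<circ> inv q then of_int (sign (inv q)) else 0)"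
      by (simp add: delta_def)
  qed
  also have "\<dots> = (\<Sum>q\<in>Y.C. \<Sum>p\<in>Y.R. if g = p \<circ> inv q then of_int (sign (inv q)) else 0)"
    by (rule sum.cong[OF refl])
       (rule sum_group_inv[OF perm_group_stab, of "\<lambda>p. if g = p \<circ> inv _ then of_int (sign (inv _)) else 0"])
  also have "\<dots> = (\<Sum>q\<in>Y.C. \<Sum>p\<in>Y.R. if g = p \<circ> q then of_int (sign q) else 0)"
    by (rule sum_group_inv[OF perm_group_stab])
  also have "\<dots> = (\<Sum>p\<in>Y.R. \<Sum>q\<in>Y.C. if g = p \<circ> q then of_int (sign q) else 0)"
    by (rule sum.swap)
  also have "\<dots> = young_symmetrizer lam g"
    by (simp only: young_symmetrizer_def row_stab_eq col_stab_eq)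
  finally show "young_symmetrizer lam g = Y.polytabloid id g" ..
qed

lemma specht_eq:
  assumes lam: "sorted_wrt (\<ge>) lam"
  shows "specht lam = galg.span ((\<lambda>w. young_cells.symmetrize {1..sum_list lam} (row_of lam) (col_of lam) (delta w))
    ` {g. g permutes {1..sum_list lam}})"
proof -
  interpret Y: young_cells "{1..sum_list lam}" "row_of lam" "col_of lam"
    by (rule young_cells_diagram[OF lam])
  have "left_mult g (young_symmetrizer lam) = Y.polytabloid g" if "g permutes {1..sum_list lam}" for g
    unfolding young_symmetrizer_eq[OF lam] Y.left_mult_polytabloid[OF that] by simp
  hence "{left_mult g (young_symmetrizer lam) | g. g permutes {1..sum_list lam}} = Y.polytabloid ` Y.S"
    by (auto simp: image_def; metis)
  thus ?thesis by (simp only: specht_def)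
qed

lemma SSYT_row:
  assumes m: "m \<in> SSYT lam" and "(i, j) \<in> diagram lam" "(i, j') \<in> diagram lam" "j \<le> j'"
  shows "m (i, j) \<le> m (i, j')"
  using \<open>j \<le> j'\<close> \<open>(i, j') \<in> diagram lam\<close>
proof (induction j' rule: dec_induct)
  case (step k)
  have k: "(i, k) \<in> diagram lam" using step assms(2) by (auto simp: diagram_def)
  have "m (i, k) \<le> m (i, k + 1)" using m k step.prems by (auto simp: SSYT_def)
  thus ?case using step.IH[OF k] by simp
qed simp

text \<open>Reading a tableau row by row turns it into a word. Strictness of columns is required only between
adjacent cells of a tableau, but between all cells of a column of a semistandard word; the two
agree because there are no gaps in a column.\<close>

lemma schur_zeta_words:
  assumes lam: "sorted_wrt (\<ge>) lam"
  shows "schur_zeta lam (\<lambda>_. s) = infsum (monomial {1..sum_list lam} s)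
    {f \<in> words {1..sum_list lam}. young_cells.semistandard {1..sum_list lam} (row_of lam) (col_of lam) f}"
proof -
  let ?N = "{1..sum_list lam}"
  interpret Y: young_cells ?N "row_of lam" "col_of lam"
    by (rule young_cells_diagram[OF lam])
  define J where "J m = (\<lambda>x\<in>?N. m (cell lam x))" for m :: "nat \<times> nat \<Rightarrow> nat"
  define I where "I f = (\<lambda>c\<in>diagram lam. f (row_reading lam c))" for f :: "nat \<Rightarrow> nat"
  note cr = cell_reading[where lam = lam]
  show ?thesis
    unfolding schur_zeta_def
  proof (rule infsum_reindex_bij_witness[where i = I and j = J])
    fix m assume m: "m \<in> SSYT lam"
    have mPi: "m \<in> diagram lam \<rightarrow>\<^sub>E {1..}" using m by (simp add: SSYT_def)
    show "I (J m) = m"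
    proof
      fix c show "I (J m) c = m c"
        using cr(1,2)[of c] extensional_arb[of m "diagram lam" c] mPi
        by (cases "c \<in> diagram lam") (auto simp: I_def J_def PiE_def simp del: atLeastAtMost_iff)
    qed
    have "J m \<in> words ?N"
      unfolding words_def J_def using cr(3) mPi by (intro restrict_PiE_iff[THEN iffD2]) auto
    moreover have "Y.semistandard (J m)"
      unfolding Y.semistandard_def
    proof (intro conjI ballI impI)
      show "block_sorted ?N (row_of lam) (col_of lam) (J m)"
        unfolding block_sorted_def
      proof (intro ballI impI)
        fix x y assume "x \<in> ?N" "y \<in> ?N" "row_of lam x = row_of lam y" "col_of lam x < col_of lam y"
        thus "J m x \<le> J m y"
          using SSYT_row[OF m, of "row_of lam x" "col_of lam x" "col_of lam y"] cr(3)[of x] cr(3)[of y]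
          by (simp add: J_def cell_eq)
      qed
      fix x y assume xy: "x \<in> ?N" "y \<in> ?N" "col_of lam x = col_of lam y" "row_of lam x < row_of lam y"
      show "J m x < J m y"
      proof (rule Y.columns_strictI[OF _ xy])
        fix x y assume "x \<in> ?N" "y \<in> ?N" "col_of lam x = col_of lam y" "row_of lam y = Suc (row_of lam x)"
        thus "J m x < J m y"
          using m cr(3)[of x] cr(3)[of y] by (simp add: J_def cell_eq SSYT_def)
      qed
    qed
    ultimately show "J m \<in> {f \<in> words ?N. Y.semistandard f}" by blast
    have "monomial ?N s (J m) = (\<Prod>c\<in>diagram lam. of_nat (J m (row_reading lam c)) powr - s)"
      unfolding monomial_def by (rule prod.reindex_bij_betw[OF row_reading_bij, symmetric])
    also have "\<dots> = (\<Prod>c\<in>diagram lam. of_nat (m c) powr - s)"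
      by (rule prod.cong) (use cr(1,2) in \<open>auto simp: J_def simp del: atLeastAtMost_iff\<close>)
    finally show "monomial ?N s (J m) = (\<Prod>c\<in>diagram lam. of_nat (m c) powr - s)" .
  next
    fix f assume f: "f \<in> {f \<in> words ?N. Y.semistandard f}"
    have fw: "f \<in> ?N \<rightarrow>\<^sub>E {1..}" using f by (simp add: words_def)
    show "J (I f) = f"
    proof
      fix x show "J (I f) x = f x"
        using cr(3,4)[of x] extensional_arb[of f ?N x] fw
        by (cases "x \<in> ?N") (auto simp: I_def J_def PiE_def simp del: atLeastAtMost_iff)
    qed
    have at: "row_of lam (row_reading lam (i, j)) = i" "col_of lam (row_reading lam (i, j)) = j"
      "row_reading lam (i, j) \<in> ?N" if "(i, j) \<in> diagram lam" for i j
      using cr(1,2)[OF that] by (simp_all add: row_of_def col_of_def)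
    have bs: "f x \<le> f y" if "x \<in> ?N" "y \<in> ?N" "row_of lam x = row_of lam y" "col_of lam x < col_of lam y" for x y
      using f that unfolding Y.semistandard_def block_sorted_def by blast
    have cs: "f x < f y" if "x \<in> ?N" "y \<in> ?N" "col_of lam x = col_of lam y" "row_of lam x < row_of lam y" for x y
      using f that unfolding Y.semistandard_def by blast
    have "I f \<in> diagram lam \<rightarrow>\<^sub>E {1..}"
      unfolding I_def using cr(2) fw by (intro restrict_PiE_iff[THEN iffD2]) blast
    moreover have "I f (i, j) \<le> I f (i, j + 1)" if "(i, j) \<in> diagram lam" "(i, j + 1) \<in> diagram lam" for i j
      using bs[OF at(3)[OF that(1)] at(3)[OF that(2)]] at(1,2)[OF that(1)] at(1,2)[OF that(2)] that
      by (simp add: I_def)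
    moreover have "I f (i, j) < I f (i + 1, j)" if "(i, j) \<in> diagram lam" "(i + 1, j) \<in> diagram lam" for i j
      using cs[OF at(3)[OF that(1)] at(3)[OF that(2)]] at(1,2)[OF that(1)] at(1,2)[OF that(2)] that
      by (simp add: I_def)
    ultimately show "I f \<in> SSYT lam" unfolding SSYT_def by blast
  qed
qed

theorem proposition2p5:
  fixes n :: nat and lam :: "nat list" and s :: complex
  assumes "n > 0" and "lam \<in> partitions n" and "Re s > 1"
  shows "(\<forall>mu\<in>partitions n. chi lam mu \<in> \<int>) \<and>
         schur_zeta lam (\<lambda>_. s) =
           (\<Sum>mu\<in>partitions n. chi lam mu / of_nat (z_part mu) *
              (\<Prod>i<length mu. riemann_zeta (of_nat (mu ! i) * s)))"
proof -
  have lam: "sorted_wrt (\<ge>) lam" and sum_lam: "sum_list lam = n"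
    using assms(2) by (auto simp: partitions_def)
  let ?N = "{1..n}"
  interpret Y: young_cells ?N "row_of lam" "col_of lam"
    using young_cells_diagram[OF lam] sum_lam by simp
  define Z where "Z M = (\<Prod>k\<in>#M. riemann_zeta (of_nat k * s))" for M
  define A where "A mu = (\<Sum>q\<in>Y.C. \<Sum>p\<in>Y.R. of_int (sign q) * of_bool (cyc_type ?N (q \<circ> p) = mset mu)) / Y.symmetrizer_scalar"
    for mu
  have chi: "chi lam mu \<in> \<int> \<and> chi lam mu / of_nat (z_part mu) = A mu" if mu: "mu \<in> partitions n" for mu
  proof -
    have mu': "0 \<notin> set mu" "sum_list mu = n" using mu by (auto simp: partitions_def)
    define g where "g = (SOME g. g permutes {1..sum_list lam} \<and> cycle_type (sum_list lam) g = mset mu)"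
    have "\<exists>g. g permutes {1..sum_list lam} \<and> cycle_type (sum_list lam) g = mset mu"
      using permutation_of_cycle_type[OF mu'(1)] by (simp only: mu'(2) sum_lam cycle_type_def cyc_type_def)
    from someI_ex[OF this] have g: "g permutes ?N" "cyc_type ?N g = mset mu"
      unfolding g_def[symmetric] by (simp_all add: sum_lam cycle_type_def cyc_type_def)
    have c: "chi lam mu = trace_on (galg.span (Y.polytabloid ` Y.S)) (left_mult g)"
      unfolding chi_def irr_char_def g_def[symmetric] unfolding specht_eq[OF lam] sum_lam ..
    have "z_mset (mset mu) > 0" by (rule z_mset_pos) (use mu' in simp)
    hence "chi lam mu / of_nat (z_part mu) = A mu"
      unfolding c Y.trace_on_specht(1)[OF g(1)] Y.trace_class_sum[OF g(1)] g(2) z_part_mset A_def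
      by simp
    thus ?thesis using Y.trace_on_specht(2)[OF g(1)] c by simp
  qed
  have Zmu: "(\<Prod>i<length mu. riemann_zeta (of_nat (mu ! i) * s)) = Z (mset mu)" for mu
  proof -
    have "Z (mset mu) = prod_list (map (\<lambda>k. riemann_zeta (of_nat k * s)) mu)"
      by (simp add: Z_def prod_mset_prod_list flip: mset_map)
    thus ?thesis by (simp add: prod.list_conv_set_nth atLeast0LessThan)
  qed
  have pick: "(\<Sum>mu\<in>partitions n. of_bool (M = mset mu) * Z (mset mu)) = Z M"
    if M: "0 \<notin># M" "sum_mset M = n" for M
  proof -
    obtain nu where nu: "nu \<in> partitions n" "mset nu = M"
      and uniq: "\<And>mu. mu \<in> partitions n \<Longrightarrow> mset mu = M \<Longrightarrow> mu = nu"
      using partitions_mset_unique[OF M] by blast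
    have "(\<Sum>mu\<in>partitions n. of_bool (M = mset mu) * Z (mset mu)) = (\<Sum>mu\<in>partitions n. if mu = nu then Z M else 0)"
    proof (rule sum.cong)
      fix mu assume mu: "mu \<in> partitions n"
      have "M = mset mu \<longleftrightarrow> mu = nu" using uniq[OF mu] nu(2) by blast
      thus "of_bool (M = mset mu) * Z (mset mu) = (if mu = nu then Z M else 0)" using nu(2) by simp
    qed simp
    thus ?thesis using nu(1) finite_partitions by simp
  qed
  have "schur_zeta lam (\<lambda>_. s) = (\<Sum>q\<in>Y.C. \<Sum>p\<in>Y.R. of_int (sign q) * Z (cyc_type ?N (q \<circ> p))) / Y.symmetrizer_scalar"
    using schur_zeta_words[OF lam, of s] Y.infsum_semistandard[OF assms(3)] by (simp add: sum_lam Z_def)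
  also have "(\<Sum>q\<in>Y.C. \<Sum>p\<in>Y.R. of_int (sign q) * Z (cyc_type ?N (q \<circ> p)))
    = (\<Sum>q\<in>Y.C. \<Sum>p\<in>Y.R. \<Sum>mu\<in>partitions n.
        of_int (sign q) * (of_bool (cyc_type ?N (q \<circ> p) = mset mu) * Z (mset mu)))"
  proof (rule sum.cong[OF refl], rule sum.cong[OF refl])
    fix q p assume "q \<in> Y.C" "p \<in> Y.R"
    hence "(q \<circ> p) permutes ?N" by (intro permutes_compose Y.R_perm Y.C_perm)
    note type = sum_cyc_type[OF _ this]
    show "of_int (sign q) * Z (cyc_type ?N (q \<circ> p)) = (\<Sum>mu\<in>partitions n.
        of_int (sign q) * (of_bool (cyc_type ?N (q \<circ> p) = mset mu) * Z (mset mu)))"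
      unfolding sum_distrib_left[symmetric] by (subst pick) (use type in simp_all)
  qed
  also have "\<dots> = (\<Sum>q\<in>Y.C. \<Sum>mu\<in>partitions n. \<Sum>p\<in>Y.R.
        of_int (sign q) * (of_bool (cyc_type ?N (q \<circ> p) = mset mu) * Z (mset mu)))"
    by (intro sum.cong refl sum.swap)
  also have "\<dots> = (\<Sum>mu\<in>partitions n. \<Sum>q\<in>Y.C. \<Sum>p\<in>Y.R.
        of_int (sign q) * (of_bool (cyc_type ?N (q \<circ> p) = mset mu) * Z (mset mu)))"
    by (rule sum.swap)
  also have "\<dots> / Y.symmetrizer_scalar = (\<Sum>mu\<in>partitions n. A mu * Z (mset mu))"
    unfolding sum_divide_distrib[of _ "partitions n"]
    by (rule sum.cong) (simp_all add: A_def sum_distrib_right mult.assoc)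
  also have "\<dots> = (\<Sum>mu\<in>partitions n. chi lam mu / of_nat (z_part mu) *
              (\<Prod>i<length mu. riemann_zeta (of_nat (mu ! i) * s)))"
    by (rule sum.cong) (use chi Zmu in simp_all)
  finally show ?thesis using chi by blast
qed

end
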